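(* Let $n \ge 4$ and $\frac{1}{\sqrt 3} \le t \le 1$. Then for all $a \in S^{n-1}$ $$A_1(a,t) \le A_1(a^{(1)},t) = \frac{2^{n-1}}{(n-1)!}\,(1-t)^{n-1},$$ i.e. the maximal hyperplane sections at distance $t$ from the origin are parallel to coordinate hyperplanes. For $n=3$ and $\frac{1}{\sqrt 3} \le t \le 1$, the inequality $A_1(a,t) \le A_1(a^{(1)},t)$ for all $a \in S^{2}$ holds only for (that is, if and only if) $t \in \left[\sqrt 2 - 1 + \sqrt{5 - \tfrac{7}{\sqrt 2}},\, 1\right]$ (the left endpoint is approximately $0.6384$).
   Context: For $n \in \mathbb{N}$ let $B_1^n := \{x \in \mathbb{R}^n : \|x\|_1 \le 1\}$ be the real $l_1^n$-ball, and let $S^{n-1} \subset \mathbb{R}^n$ be the Euclidean unit sphere. For $a \in S^{n-1}$ and $t \ge 0$ define the parallel section function $$A_1(a,t) := \mathrm{vol}_{n-1}(\{x \in B_1^n : \langle x,a\rangle = t\}),$$ where $\mathrm{vol}_{n-1}$ is $(n-1)$-dimensional Lebesgue measure on the hyperplane. Put $a^{(1)} := (1,0,\dots,0) \in S^{n-1}$. "The maximal sections at distance $t$ are parallel to coordinate hyperplanes" means that $A_1(a,t) \le A_1(a^{(1)},t)$ for all $a\in S^{n-1}$. *)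

theory Defs
  imports "HOL-Analysis.Analysis"
begin

definition l1_unit_ball :: "(real ^ 'n) set" where
  "l1_unit_ball = {x. (\<Sum>i\<in>UNIV. \<bar>x $ i\<bar>) \<le> 1}"

definition hyperplane :: "'a::euclidean_space \<Rightarrow> real \<Rightarrow> 'a set" where
  "hyperplane a t = {x. x \<bullet> a = t}"

definition orthonormal_basis_of :: "'a::euclidean_space set \<Rightarrow> 'a set \<Rightarrow> bool" where
  "orthonormal_basis_of V B \<longleftrightarrow> pairwise orthogonal B \<and> (\<forall>b\<in>B. norm b = 1) \<and> span B = V"

text \<open>Lebesgue measure on the affine subspace \<open>p + span B\<close>, for \<open>B\<close> orthonormal: the image of the
  product Lebesgue measure under the isometric parametrization by \<open>B\<close>-coordinates. For \<open>p = 0\<close> and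
  \<open>B = Basis\<close> this is verbatim the library's characterization \<open>lborel_eq\<close> of \<open>lborel\<close>.\<close>

definition flat_lborel :: "'a::euclidean_space \<Rightarrow> 'a set \<Rightarrow> 'a measure" where
  "flat_lborel p B = distr (\<Pi>\<^sub>M b\<in>B. lborel) borel (\<lambda>f. p + (\<Sum>b\<in>B. f b *\<^sub>R b))"

text \<open>The \<open>n - 1\<close>-dimensional Lebesgue measure on \<open>hyperplane a t\<close> for a unit vector \<open>a\<close>, as a Borel
  measure on the ambient space. Such a hyperplane has foot point \<open>t *\<^sub>R a\<close> and direction space
  \<open>hyperplane a 0\<close>; the choice of the basis is immaterial, see \<open>hyperplane_lborel_eq\<close> below.\<close>

definition hyperplane_lborel :: "'a::euclidean_space \<Rightarrow> real \<Rightarrow> 'a measure" where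
  "hyperplane_lborel a t =
     flat_lborel (t *\<^sub>R a) (SOME B. orthonormal_basis_of (hyperplane a 0) B)"

definition parallel_section :: "real ^ 'n \<Rightarrow> real \<Rightarrow> real" where
  "parallel_section a t = measure (hyperplane_lborel a t) (l1_unit_ball \<inter> hyperplane a t)"

lemma orthonormal_basis_of_hyperplane_exists:
  "\<exists>B. orthonormal_basis_of (hyperplane a 0) B"
proof -
  have "subspace (hyperplane a 0)"
    by (auto simp: hyperplane_def subspace_def inner_add_left)
  then show ?thesis
    unfolding orthonormal_basis_of_def by (metis orthonormal_basis_subspace)
qed

lemma orthonormal_basis_of_finite:
  "orthonormal_basis_of V B \<Longrightarrow> finite B"
  by (simp add: orthonormal_basis_of_def pairwise_orthogonal_imp_finite)

lemma distr_lborel_orthogonal_transformation: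
  fixes T :: "'a::euclidean_space \<Rightarrow> 'a"
  assumes T: "orthogonal_transformation T"
  shows "distr lborel borel T = lborel"
proof (rule measure_eqI)
  let ?M = "distr lborel borel T"
  show "sets ?M = sets lborel" by simp
  have lin: "linear T" using T by (rule orthogonal_transformation_linear)
  have T_meas [measurable]: "T \<in> borel_measurable borel"
    by (intro borel_measurable_continuous_onI linear_continuous_on linear_conv_bounded_linear[THEN iffD1] lin)
  have nrm: "norm (T x) = norm x" for x using T by (rule orthogonal_transformation_norm)
  have ball: "emeasure ?M (ball 0 1) = emeasure lborel (ball 0 (1::real) :: 'a set)"
  proof -
    have "T -` ball 0 1 \<inter> space lborel = ball 0 1" by (auto simp: nrm)
    then show ?thesis by (simp add: emeasure_distr)
  qed
  have trans_l: "(\<integral>\<^sup>+x. f (c + x) \<partial>lborel) = (\<integral>\<^sup>+x. f x \<partial>lborel)"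
    if [measurable]: "f \<in> borel_measurable borel" for f :: "'a \<Rightarrow> ennreal" and c
    by (subst (2) lborel_distr_plus[of c, symmetric]) (simp add: nn_integral_distr)
  have trans_M: "(\<integral>\<^sup>+x. f (c + x) \<partial>?M) = (\<integral>\<^sup>+x. f x \<partial>?M)"
    if [measurable]: "f \<in> borel_measurable borel" for f :: "'a \<Rightarrow> ennreal" and c
  proof -
    obtain d where d: "c = T d" using orthogonal_transformation_surj[OF T] by (metis surjD)
    have "(\<integral>\<^sup>+x. f (c + x) \<partial>?M) = (\<integral>\<^sup>+x. f (T (d + x)) \<partial>lborel)"
      by (simp add: nn_integral_distr d linear_add[OF lin])
    also have "\<dots> = (\<integral>\<^sup>+x. f (T x) \<partial>lborel)"
      by (rule trans_l[of "\<lambda>x. f (T x)"]) measurable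
    finally show ?thesis by (simp add: nn_integral_distr)
  qed
  have neg_l: "(\<integral>\<^sup>+x. f (- x) \<partial>lborel) = (\<integral>\<^sup>+x. f x \<partial>lborel)"
    if [measurable]: "f \<in> borel_measurable borel" for f :: "'a \<Rightarrow> ennreal"
    by (subst (2) lborel_affine[of "-1" 0]) (simp_all add: nn_integral_density nn_integral_distr)
  have "bij T" using T by (rule orthogonal_transformation_bij)
  have "sigma_finite_measure ?M"
  proof
    show "\<exists>A. countable A \<and> A \<subseteq> sets ?M \<and> \<Union>A = space ?M \<and> (\<forall>a\<in>A. emeasure ?M a \<noteq> \<infinity>)"
    proof (intro exI conjI)
      let ?A = "range (\<lambda>n::nat. ball (0::'a) (real n))"
      show "countable ?A" by simp
      show "?A \<subseteq> sets ?M" by auto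
      show "\<Union>?A = space ?M" using reals_Archimedean2 by auto
      have "T -` ball 0 r \<inter> space lborel = ball 0 r" for r by (auto simp: nrm)
      then show "\<forall>a\<in>?A. emeasure ?M a \<noteq> \<infinity>"
        using emeasure_lborel_ball_finite by (auto simp: emeasure_distr less_top)
    qed
  qed
  then interpret pair_sigma_finite lborel ?M
    by (simp add: pair_sigma_finite_def sigma_finite_lborel)
  fix A assume "A \<in> sets ?M"
  then have [measurable]: "A \<in> sets borel" by simp
  have [measurable]: "ball (0::'a) 1 \<in> sets borel" by simp
  let ?f = "indicator (ball 0 1) :: 'a \<Rightarrow> ennreal" and ?g = "indicator A :: 'a \<Rightarrow> ennreal"
  have [measurable]: "?f \<in> borel_measurable borel" "?g \<in> borel_measurable borel"
    by (simp_all add: borel_measurable_indicator)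
  have pair: "h \<in> borel_measurable (lborel \<Otimes>\<^sub>M ?M)" if "h \<in> borel_measurable (borel \<Otimes>\<^sub>M borel)"
    for h :: "'a \<times> 'a \<Rightarrow> ennreal"
  proof -
    have "sets (lborel \<Otimes>\<^sub>M ?M) = sets (borel \<Otimes>\<^sub>M (borel :: 'a measure))"
      by (rule sets_pair_measure_cong) simp_all
    then show ?thesis using that by (simp cong: measurable_cong_sets)
  qed
  have m1: "(\<lambda>(y, x). ?f x * ?g (x + y)) \<in> borel_measurable (borel \<Otimes>\<^sub>M borel)"
  proof -
    have "(\<lambda>p. ?f (snd p)) \<in> borel_measurable (borel \<Otimes>\<^sub>M borel)"
      by (rule measurable_compose[of snd _ borel ?f]) simp_all
    moreover have "(\<lambda>p. ?g (snd p + fst p)) \<in> borel_measurable (borel \<Otimes>\<^sub>M borel)"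
      by (rule measurable_compose[of "\<lambda>p. snd p + fst p" _ borel ?g]) simp_all
    ultimately show ?thesis by (simp add: case_prod_beta)
  qed
  have m2: "(\<lambda>(y, x). ?f (- y + x) * ?g x) \<in> borel_measurable (borel \<Otimes>\<^sub>M borel)"
  proof -
    have "(\<lambda>p. ?f (- fst p + snd p)) \<in> borel_measurable (borel \<Otimes>\<^sub>M borel)"
      by (rule measurable_compose[of "\<lambda>p. - fst p + snd p" _ borel ?f]) simp_all
    moreover have "(\<lambda>p. ?g (snd p)) \<in> borel_measurable (borel \<Otimes>\<^sub>M borel)"
      by (rule measurable_compose[of snd _ borel ?g]) simp_all
    ultimately show ?thesis by (simp add: case_prod_beta)
  qed
  have "emeasure ?M (ball 0 1) * emeasure lborel A = (\<integral>\<^sup>+x. ?f x * (\<integral>\<^sup>+y. ?g y \<partial>lborel) \<partial>?M)"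
    by (subst nn_integral_multc) (simp_all add: borel_measurable_indicator)
  also have "\<dots> = (\<integral>\<^sup>+x. (\<integral>\<^sup>+y. ?f x * ?g (x + y) \<partial>lborel) \<partial>?M)"
  proof (rule nn_integral_cong)
    fix x
    show "?f x * (\<integral>\<^sup>+y. ?g y \<partial>lborel) = (\<integral>\<^sup>+y. ?f x * ?g (x + y) \<partial>lborel)"
      using trans_l[of ?g x] by (simp add: nn_integral_cmult)
  qed
  also have "\<dots> = (\<integral>\<^sup>+y. (\<integral>\<^sup>+x. ?f x * ?g (x + y) \<partial>?M) \<partial>lborel)"
    by (rule Fubini') (rule pair[OF m1])
  also have "\<dots> = (\<integral>\<^sup>+y. (\<integral>\<^sup>+x. ?f (- y + x) * ?g x \<partial>?M) \<partial>lborel)"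
  proof (rule nn_integral_cong)
    fix y
    show "(\<integral>\<^sup>+x. ?f x * ?g (x + y) \<partial>?M) = (\<integral>\<^sup>+x. ?f (- y + x) * ?g x \<partial>?M)"
      using trans_M[of "\<lambda>x. ?f x * ?g (x + y)" "- y"] by simp
  qed
  also have "\<dots> = (\<integral>\<^sup>+x. (\<integral>\<^sup>+y. ?f (- y + x) * ?g x \<partial>lborel) \<partial>?M)"
    by (rule Fubini'[symmetric]) (rule pair[OF m2])
  also have "\<dots> = (\<integral>\<^sup>+x. (\<integral>\<^sup>+y. ?f (x + y) \<partial>lborel) * ?g x \<partial>?M)"
  proof (rule nn_integral_cong)
    fix x
    show "(\<integral>\<^sup>+y. ?f (- y + x) * ?g x \<partial>lborel) = (\<integral>\<^sup>+y. ?f (x + y) \<partial>lborel) * ?g x"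
      using neg_l[of "\<lambda>y. ?f (x + y)"] by (simp add: nn_integral_multc)
  qed
  also have "\<dots> = emeasure lborel (ball 0 1 :: 'a set) * emeasure ?M A"
  proof -
    have "(\<integral>\<^sup>+y. ?f (x + y) \<partial>lborel) = emeasure lborel (ball 0 1 :: 'a set)" for x :: 'a
      using trans_l[of ?f x] by simp
    then show ?thesis by (simp add: nn_integral_cmult)
  qed
  finally have "emeasure lborel (ball 0 1 :: 'a set) * emeasure lborel A
      = emeasure lborel (ball 0 1 :: 'a set) * emeasure ?M A"
    by (simp only: ball)
  moreover have "emeasure lborel (ball 0 1 :: 'a set) \<noteq> 0"
  proof
    assume "emeasure lborel (ball 0 1 :: 'a set) = 0"
    then have "measure lborel (ball 0 1 :: 'a set) = 0" by (simp add: measure_def)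
    then show False using content_ball_pos[of 1 "0::'a"] by simp
  qed
  moreover have "emeasure lborel (ball 0 1 :: 'a set) \<noteq> \<infinity>"
    using emeasure_lborel_ball_finite[of "0::'a" 1] by auto
  ultimately show "emeasure ?M A = emeasure lborel A"
    by (auto simp: ennreal_mult_cancel_left)
qed

lemma flat_lborel_UNIV:
  fixes C :: "'a::euclidean_space set"
  assumes C: "orthonormal_basis_of UNIV C"
  shows "flat_lborel 0 C = lborel"
proof -
  have fin: "finite C" using C by (rule orthonormal_basis_of_finite)
  have inn: "b \<bullet> c = (if b = c then 1 else 0)" if "b \<in> C" "c \<in> C" for b c
    using C that by (auto simp: orthonormal_basis_of_def pairwise_def orthogonal_def dot_square_norm)
  have "0 \<notin> C" using C by (auto simp: orthonormal_basis_of_def)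
  then have "independent C"
    using C by (simp add: orthonormal_basis_of_def pairwise_orthogonal_independent)
  then have "card C = DIM('a)"
    using C by (simp add: orthonormal_basis_of_def dim_eq_card_independent flip: dim_span)
      (metis dim_UNIV dim_eq_card_independent dim_span)
  then obtain \<pi> where \<pi>: "bij_betw \<pi> (Basis :: 'a set) C"
    using fin finite_same_card_bij[of "Basis :: 'a set" C] by auto
  define \<rho> where "\<rho> = inv_into Basis \<pi>"
  have \<rho>: "bij_betw \<rho> C Basis" unfolding \<rho>_def by (rule bij_betw_inv_into[OF \<pi>])
  have \<pi>\<rho>: "\<pi> (\<rho> c) = c" if "c \<in> C" for c
    unfolding \<rho>_def using \<pi> that by (simp add: bij_betw_inv_into_right)
  have \<rho>B: "\<rho> c \<in> Basis" if "c \<in> C" for c using \<rho> that by (rule bij_betwE[THEN bspec])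
  have \<pi>C: "\<pi> b \<in> C" if "b \<in> Basis" for b using \<pi> that by (rule bij_betwE[THEN bspec])
  have \<pi>inj: "\<pi> b = \<pi> c \<longleftrightarrow> b = c" if "b \<in> Basis" "c \<in> Basis" for b c
    using \<pi> that by (auto simp: bij_betw_def inj_on_def)
  have \<rho>inj: "\<rho> b = \<rho> c \<longleftrightarrow> b = c" if "b \<in> C" "c \<in> C" for b c
    using \<rho> that by (auto simp: bij_betw_def inj_on_def)
  interpret product_sigma_finite "\<lambda>_::'a. lborel :: real measure" ..
  define g where "g f = (\<Sum>c\<in>C. f c *\<^sub>R \<rho> c)" for f :: "'a \<Rightarrow> real"
  have g_inner: "g f \<bullet> \<rho> c = f c" if "c \<in> C" for f c
  proof -
    have "g f \<bullet> \<rho> c = (\<Sum>d\<in>C. if d = c then f d else 0)"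
      unfolding g_def inner_sum_left using that
      by (intro sum.cong) (auto simp: inner_Basis \<rho>B \<rho>inj)
    then show ?thesis using fin that by simp
  qed
  have g_meas [measurable]: "g \<in> borel_measurable (\<Pi>\<^sub>M c\<in>C. lborel)"
    unfolding g_def by measurable
  have lb: "lborel = distr (\<Pi>\<^sub>M c\<in>C. lborel) borel g"
  proof (rule lborel_eqI)
    fix l u :: 'a
    assume le: "\<And>b. b \<in> Basis \<Longrightarrow> l \<bullet> b \<le> u \<bullet> b"
    have "g -` box l u \<inter> space (\<Pi>\<^sub>M c\<in>C. lborel) = (\<Pi>\<^sub>E c\<in>C. {l \<bullet> \<rho> c <..< u \<bullet> \<rho> c})"
    proof -
      have "g f \<in> box l u \<longleftrightarrow> (\<forall>c\<in>C. f c \<in> {l \<bullet> \<rho> c <..< u \<bullet> \<rho> c})" for f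
      proof -
        have "g f \<in> box l u \<longleftrightarrow> (\<forall>b\<in>\<rho> ` C. l \<bullet> b < g f \<bullet> b \<and> g f \<bullet> b < u \<bullet> b)"
          using \<rho> by (simp add: mem_box bij_betw_def)
        then show ?thesis by (simp add: g_inner)
      qed
      then show ?thesis by (auto simp: space_PiM PiE_iff)
    qed
    then have "emeasure (distr (\<Pi>\<^sub>M c\<in>C. lborel) borel g) (box l u)
        = (\<Prod>c\<in>C. emeasure lborel {l \<bullet> \<rho> c <..< u \<bullet> \<rho> c})"
      by (simp add: emeasure_distr emeasure_PiM fin)
    also have "\<dots> = (\<Prod>c\<in>C. ennreal ((u - l) \<bullet> \<rho> c))"
      by (intro prod.cong) (auto simp: le \<rho>B inner_diff_left)
    also have "\<dots> = (\<Prod>b\<in>Basis. ennreal ((u - l) \<bullet> b))"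
      by (rule prod.reindex_bij_betw[OF \<rho>])
    also have "\<dots> = ennreal (\<Prod>b\<in>Basis. (u - l) \<bullet> b)"
      by (rule prod_ennreal) (simp add: le inner_diff_left)
    finally show "emeasure (distr (\<Pi>\<^sub>M c\<in>C. lborel) borel g) (box l u)
        = (\<Prod>b\<in>Basis. (u - l) \<bullet> b)" .
  qed simp
  define T where "T x = (\<Sum>b\<in>Basis. (x \<bullet> b) *\<^sub>R \<pi> b)" for x :: 'a
  have linT: "linear T"
    unfolding T_def by (rule linearI) (simp_all add: inner_add_left scaleR_add_left sum.distrib scaleR_sum_right)
  have "T v \<bullet> T w = v \<bullet> w" for v w
  proof -
    have "T v \<bullet> T w = (\<Sum>b\<in>Basis. \<Sum>c\<in>Basis. (v \<bullet> b) * (w \<bullet> c) * (\<pi> b \<bullet> \<pi> c))"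
      unfolding T_def by (simp add: inner_sum_left inner_sum_right sum_distrib_left mult.assoc, subst sum.swap, simp add: mult_ac)
    also have "\<dots> = (\<Sum>b\<in>Basis. \<Sum>c\<in>Basis. if b = c then (v \<bullet> b) * (w \<bullet> c) else 0)"
      by (intro sum.cong) (auto simp: inn \<pi>C \<pi>inj)
    also have "\<dots> = v \<bullet> w" by (simp add: euclidean_inner[of v w])
    finally show ?thesis .
  qed
  with linT have T: "orthogonal_transformation T" by (simp add: orthogonal_transformation_def)
  have [measurable]: "T \<in> borel_measurable borel"
    by (intro borel_measurable_continuous_onI linear_continuous_on linear_conv_bounded_linear[THEN iffD1] linT)
  have Tb: "T b = \<pi> b" if "b \<in> Basis" for b
  proof -
    have "T b = (\<Sum>c\<in>Basis. if b = c then \<pi> c else 0)"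
      unfolding T_def using that by (intro sum.cong) (auto simp: inner_Basis)
    then show ?thesis using that by simp
  qed
  have Tg: "T (g f) = (\<Sum>c\<in>C. f c *\<^sub>R c)" for f
    unfolding g_def linear_sum[OF linT]
    by (intro sum.cong) (simp_all add: linear_scale[OF linT] Tb \<rho>B \<pi>\<rho>)
  have "lborel = distr (distr (\<Pi>\<^sub>M c\<in>C. lborel) borel g) borel T"
    using distr_lborel_orthogonal_transformation[OF T] lb by simp
  also have "\<dots> = distr (\<Pi>\<^sub>M c\<in>C. lborel) borel (\<lambda>f. \<Sum>c\<in>C. f c *\<^sub>R c)"
    by (simp add: distr_distr comp_def Tg)
  finally show ?thesis by (simp add: flat_lborel_def)
qed

lemma emeasure_flat_lborel_eq_cylinder:
  fixes a :: "'a::euclidean_space"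
  assumes a: "norm a = 1" and B: "orthonormal_basis_of (hyperplane a 0) B"
    and S [measurable]: "S \<in> sets borel"
  shows "emeasure (flat_lborel (t *\<^sub>R a) B) S =
    emeasure lborel {x. x \<bullet> a \<in> {0..1} \<and> t *\<^sub>R a + (x - (x \<bullet> a) *\<^sub>R a) \<in> S}"
    (is "_ = emeasure lborel ?Z")
proof -
  have fin: "finite B" using B by (rule orthonormal_basis_of_finite)
  have Ba: "b \<bullet> a = 0" if "b \<in> B" for b
    using B that span_base[of b B] by (auto simp: orthonormal_basis_of_def hyperplane_def)
  have aa: "a \<bullet> a = 1" using a by (simp add: dot_square_norm)
  have aB: "a \<notin> B" using Ba aa by auto
  have "x \<in> span (insert a B)" for x
  proof -
    have "x - (x \<bullet> a) *\<^sub>R a \<in> span B"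
      using B aa by (auto simp: orthonormal_basis_of_def hyperplane_def inner_diff_left)
    then show ?thesis unfolding span_insert by blast
  qed
  then have C: "orthonormal_basis_of UNIV (insert a B)"
    using B a Ba by (auto simp: orthonormal_basis_of_def pairwise_insert orthogonal_def inner_commute)
  interpret product_sigma_finite "\<lambda>_::'a. lborel :: real measure" ..
  have Zm [measurable]: "?Z \<in> sets borel" by measurable
  let ?h = "\<lambda>f::'a \<Rightarrow> real. \<Sum>b\<in>B. f b *\<^sub>R b"
  let ?P = "\<Pi>\<^sub>M b\<in>B. (lborel :: real measure)"
  have ha: "?h f \<bullet> a = 0" for f by (simp add: inner_sum_left Ba)
  have upd: "(\<Sum>b\<in>insert a B. (f(a := s)) b *\<^sub>R b) = s *\<^sub>R a + ?h f" for f s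
  proof -
    have "(\<Sum>b\<in>B. (f(a := s)) b *\<^sub>R b) = ?h f" using aB by (intro sum.cong) auto
    then show ?thesis using fin aB by simp
  qed
  have ind: "indicator ?Z (s *\<^sub>R a + ?h f) = indicator {0..1} s * (indicator S (t *\<^sub>R a + ?h f) :: ennreal)"
    for f s by (auto simp: indicator_def inner_add_left ha aa)
  have "emeasure lborel ?Z = (\<integral>\<^sup>+x. indicator ?Z x \<partial>flat_lborel 0 (insert a B))"
    by (simp add: flat_lborel_UNIV[OF C])
  also have "\<dots> = (\<integral>\<^sup>+f. indicator ?Z (\<Sum>b\<in>insert a B. f b *\<^sub>R b) \<partial>(\<Pi>\<^sub>M b\<in>insert a B. lborel))"
    unfolding flat_lborel_def by (subst nn_integral_distr) simp_all
  also have "\<dots> = (\<integral>\<^sup>+f. (\<integral>\<^sup>+s. indicator ?Z (\<Sum>b\<in>insert a B. (f(a := s)) b *\<^sub>R b) \<partial>lborel) \<partial>?P)"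
    by (rule product_nn_integral_insert[OF fin aB]) measurable
  also have "\<dots> = (\<integral>\<^sup>+f. (\<integral>\<^sup>+s. indicator {0..1::real} s * indicator S (t *\<^sub>R a + ?h f) \<partial>lborel) \<partial>?P)"
    by (simp only: upd ind)
  also have "\<dots> = (\<integral>\<^sup>+f. indicator S (t *\<^sub>R a + ?h f) \<partial>?P)"
  proof (rule nn_integral_cong)
    fix f
    show "(\<integral>\<^sup>+s. indicator {0..1::real} s * indicator S (t *\<^sub>R a + ?h f) \<partial>lborel)
        = (indicator S (t *\<^sub>R a + ?h f) :: ennreal)"
      using emeasure_lborel_Icc[of 0 "1::real"]
      by (subst nn_integral_multc) (simp_all add: borel_measurable_indicator)
  qed
  also have "\<dots> = (\<integral>\<^sup>+x. indicator S x \<partial>flat_lborel (t *\<^sub>R a) B)"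
    unfolding flat_lborel_def by (subst nn_integral_distr) simp_all
  also have "\<dots> = emeasure (flat_lborel (t *\<^sub>R a) B) S"
    by (simp add: flat_lborel_def)
  finally show ?thesis by simp
qed

theorem hyperplane_lborel_eq:
  fixes a :: "'a::euclidean_space"
  assumes a: "norm a = 1" and B: "orthonormal_basis_of (hyperplane a 0) B"
  shows "hyperplane_lborel a t = flat_lborel (t *\<^sub>R a) B"
proof -
  have B': "orthonormal_basis_of (hyperplane a 0) (SOME B. orthonormal_basis_of (hyperplane a 0) B)"
    by (rule someI_ex) (rule orthonormal_basis_of_hyperplane_exists)
  show ?thesis unfolding hyperplane_lborel_def
  proof (rule measure_eqI)
    fix S assume "S \<in> sets (flat_lborel (t *\<^sub>R a) (SOME B. orthonormal_basis_of (hyperplane a 0) B))"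
    then have "S \<in> sets borel" by (simp add: flat_lborel_def)
    then show "emeasure (flat_lborel (t *\<^sub>R a) (SOME B. orthonormal_basis_of (hyperplane a 0) B)) S
        = emeasure (flat_lborel (t *\<^sub>R a) B) S"
      by (simp add: emeasure_flat_lborel_eq_cylinder[OF a B'] emeasure_flat_lborel_eq_cylinder[OF a B])
  qed (simp add: flat_lborel_def)
qed

end

theory Submission
  imports Defs
begin

text \<open>
  Let \<open>x \<ge> y\<close> be the two largest absolute values of coordinates of the unit vector \<open>a\<close>. Projecting
  the section along the coordinate direction of \<open>x\<close> turns its area into \<open>1 / x\<close> times the volume of
  an explicit set in one dimension less (\<open>emeasure_section_eq_section_vol\<close>). For this volume Fubini
  gives a one-dimensional recursion over the remaining coordinates (\<open>section_vol_insert\<close>), in which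
  a slice is again a section, of a smaller ball at a shifted level. All volume estimates are
  inductions along this recursion, driven by a single integral (\<open>tpow_kernel\<close>).

  At most the vertices in the directions of coordinates larger than \<open>t\<close> lie beyond the hyperplane.
  If only \<open>x\<close> exceeds \<open>t\<close>, the section lies in the cone spanned at one vertex, and up to the factor
  \<open>2^(n-1) / (n-1)!\<close> the area is at most \<open>f(x) / (x\<^sup>2 - y\<^sup>2)\<close> with
  \<open>f(z) = z^(n-2) (z - t)^(n-1) / \<Prod> (z\<^sup>2 - a_j\<^sup>2)\<close>, the product over the other coordinates
  (\<open>section_vol_le_cone\<close>). If both \<open>x\<close> and \<open>y\<close> exceed \<open>t\<close>, a second cone has to be subtracted, and
  the area is bounded by the divided difference \<open>(f(x) - f(y)) / (x\<^sup>2 - y\<^sup>2)\<close>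
  (\<open>section_vol_le_two_cones\<close>). A third coordinate cannot exceed \<open>t\<close>, since \<open>3 t\<^sup>2 \<ge> 1\<close>.

  For \<open>n = 4\<close> it remains to compare these expressions with \<open>(1 - t)^3\<close>. The condition \<open>3 t\<^sup>2 \<ge> 1\<close>
  makes this possible, and leaves enough room for crude estimates (\<open>section_vol_le_axis_4\<close>).

  Larger \<open>n\<close> are reduced to \<open>n - 1\<close> by slicing along the smallest coordinate \<open>a_j\<close>
  (\<open>section_vol_le_axis\<close>). The slices are sections at relative distance at least \<open>1 / sqrt 3\<close> again, so
  each is at most the corresponding section parallel to a coordinate hyperplane. Integrating these
  bounds yields the section for a direction with only the two nonzero coordinates
  \<open>sqrt (1 - a_j\<^sup>2)\<close> and \<open>a_j\<close>, which is handled by an inequality in one variable.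

  For \<open>n = 3\<close> there is no room. The direction \<open>(1, 1, 0) / sqrt 2\<close> has a section of area
  \<open>2 sqrt 2 (1/2 - t\<^sup>2)\<close> as long as \<open>t \<le> 1 / sqrt 2\<close>, and comparison with the area \<open>2 (1 - t)\<^sup>2\<close> of the
  coordinate section is a quadratic inequality in \<open>t\<close>, whose larger root is the stated threshold
  (\<open>threshold_iff\<close>). Conversely, for \<open>t \<ge> 0.638\<close>, which is just below the threshold, this direction is the
  worst one among those with \<open>y > t\<close> (\<open>two_cone_quadratic_ineq\<close>), and the directions with \<open>y \<le> t\<close> never
  beat the coordinate section (\<open>cone_ineq_3\<close>).
\<close>

section \<open>Truncated powers\<close>

text \<open>The value of \<open>tpow 0\<close> at \<open>0\<close> is \<open>1\<close>, so that \<open>tpow 0\<close> is the indicator of a closed half-line and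
  one-dimensional volumes fit the same pattern as the others.\<close>

definition tpow :: "nat \<Rightarrow> real \<Rightarrow> real" where
  "tpow m A = (if A < 0 then 0 else A ^ m)"

lemma tpow_nonneg [simp]: "0 \<le> tpow m A"
  by (simp add: tpow_def)

lemma tpow_measurable [measurable]: "tpow m \<in> borel_measurable borel"
  unfolding tpow_def by measurable

lemma tpow_mono: "A \<le> B \<Longrightarrow> tpow m A \<le> tpow m B"
  by (auto simp: tpow_def intro: power_mono)

lemma tpow_divide: "0 < N \<Longrightarrow> tpow m (A / N) = tpow m A / N ^ m"
  by (simp add: tpow_def divide_less_0_iff power_divide)

lemma tpow_half_line:
  fixes c A :: real
  assumes c: "0 < c"
  shows "(\<integral>\<^sup>+u. ennreal (tpow m (A - c * u)) * indicator {0..} u \<partial>lborel) = ennreal (tpow (Suc m) A / (c * Suc m))"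
proof (cases "A < 0")
  case True
  have z: "ennreal (tpow m (A - c * u)) * indicator {0..} u = 0" for u :: real
  proof (cases "0 \<le> u")
    case True
    then have "A - c * u < 0" using \<open>A < 0\<close> c mult_nonneg_nonneg[of c u] by linarith
    then show ?thesis by (simp add: tpow_def)
  qed simp
  show ?thesis unfolding z using True by (simp add: tpow_def)
next
  case False
  have "ennreal (tpow m (A - c * u)) * indicator {0..} u = ennreal (tpow m (A - c * u)) * indicator {0..A / c} u" for u
    using c by (auto simp: tpow_def indicator_def field_simps)
  then have "(\<integral>\<^sup>+u. ennreal (tpow m (A - c * u)) * indicator {0..} u \<partial>lborel)
      = (\<integral>\<^sup>+u. ennreal (tpow m (A - c * u)) * indicator {0..A / c} u \<partial>lborel)" by simp
  also have "\<dots> = (\<integral>\<^sup>+u. ennreal ((A - c * u) ^ m) * indicator {0..A / c} u \<partial>lborel)"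
    using c by (intro nn_integral_cong) (auto simp: tpow_def indicator_def field_simps)
  also have "\<dots> = ennreal (- ((A - c * (A / c)) ^ Suc m / (c * Suc m)) - - ((A - c * 0) ^ Suc m / (c * Suc m)))"
  proof (rule nn_integral_FTC_Icc)
    fix u assume u: "u \<in> {0..A / c}"
    show "((\<lambda>u. - ((A - c * u) ^ Suc m / (c * Suc m))) has_real_derivative (A - c * u) ^ m) (at u)"
      using c by (auto intro!: derivative_eq_intros simp del: power_Suc)
    show "0 \<le> (A - c * u) ^ m" using u c by (auto simp: field_simps)
  qed (use False c in auto)
  also have "\<dots> = ennreal (tpow (Suc m) A / (c * Suc m))"
    using c False by (simp add: tpow_def)
  finally show ?thesis .
qed

text \<open>Integrating a truncated power along the cone \<open>x \<bar>u\<bar> - a u \<le> A\<close> raises the exponent by one. The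
  two half-lines contribute \<open>1 / (x - a)\<close> and \<open>1 / (x + a)\<close>, which is where the factors
  \<open>2 x / (x\<^sup>2 - a\<^sup>2)\<close> of the volume formulas come from.\<close>

lemma tpow_kernel:
  fixes x a A :: real
  assumes a: "\<bar>a\<bar> < x"
  shows "(\<integral>\<^sup>+u. ennreal (tpow m (A - (x * \<bar>u\<bar> - a * u))) \<partial>lborel)
    = ennreal (2 * x / (x\<^sup>2 - a\<^sup>2) / Suc m * tpow (Suc m) A)"
proof -
  let ?f = "\<lambda>u. ennreal (tpow m (A - (x * \<bar>u\<bar> - a * u)))"
  have x: "0 < x - a" "0 < x + a" using a by auto
  have "(\<integral>\<^sup>+u. ?f u \<partial>lborel) = (\<integral>\<^sup>+u. ?f u * indicator {0..} u + ?f u * indicator {..<0} u \<partial>lborel)"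
    by (intro nn_integral_cong) (auto simp: indicator_def)
  also have "\<dots> = (\<integral>\<^sup>+u. ?f u * indicator {0..} u \<partial>lborel) + (\<integral>\<^sup>+u. ?f u * indicator {..<0} u \<partial>lborel)"
    by (rule nn_integral_add) auto
  also have "(\<integral>\<^sup>+u. ?f u * indicator {0..} u \<partial>lborel)
      = (\<integral>\<^sup>+u. ennreal (tpow m (A - (x - a) * u)) * indicator {0..} u \<partial>lborel)"
    by (intro nn_integral_cong) (auto simp: indicator_def algebra_simps)
  also have "\<dots> = ennreal (tpow (Suc m) A / ((x - a) * Suc m))" by (rule tpow_half_line[OF x(1)])
  also have "(\<integral>\<^sup>+u. ?f u * indicator {..<0} u \<partial>lborel)
      = (\<integral>\<^sup>+u. ?f (- u) * indicator {..<0} (- u) \<partial>lborel)"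
    by (subst nn_integral_real_affine[of _ "-1" 0]) (auto simp: one_ennreal_def[symmetric])
  also have "\<dots> = (\<integral>\<^sup>+u. ennreal (tpow m (A - (x + a) * u)) * indicator {0..} u \<partial>lborel)"
  proof (rule nn_integral_cong_AE)
    have "AE u in lborel. u \<noteq> (0::real)" by (rule AE_lborel_singleton)
    then show "AE u in lborel. ?f (- u) * indicator {..<0} (- u)
        = ennreal (tpow m (A - (x + a) * u)) * indicator {0..} u"
      by eventually_elim (auto simp: indicator_def algebra_simps)
  qed
  also have "\<dots> = ennreal (tpow (Suc m) A / ((x + a) * Suc m))" by (rule tpow_half_line[OF x(2)])
  also have "ennreal (tpow (Suc m) A / ((x - a) * Suc m)) + ennreal (tpow (Suc m) A / ((x + a) * Suc m))
      = ennreal (tpow (Suc m) A / ((x - a) * Suc m) + tpow (Suc m) A / ((x + a) * Suc m))"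
    using x by simp
  also have "tpow (Suc m) A / ((x - a) * Suc m) + tpow (Suc m) A / ((x + a) * Suc m)
      = 2 * x / (x\<^sup>2 - a\<^sup>2) / Suc m * tpow (Suc m) A"
  proof -
    have "x\<^sup>2 - a\<^sup>2 = (x - a) * (x + a)" by (simp add: power2_eq_square algebra_simps)
    moreover have "S / (p * M) + S / (q * M) = (p + q) / (p * q) / M * S"
      if "0 < p" "0 < q" "0 < M" for S p q M :: real using that by (simp add: field_simps)
    from this[OF x, of "real (Suc m)" "tpow (Suc m) A"]
    have "tpow (Suc m) A / ((x - a) * Suc m) + tpow (Suc m) A / ((x + a) * Suc m)
      = (x - a + (x + a)) / ((x - a) * (x + a)) / Suc m * tpow (Suc m) A" by simp
    ultimately show ?thesis by simp
  qed
  finally show ?thesis .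
qed

section \<open>Volumes of sections in coordinates\<close>

text \<open>For \<open>k \<notin> J\<close> this is the density at \<open>t\<close> of \<open>a_k x_k + \<Sum> a_j x_j\<close> on the \<open>l_1\<close>-ball of radius \<open>r\<close> in the
  coordinates \<open>insert k J\<close>: the hyperplane equation is solved for \<open>x_k\<close>, and \<open>y\<close> collects the other
  coordinates. Keeping \<open>J\<close>, \<open>t\<close> and \<open>r\<close> variable allows induction on the dimension, which a
  dimension encoded in a type does not.\<close>

definition section_vol :: "'i \<Rightarrow> 'i set \<Rightarrow> ('i \<Rightarrow> real) \<Rightarrow> real \<Rightarrow> real \<Rightarrow> ennreal" where
  "section_vol k J a t r = ennreal (1 / \<bar>a k\<bar>) * emeasure (\<Pi>\<^sub>M j\<in>J. lborel)
     {y \<in> space (\<Pi>\<^sub>M j\<in>J. lborel). \<bar>t - (\<Sum>j\<in>J. a j * y j)\<bar> / \<bar>a k\<bar> + (\<Sum>j\<in>J. \<bar>y j\<bar>) \<le> r}"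

lemma section_vol_empty:
  "section_vol k {} a t r = ennreal (if \<bar>t\<bar> / \<bar>a k\<bar> \<le> r then 1 / \<bar>a k\<bar> else 0)"
  by (simp add: section_vol_def PiM_empty)

text \<open>Fixing the coordinate \<open>u\<close> of index \<open>j\<close> leaves a ball of radius \<open>r - \<bar>u\<bar>\<close> and shifts the level by
  \<open>a_j u\<close>.\<close>

lemma section_vol_insert:
  assumes "finite J" "j \<notin> J"
  shows "section_vol k (insert j J) a t r
    = (\<integral>\<^sup>+u. section_vol k J a (t - a j * u) (r - \<bar>u\<bar>) \<partial>lborel)"
proof -
  interpret product_sigma_finite "\<lambda>_::'a. lborel :: real measure" ..
  let ?P = "\<lambda>I. \<Pi>\<^sub>M j\<in>I. (lborel :: real measure)"
  let ?S = "\<lambda>I t r. {y \<in> space (?P I). \<bar>t - (\<Sum>j\<in>I. a j * y j)\<bar> / \<bar>a k\<bar> + (\<Sum>j\<in>I. \<bar>y j\<bar>) \<le> r}"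
  have S [measurable]: "?S I t r \<in> sets (?P I)" for I t r by measurable
  let ?c = "ennreal (1 / \<bar>a k\<bar>)"
  have "?c * emeasure (?P (insert j J)) (?S (insert j J) t r)
      = (\<integral>\<^sup>+y. ?c * indicator (?S (insert j J) t r) y \<partial>?P (insert j J))"
    by (simp add: nn_integral_cmult_indicator)
  also have "\<dots> = (\<integral>\<^sup>+u. (\<integral>\<^sup>+y. ?c * indicator (?S (insert j J) t r) (y(j := u)) \<partial>?P J) \<partial>lborel)"
    using assms by (intro product_nn_integral_insert_rev borel_measurable_times_ennreal borel_measurable_indicator S) auto
  also have "\<dots> = (\<integral>\<^sup>+u. (\<integral>\<^sup>+y. ?c * indicator (?S J (t - a j * u) (r - \<bar>u\<bar>)) y \<partial>?P J) \<partial>lborel)"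
  proof (intro nn_integral_cong)
    fix u y assume y: "y \<in> space (?P J)"
    have "y(j := u) \<in> space (?P (insert j J))" using y by (auto simp: space_PiM PiE_def extensional_def)
    moreover have "(\<Sum>i\<in>J. a i * (y(j := u)) i) = (\<Sum>i\<in>J. a i * y i)"
      "(\<Sum>i\<in>J. \<bar>(y(j := u)) i\<bar>) = (\<Sum>i\<in>J. \<bar>y i\<bar>)"
      using assms by (auto intro!: sum.cong)
    then have "(\<Sum>i\<in>insert j J. a i * (y(j := u)) i) = a j * u + (\<Sum>i\<in>J. a i * y i)"
      "(\<Sum>i\<in>insert j J. \<bar>(y(j := u)) i\<bar>) = \<bar>u\<bar> + (\<Sum>i\<in>J. \<bar>y i\<bar>)"
      using assms by simp_all
    ultimately have "y(j := u) \<in> ?S (insert j J) t r \<longleftrightarrow> y \<in> ?S J (t - a j * u) (r - \<bar>u\<bar>)"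
      using y by (simp only: mem_Collect_eq simp_thms) (simp add: algebra_simps)
    then show "?c * indicator (?S (insert j J) t r) (y(j := u))
        = ?c * (indicator (?S J (t - a j * u) (r - \<bar>u\<bar>)) y :: ennreal)"
      by (simp only: indicator_def)
  qed
  also have "\<dots> = (\<integral>\<^sup>+u. ?c * emeasure (?P J) (?S J (t - a j * u) (r - \<bar>u\<bar>)) \<partial>lborel)"
    by (simp add: nn_integral_cmult_indicator)
  finally show ?thesis by (simp add: section_vol_def)
qed

lemma section_vol_scale:
  assumes s: "0 < s"
  shows "section_vol k J (\<lambda>j. s * a j) (s * t) r = ennreal (1 / s) * section_vol k J a t r"
proof -
  have "\<bar>s * t - (\<Sum>j\<in>J. s * a j * y j)\<bar> / \<bar>s * a k\<bar> = \<bar>t - (\<Sum>j\<in>J. a j * y j)\<bar> / \<bar>a k\<bar>" for y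
  proof -
    have "s * t - (\<Sum>j\<in>J. s * a j * y j) = s * (t - (\<Sum>j\<in>J. a j * y j))"
      by (simp add: algebra_simps sum_distrib_left)
    then show ?thesis using s by (simp add: abs_mult)
  qed
  moreover have "ennreal (1 / \<bar>s * a k\<bar>) = ennreal (1 / s) * ennreal (1 / \<bar>a k\<bar>)"
    using s by (simp add: abs_mult flip: ennreal_mult)
  ultimately show ?thesis by (simp add: section_vol_def mult.assoc)
qed

text \<open>A linear form is bounded on the ball of radius \<open>r\<close> by \<open>r\<close> times its largest coefficient.\<close>

lemma section_vol_eq_0:
  assumes J: "\<And>j. j \<in> J \<Longrightarrow> \<bar>a j\<bar> \<le> \<bar>a k\<bar>" and k: "a k \<noteq> 0" and t: "\<bar>a k\<bar> * r < t"
  shows "section_vol k J a t r = 0"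
proof -
  have "\<not> \<bar>t - (\<Sum>j\<in>J. a j * y j)\<bar> / \<bar>a k\<bar> + (\<Sum>j\<in>J. \<bar>y j\<bar>) \<le> r" for y
  proof
    assume "\<bar>t - (\<Sum>j\<in>J. a j * y j)\<bar> / \<bar>a k\<bar> + (\<Sum>j\<in>J. \<bar>y j\<bar>) \<le> r"
    then have "\<bar>a k\<bar> * (\<bar>t - (\<Sum>j\<in>J. a j * y j)\<bar> / \<bar>a k\<bar> + (\<Sum>j\<in>J. \<bar>y j\<bar>)) \<le> \<bar>a k\<bar> * r"
      by (intro mult_left_mono) auto
    then have "\<bar>t - (\<Sum>j\<in>J. a j * y j)\<bar> + (\<Sum>j\<in>J. \<bar>a k\<bar> * \<bar>y j\<bar>) \<le> \<bar>a k\<bar> * r"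
      using k by (simp add: distrib_left sum_distrib_left)
    moreover have "(\<Sum>j\<in>J. a j * y j) \<le> (\<Sum>j\<in>J. \<bar>a k\<bar> * \<bar>y j\<bar>)"
    proof (rule sum_mono)
      fix j assume "j \<in> J"
      have "a j * y j \<le> \<bar>a j\<bar> * \<bar>y j\<bar>" using abs_ge_self[of "a j * y j"] by (simp add: abs_mult)
      also have "\<dots> \<le> \<bar>a k\<bar> * \<bar>y j\<bar>" using J[OF \<open>j \<in> J\<close>] by (intro mult_right_mono) auto
      finally show "a j * y j \<le> \<bar>a k\<bar> * \<bar>y j\<bar>" .
    qed
    ultimately show False using t by linarith
  qed
  then show ?thesis by (simp add: section_vol_def)
qed

lemma section_vol_neg_radius:
  assumes "r < 0"
  shows "section_vol k J a t r = 0"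
proof -
  have "0 \<le> \<bar>t - (\<Sum>j\<in>J. a j * y j)\<bar> / \<bar>a k\<bar> + (\<Sum>j\<in>J. \<bar>y j\<bar>)" for y
    by (intro add_nonneg_nonneg sum_nonneg) auto
  then have "\<not> \<bar>t - (\<Sum>j\<in>J. a j * y j)\<bar> / \<bar>a k\<bar> + (\<Sum>j\<in>J. \<bar>y j\<bar>) \<le> r" for y
    using assms by (meson le_less_trans not_le)
  then show ?thesis by (simp add: section_vol_def)
qed

text \<open>At the extreme level \<open>t = \<bar>a_k\<bar> r\<close> the section is a face. A coordinate with \<open>\<bar>a_j\<bar> < \<bar>a_k\<bar>\<close> is constant
  on this face, so that almost every slice is empty.\<close>

lemma section_vol_boundary_eq_0:
  assumes J: "finite J" "j \<notin> J" "\<And>i. i \<in> J \<Longrightarrow> \<bar>a i\<bar> \<le> \<bar>a k\<bar>"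
    and j: "\<bar>a j\<bar> < \<bar>a k\<bar>" and t: "\<bar>a k\<bar> * r \<le> t"
  shows "section_vol k (insert j J) a t r = 0"
proof -
  have "AE u in lborel. u \<noteq> (0::real)" by (rule AE_lborel_singleton)
  then have "AE u in lborel. section_vol k J a (t - a j * u) (r - \<bar>u\<bar>) = 0"
  proof eventually_elim
    case (elim u)
    have "a j * u \<le> \<bar>a j\<bar> * \<bar>u\<bar>" using abs_ge_self[of "a j * u"] by (simp add: abs_mult)
    also have "\<dots> < \<bar>a k\<bar> * \<bar>u\<bar>" using elim j by (intro mult_strict_right_mono) auto
    finally have "\<bar>a k\<bar> * (r - \<bar>u\<bar>) < t - a j * u" using t by (simp add: right_diff_distrib)
    then show ?case using J j by (intro section_vol_eq_0) auto
  qed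
  then have "(\<integral>\<^sup>+u. section_vol k J a (t - a j * u) (r - \<bar>u\<bar>) \<partial>lborel) = (\<integral>\<^sup>+u. 0 \<partial>(lborel :: real measure))"
    by (rule nn_integral_cong_AE)
  then show ?thesis by (simp add: section_vol_insert J)
qed

lemma section_vol_nonpos_radius:
  assumes "finite J" "j \<notin> J" "r \<le> 0"
  shows "section_vol k (insert j J) a t r = 0"
proof -
  have "AE u in lborel. u \<noteq> (0::real)" by (rule AE_lborel_singleton)
  then have "AE u in lborel. section_vol k J a (t - a j * u) (r - \<bar>u\<bar>) = 0"
    by eventually_elim (use assms(3) in \<open>intro section_vol_neg_radius, auto\<close>)
  then have "(\<integral>\<^sup>+u. section_vol k J a (t - a j * u) (r - \<bar>u\<bar>) \<partial>lborel) = (\<integral>\<^sup>+u. 0 \<partial>(lborel :: real measure))"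
    by (rule nn_integral_cong_AE)
  then show ?thesis by (simp add: section_vol_insert assms)
qed

text \<open>The assumption on \<open>t / r\<close> says that the level does not meet the ball when all coordinates have
  the same absolute value; otherwise some coordinate is smaller than the maximum and the section
  has measure zero.\<close>

lemma section_vol_beyond_max_eq_0:
  assumes J: "finite J" "\<And>j. j \<in> J \<Longrightarrow> \<bar>a j\<bar> \<le> \<bar>a k\<bar>" and k: "a k \<noteq> 0"
    and sum: "(a k)\<^sup>2 + (\<Sum>j\<in>J. (a j)\<^sup>2) = 1" and r: "0 < r" and t: "\<bar>a k\<bar> * r \<le> t"
    and big: "1 < (1 + real (card J)) * (t / r)\<^sup>2"
  shows "section_vol k J a t r = 0"
proof (cases "\<exists>j\<in>J. \<bar>a j\<bar> < \<bar>a k\<bar>")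
  case True
  then obtain j where "j \<in> J" "\<bar>a j\<bar> < \<bar>a k\<bar>" by auto
  then have "section_vol k (insert j (J - {j})) a t r = 0"
    using J t by (intro section_vol_boundary_eq_0) auto
  then show ?thesis using \<open>j \<in> J\<close> by (simp add: insert_absorb)
next
  case False
  then have "(a j)\<^sup>2 = (a k)\<^sup>2" if "j \<in> J" for j
    using J(2)[OF that] that by (metis abs_le_square_iff not_le order_antisym)
  then have "(1 + real (card J)) * (a k)\<^sup>2 = 1" using sum by (simp add: algebra_simps)
  then have "(1 + real (card J)) * \<bar>a k\<bar>\<^sup>2 < (1 + real (card J)) * (t / r)\<^sup>2" using big by simp
  then have "\<bar>a k\<bar>\<^sup>2 < (t / r)\<^sup>2" by (rule mult_left_less_imp_less) simp
  moreover have "0 \<le> t / r" using t r by (metis abs_ge_zero divide_nonneg_pos mult_nonneg_nonneg order_less_imp_le order_trans)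
  ultimately have "\<bar>a k\<bar> < t / r" by (rule power2_less_imp_less)
  then have "\<bar>a k\<bar> * r < t" using r by (simp add: field_simps)
  then show ?thesis using J k by (intro section_vol_eq_0) auto
qed

section \<open>One or two vertices beyond the hyperplane\<close>

text \<open>The induction step of the cone bound: the argument of the truncated power at a slice is the
  original one minus \<open>x \<bar>u\<bar> - a_j u\<close>, which is the form integrated in \<open>tpow_kernel\<close>.\<close>

lemma section_vol_insert_le:
  assumes J: "finite J" "j \<notin> J" and a: "\<bar>a j\<bar> < x" and C: "0 \<le> C"
    and le: "\<And>u. section_vol k J a (t - a j * u) (r - \<bar>u\<bar>)
      \<le> ennreal (C * tpow m (x * (r - \<bar>u\<bar>) - (t - a j * u)))"
  shows "section_vol k (insert j J) a t r \<le> ennreal (C * (2 * x / (x\<^sup>2 - (a j)\<^sup>2) / Suc m) * tpow (Suc m) (x * r - t))"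
proof -
  define K where "K = 2 * x / (x\<^sup>2 - (a j)\<^sup>2) / Suc m"
  have x: "0 \<le> K"
    unfolding K_def using a abs_le_square_iff[of "a j" x] by (intro divide_nonneg_nonneg) auto
  have "section_vol k (insert j J) a t r \<le> (\<integral>\<^sup>+u. ennreal (C * tpow m (x * (r - \<bar>u\<bar>) - (t - a j * u))) \<partial>lborel)"
    unfolding section_vol_insert[OF J] by (intro nn_integral_mono le)
  also have "\<dots> = (\<integral>\<^sup>+u. ennreal C * ennreal (tpow m ((x * r - t) - (x * \<bar>u\<bar> - a j * u))) \<partial>lborel)"
    using C by (intro nn_integral_cong) (simp add: ennreal_mult algebra_simps)
  also have "\<dots> = ennreal C * ennreal (K * tpow (Suc m) (x * r - t))"
    by (subst nn_integral_cmult) (simp_all only: tpow_kernel[OF a] K_def, measurable)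
  also have "\<dots> = ennreal (C * K * tpow (Suc m) (x * r - t))"
    using C x by (subst ennreal_mult[symmetric]) (simp_all add: mult.assoc)
  finally show ?thesis unfolding K_def .
qed

text \<open>The section is contained in the section of the cone which the ball spans at its vertex in
  direction \<open>k\<close>. The bound is the exact value for the cone.\<close>

lemma section_vol_le_cone:
  assumes "finite J" "\<And>j. j \<in> J \<Longrightarrow> \<bar>a j\<bar> < \<bar>a k\<bar>" "a k \<noteq> 0"
  defines "x \<equiv> \<bar>a k\<bar>"
  shows "section_vol k J a t r
    \<le> ennreal ((\<Prod>j\<in>J. 2 * x / (x\<^sup>2 - (a j)\<^sup>2)) / (x * fact (card J)) * tpow (card J) (x * r - t))"
  using assms(1,2)
proof (induction J arbitrary: t r)
  case empty
  have "\<bar>t\<bar> / \<bar>a k\<bar> \<le> r \<Longrightarrow> 0 \<le> x * r - t" using assms(3) by (simp add: x_def field_simps)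
  then show ?case using assms(3) by (auto simp: section_vol_empty tpow_def x_def intro!: ennreal_leI)
next
  case (insert j J)
  have "0 \<le> (\<Prod>j\<in>J. 2 * x / (x\<^sup>2 - (a j)\<^sup>2)) / (x * fact (card J))"
    using insert.prems abs_le_square_iff[of x] unfolding x_def
    by (intro divide_nonneg_nonneg prod_nonneg) (auto simp: abs_le_square_iff[symmetric] less_imp_le)
  from section_vol_insert_le[OF insert.hyps _ this insert.IH]
  have "section_vol k (insert j J) a t r \<le> ennreal ((\<Prod>j\<in>J. 2 * x / (x\<^sup>2 - (a j)\<^sup>2)) / (x * fact (card J)) *
      (2 * x / (x\<^sup>2 - (a j)\<^sup>2) / Suc (card J)) * tpow (Suc (card J)) (x * r - t))"
    using insert.prems by (simp add: x_def)
  also have "(\<Prod>j\<in>J. 2 * x / (x\<^sup>2 - (a j)\<^sup>2)) / (x * fact (card J)) * (2 * x / (x\<^sup>2 - (a j)\<^sup>2) / Suc (card J))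
      = (\<Prod>j\<in>insert j J. 2 * x / (x\<^sup>2 - (a j)\<^sup>2)) / (x * fact (card (insert j J)))"
  proof -
    have "P / (x * F) * (q / S) = (q * P) / (x * (S * F))" for P F q S :: real by (simp add: mult_ac)
    then show ?thesis
      by (simp only: prod.insert[OF insert.hyps] card_insert_disjoint[OF insert.hyps] fact_Suc)
  qed
  finally show ?case using insert.hyps by simp
qed

text \<open>In dimension two the section is a segment. For \<open>t > y r\<close> both of its ends lie on the edges at the
  first vertex; for \<open>t < y r\<close> one end has moved on to the next edge at the second vertex, and the
  length becomes a difference of lengths of two cone sections. The exact value has \<open>x = x0\<close>, where the
  formula breaks down for \<open>x0 = y\<close>. A slightly larger \<open>x\<close> with the denominator \<open>(x0 + y) (x - y)\<close> covers
  that case as well: the right side does not depend on \<open>x\<close> for \<open>t \<le> y r\<close> and increases with \<open>x\<close> for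
  \<open>t > y r\<close>.\<close>

lemma section_vol_two_axes:
  fixes a :: "'i \<Rightarrow> real" and k l :: 'i and x b r t :: real
  defines "x0 \<equiv> \<bar>a k\<bar>" and "y \<equiv> \<bar>a l\<bar>"
  assumes y: "y \<le> x0" "x0 \<le> x" "y < x" and b: "0 \<le> b" "b < y" "b * r \<le> t"
  defines "K \<equiv> 2 / ((x0 + y) * (x - y))"
  shows "section_vol k {l} a t r \<le> ennreal (K * tpow 1 (x * r - t) - K * tpow 1 (y * r - t))"
    and "tpow 1 (y * r - t) \<le> tpow 1 (x * r - t)"
proof -
  have x0: "0 < x0" using y b by linarith
  have K: "0 < K" using y b x0 by (auto simp: K_def)
  show mono: "tpow 1 (y * r - t) \<le> tpow 1 (x * r - t)"
  proof (cases "0 \<le> r")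
    case True
    then show ?thesis using y by (intro tpow_mono diff_right_mono mult_right_mono) auto
  next
    case False
    then have "y * r < b * r" using b by simp
    then have "tpow 1 (y * r - t) = 0" using b by (simp add: tpow_def)
    then show ?thesis by simp
  qed
  then have PQ: "0 \<le> K * tpow 1 (x * r - t) - K * tpow 1 (y * r - t)"
    using K by (simp add: mult_left_mono)
  define U where "U = {u. \<bar>t - a l * u\<bar> / x0 \<le> r - \<bar>u\<bar>}"
  have vol: "section_vol k {l} a t r = (\<integral>\<^sup>+u. ennreal (1 / x0) * indicator U u \<partial>lborel)"
    by (subst section_vol_insert) (auto simp: section_vol_empty x0_def U_def intro!: nn_integral_cong)
  \<comment> \<open>The sign \<open>\<epsilon>\<close> reduces to \<open>a l \<ge> 0\<close> by the reflection \<open>u \<mapsto> - u\<close>.\<close>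
  define \<epsilon> where "\<epsilon> = (if 0 \<le> a l then 1 else -1 :: real)"
  have U: "t - y * (\<epsilon> * u) + x0 * \<bar>\<epsilon> * u\<bar> \<le> x0 * r" "y * (\<epsilon> * u) - t + x0 * \<bar>\<epsilon> * u\<bar> \<le> x0 * r" if "u \<in> U" for u
  proof -
    have "\<bar>t - a l * u\<bar> + x0 * \<bar>u\<bar> \<le> x0 * r" using that x0 by (simp add: U_def field_simps)
    moreover have eq: "y * (\<epsilon> * u) = a l * u" "\<bar>\<epsilon> * u\<bar> = \<bar>u\<bar>" by (auto simp: \<epsilon>_def y_def)
    ultimately show "t - y * (\<epsilon> * u) + x0 * \<bar>\<epsilon> * u\<bar> \<le> x0 * r" "y * (\<epsilon> * u) - t + x0 * \<bar>\<epsilon> * u\<bar> \<le> x0 * r"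
      unfolding eq by linarith+
  qed
  have bound: "section_vol k {l} a t r \<le> ennreal (1 / x0 * (lo + hi))"
    if "\<And>u. u \<in> U \<Longrightarrow> - lo \<le> \<epsilon> * u \<and> \<epsilon> * u \<le> hi" and "0 \<le> lo + hi" for lo hi
  proof -
    define I where "I = (if 0 \<le> a l then {-lo..hi} else {-hi..lo})"
    have "U \<subseteq> I" using that(1) by (fastforce simp: I_def \<epsilon>_def)
    then have "section_vol k {l} a t r \<le> (\<integral>\<^sup>+u. ennreal (1 / x0) * indicator I u \<partial>lborel)"
      unfolding vol by (intro nn_integral_mono mult_left_mono) (auto simp: indicator_def)
    also have "\<dots> = ennreal (1 / x0) * emeasure lborel I"
      by (rule nn_integral_cmult_indicator) (auto simp: I_def)
    also have "emeasure lborel I = ennreal (lo + hi)" using that(2) by (auto simp: I_def add.commute)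
    finally show ?thesis using x0 that(2) by (simp add: ennreal_mult[symmetric])
  qed
  show "section_vol k {l} a t r \<le> ennreal (K * tpow 1 (x * r - t) - K * tpow 1 (y * r - t))"
  proof (cases "0 \<le> r \<and> t \<le> x0 * r")
    case False
    have "section_vol k {l} a t r = 0"
    proof (cases "0 \<le> r")
      case True
      then show ?thesis using False y x0 by (intro section_vol_eq_0) (auto simp: x0_def y_def)
    qed (simp add: section_vol_neg_radius)
    then show ?thesis by simp
  next
    case True
    then have r: "0 \<le> r" "t \<le> x0 * r" by auto
    then have t: "0 \<le> t" using b mult_nonneg_nonneg[of b r] by linarith
    have lo: "- ((x0 * r - t) / (x0 + y)) \<le> \<epsilon> * u" if "u \<in> U" for u
    proof (cases "0 \<le> \<epsilon> * u")
      case True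
      moreover have "0 \<le> (x0 * r - t) / (x0 + y)" using r x0 y b by (intro divide_nonneg_pos) auto
      ultimately show ?thesis by linarith
    next
      case False
      then show ?thesis using U(1)[OF that] x0 b by (simp add: field_simps)
    qed
    have xx: "x0 * r \<le> x * r" using r y by (intro mult_right_mono)
    show ?thesis
    proof (cases "t \<le> y * r")
      case True
      have "\<epsilon> * u \<le> (x0 * r + t) / (x0 + y)" if "u \<in> U" for u
      proof (cases "0 \<le> \<epsilon> * u")
        case False
        moreover have "0 \<le> (x0 * r + t) / (x0 + y)" using r t x0 y b by (intro divide_nonneg_pos) auto
        ultimately show ?thesis by linarith
      next
        case True
        then show ?thesis using U(2)[OF that] x0 b by (simp add: field_simps)
      qed
      with lo have "section_vol k {l} a t r \<le> ennreal (1 / x0 * ((x0 * r - t) / (x0 + y) + (x0 * r + t) / (x0 + y)))"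
        using r x0 y b by (intro bound) (auto simp flip: add_divide_distrib)
      also have "1 / x0 * ((x0 * r - t) / (x0 + y) + (x0 * r + t) / (x0 + y)) = 2 * r / (x0 + y)"
        using x0 by (simp flip: add_divide_distrib)
      also have "\<dots> = K * (x * r - t) - K * (y * r - t)"
      proof -
        have "K * (x * r - t) - K * (y * r - t) = (K * (x - y)) * r" by (simp add: algebra_simps)
        also have "K * (x - y) = 2 / (x0 + y)"
        proof -
          have "2 / (p * q) * q = 2 / p" if "0 < q" for p q :: real using that by simp
          from this[of "x - y" "x0 + y"] show ?thesis using y by (simp only: K_def diff_gt_0_iff_gt)
        qed
        finally show ?thesis by simp
      qed
      finally show ?thesis using True r xx by (simp add: tpow_def)
    next
      case False
      then have x0y: "y < x0" using r by (metis le_less_linear order_antisym_conv y(1) order_trans)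
      have "\<epsilon> * u \<le> (x0 * r - t) / (x0 - y)" if "u \<in> U" for u
      proof (cases "0 \<le> \<epsilon> * u")
        case False
        moreover have "0 \<le> (x0 * r - t) / (x0 - y)" using r x0y by (intro divide_nonneg_pos) auto
        ultimately show ?thesis by linarith
      next
        case True
        then show ?thesis using U(1)[OF that] x0y by (simp add: field_simps)
      qed
      with lo have "section_vol k {l} a t r \<le> ennreal (1 / x0 * ((x0 * r - t) / (x0 + y) + (x0 * r - t) / (x0 - y)))"
        using r x0 x0y y b by (intro bound) (auto intro!: add_nonneg_nonneg divide_nonneg_nonneg)
      also have "1 / x0 * ((x0 * r - t) / (x0 + y) + (x0 * r - t) / (x0 - y))
          = 2 / (x0 + y) * ((x0 * r - t) / (x0 - y))"
      proof -
        have "1 / x0 * (N / p + N / q) = 2 / p * (N / q)" if "0 < p" "0 < q" "p + q = 2 * x0" for N p q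
        proof -
          have "N / p + N / q = N * (p + q) / (p * q)" using that(1,2) by (simp add: field_simps)
          then show ?thesis unfolding that(3) using that x0 by simp
        qed
        then show ?thesis using x0y x0 b by simp
      qed
      also have "\<dots> \<le> 2 / (x0 + y) * ((x * r - t) / (x - y))"
      proof (rule mult_left_mono)
        have "0 \<le> (x - x0) * (t - y * r)" using y False by (intro mult_nonneg_nonneg) auto
        then show "(x0 * r - t) / (x0 - y) \<le> (x * r - t) / (x - y)"
          using x0y y by (simp add: divide_le_eq le_divide_eq pos_le_divide_eq pos_divide_le_eq) (simp add: algebra_simps)
      qed (use x0 b in auto)
      also have "\<dots> = K * (x * r - t)" by (simp add: K_def)
      finally show ?thesis using False r xx by (simp add: tpow_def ennreal_leI)
    qed
  qed
qed

text \<open>The condition \<open>b r \<le> t\<close> passes to all slices, because \<open>b\<close> dominates the coordinates in \<open>J\<close>. It keeps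
  the cone of \<open>y\<close> away from slices with negative radius, where the section is empty. The inequality
  between the two terms is carried along in the induction so that the difference of the integrals
  is the integral of the difference.\<close>

lemma section_vol_le_two_cones:
  fixes a :: "'i \<Rightarrow> real" and k l :: 'i and x b :: real
  defines "x0 \<equiv> \<bar>a k\<bar>" and "y \<equiv> \<bar>a l\<bar>"
  assumes y: "y \<le> x0" "x0 \<le> x" "y < x" and b: "0 \<le> b" "b < y"
  defines "P \<equiv> \<lambda>z J t r. 2 / ((x0 + y) * (x - y)) * ((\<Prod>j\<in>J. 2 * z / (z\<^sup>2 - (a j)\<^sup>2)) / fact (Suc (card J)))
    * tpow (Suc (card J)) (z * r - t)"
  assumes "finite J" "l \<notin> J" "\<And>j. j \<in> J \<Longrightarrow> \<bar>a j\<bar> \<le> b" "b * r \<le> t"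
  shows "section_vol k (insert l J) a t r \<le> ennreal (P x J t r - P y J t r) \<and> P y J t r \<le> P x J t r"
  using assms(9-)
proof (induction J arbitrary: t r)
  case empty
  have "0 \<le> 2 / ((x0 + y) * (x - y))" using y b by simp
  moreover have P: "P z {} t r = 2 / ((x0 + y) * (x - y)) * tpow 1 (z * r - t)" for z by (simp add: P_def)
  moreover have "section_vol k {l} a t r \<le> ennreal (P x {} t r - P y {} t r)"
    "tpow 1 (y * r - t) \<le> tpow 1 (x * r - t)"
    unfolding P x0_def y_def
    by (rule section_vol_two_axes[of a l k x b r t, OF y[unfolded x0_def y_def] b[unfolded y_def] empty(3)])+
  ultimately show ?case by (simp only: P mult_left_mono simp_thms)
next
  case (insert j J)
  let ?K = "2 / ((x0 + y) * (x - y))"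
  let ?C = "\<lambda>z. ?K * ((\<Prod>j\<in>J. 2 * z / (z\<^sup>2 - (a j)\<^sup>2)) / fact (Suc (card J)))"
  have K: "0 \<le> ?K" using y b by simp
  have prod_nn: "0 \<le> (\<Prod>i\<in>I. 2 * z / (z\<^sup>2 - (a i)\<^sup>2))"
    if "b < z" "\<And>i. i \<in> I \<Longrightarrow> \<bar>a i\<bar> \<le> b" for z I
  proof (rule prod_nonneg)
    fix i assume "i \<in> I"
    then have "\<bar>a i\<bar> \<le> \<bar>z\<bar>" using that(2)[of i] that(1) b by auto
    then have "(a i)\<^sup>2 \<le> z\<^sup>2" by (simp only: abs_le_square_iff)
    then show "0 \<le> 2 * z / (z\<^sup>2 - (a i)\<^sup>2)" using that(1) b by (intro divide_nonneg_nonneg) auto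
  qed
  have C: "0 \<le> ?C z" if "b < z" for z
    using prod_nn[OF that, of J] insert.prems(2) by (intro mult_nonneg_nonneg[OF K]) auto
  have j: "\<bar>a j\<bar> \<le> b" using insert.prems by auto
  have I: "(\<integral>\<^sup>+u. ennreal (P z J (t - a j * u) (r - \<bar>u\<bar>)) \<partial>lborel) = ennreal (P z (insert j J) t r)"
    if z: "b < z" for z
  proof -
    have "(\<integral>\<^sup>+u. ennreal (P z J (t - a j * u) (r - \<bar>u\<bar>)) \<partial>lborel)
        = (\<integral>\<^sup>+u. ennreal (?C z) * ennreal (tpow (Suc (card J)) ((z * r - t) - (z * \<bar>u\<bar> - a j * u))) \<partial>lborel)"
      unfolding ennreal_mult[OF C[OF z] tpow_nonneg, symmetric]
      by (intro nn_integral_cong) (simp add: P_def algebra_simps)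
    also have "\<dots> = ennreal (?C z) * ennreal (2 * z / (z\<^sup>2 - (a j)\<^sup>2) / Suc (Suc (card J)) * tpow (Suc (Suc (card J))) (z * r - t))"
      using j z by (subst nn_integral_cmult, measurable) (subst tpow_kernel, auto)
    also have "\<dots> = ennreal (?C z * (2 * z / (z\<^sup>2 - (a j)\<^sup>2) / Suc (Suc (card J)) * tpow (Suc (Suc (card J))) (z * r - t)))"
      using C[OF z] by (rule ennreal_mult'[symmetric])
    also have "?C z * (2 * z / (z\<^sup>2 - (a j)\<^sup>2) / Suc (Suc (card J)) * tpow (Suc (Suc (card J))) (z * r - t))
        = P z (insert j J) t r"
    proof -
      have "K * (Q / F) * (q / S * T) = K * (q * Q / (S * F)) * T" for K Q F q S T :: real
        by (simp add: mult_ac)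
      then show ?thesis
        by (simp only: P_def prod.insert[OF insert.hyps] card_insert_disjoint[OF insert.hyps] fact_Suc[of "Suc (card J)"])
    qed
    finally show ?thesis .
  qed
  have t: "b * (r - \<bar>u\<bar>) \<le> t - a j * u" for u
  proof -
    have "a j * u \<le> \<bar>a j\<bar> * \<bar>u\<bar>" using abs_ge_self[of "a j * u"] by (simp add: abs_mult)
    also have "\<dots> \<le> b * \<bar>u\<bar>" using j by (intro mult_right_mono) auto
    finally show ?thesis using insert.prems(3) by (simp add: right_diff_distrib)
  qed
  have IH: "section_vol k (insert l J) a (t - a j * u) (r - \<bar>u\<bar>)
      \<le> ennreal (P x J (t - a j * u) (r - \<bar>u\<bar>) - P y J (t - a j * u) (r - \<bar>u\<bar>))"
    "P y J (t - a j * u) (r - \<bar>u\<bar>) \<le> P x J (t - a j * u) (r - \<bar>u\<bar>)" for u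
    using insert.IH[of "r - \<bar>u\<bar>" "t - a j * u"] insert.prems t by auto
  have [measurable]: "(\<lambda>u. P z J (t - a j * u) (r - \<bar>u\<bar>)) \<in> borel_measurable borel" for z
    unfolding P_def by measurable
  have Pnn: "0 \<le> P z I t r" if "b < z" "\<And>i. i \<in> I \<Longrightarrow> \<bar>a i\<bar> \<le> b" for z I t r
    unfolding P_def using prod_nn[OF that]
    by (intro mult_nonneg_nonneg[OF mult_nonneg_nonneg[OF K] tpow_nonneg]) auto
  have bx: "b < x" using y b by linarith
  have mono: "ennreal (P y (insert j J) t r) \<le> ennreal (P x (insert j J) t r)"
    unfolding I[OF b(2), symmetric] I[OF bx, symmetric] by (intro nn_integral_mono ennreal_leI IH)
  have leP: "P y (insert j J) t r \<le> P x (insert j J) t r"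
    using mono Pnn[OF bx, of "insert j J"] insert.prems(2) by (subst (asm) ennreal_le_iff) auto
  have jl: "j \<notin> insert l J" using insert by auto
  have "section_vol k (insert j (insert l J)) a t r
      \<le> (\<integral>\<^sup>+u. ennreal (P x J (t - a j * u) (r - \<bar>u\<bar>)) - ennreal (P y J (t - a j * u) (r - \<bar>u\<bar>)) \<partial>lborel)"
    unfolding section_vol_insert[OF finite.insertI[OF insert.hyps(1)] jl]
    using IH(1) Pnn[OF b(2), of J] insert.prems(2) by (intro nn_integral_mono) (simp add: ennreal_minus)
  also have "\<dots> = (\<integral>\<^sup>+u. ennreal (P x J (t - a j * u) (r - \<bar>u\<bar>)) \<partial>lborel)
      - (\<integral>\<^sup>+u. ennreal (P y J (t - a j * u) (r - \<bar>u\<bar>)) \<partial>lborel)"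
    using IH(2) by (intro nn_integral_diff) (auto simp: I[OF b(2)] ennreal_leI)
  also have "\<dots> = ennreal (P x (insert j J) t r - P y (insert j J) t r)"
    unfolding I[OF b(2)] I[OF bx] using Pnn[OF b(2), of "insert j J"] insert.prems(2)
    by (intro ennreal_minus) auto
  finally show ?case using leP by (simp add: insert_commute)
qed

text \<open>Letting \<open>x\<close> tend to \<open>x0\<close> from above treats the cases \<open>x0 > y\<close> and \<open>x0 = y\<close> alike; the bound \<open>E\<close> stands
  for an estimate of the difference quotient that has no singularity at \<open>y\<close>.\<close>

lemma section_vol_le_two_cones_limit:
  fixes a :: "'i \<Rightarrow> real" and k l :: 'i and b r t L :: real and J :: "'i set"
  defines "x0 \<equiv> \<bar>a k\<bar>" and "y \<equiv> \<bar>a l\<bar>"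
  defines "f \<equiv> \<lambda>z. (\<Prod>j\<in>J. 2 * z / (z\<^sup>2 - (a j)\<^sup>2)) / fact (Suc (card J)) * (z * r - t) ^ Suc (card J)"
  assumes y: "y \<le> x0" and b: "0 \<le> b" "b < y" and J: "finite J" "l \<notin> J" "\<And>j. j \<in> J \<Longrightarrow> \<bar>a j\<bar> \<le> b"
    and t: "b * r \<le> t" "t \<le> y * r" and r: "0 \<le> r"
    and E: "((\<lambda>x. E x) \<longlongrightarrow> E x0) (at_right x0)"
      "\<forall>\<^sub>F x in at_right x0. (f x - f y) / (x - y) \<le> E x"
  shows "section_vol k (insert l J) a t r \<le> ennreal (2 / (x0 + y) * E x0)"
proof (rule tendsto_lowerbound)
  show "((\<lambda>x. ennreal (2 / (x0 + y) * E x)) \<longlongrightarrow> ennreal (2 / (x0 + y) * E x0)) (at_right x0)"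
    by (intro tendsto_ennrealI tendsto_mult tendsto_const E)
  have "\<forall>\<^sub>F x in at_right x0. x0 < x" by (simp add: eventually_at_right_less)
  with E(2) show "\<forall>\<^sub>F x in at_right x0. section_vol k (insert l J) a t r \<le> ennreal (2 / (x0 + y) * E x)"
  proof eventually_elim
    case (elim x)
    have "y * r \<le> x * r" using r y elim by (intro mult_right_mono) auto
    then have f: "2 / ((x0 + y) * (x - y)) * ((\<Prod>j\<in>J. 2 * z / (z\<^sup>2 - (a j)\<^sup>2)) / fact (Suc (card J)))
      * tpow (Suc (card J)) (z * r - t) = 2 / ((x0 + y) * (x - y)) * f z" if "z = x \<or> z = y" for z
      using that t by (auto simp: f_def tpow_def)
    have "section_vol k (insert l J) a t r \<le> ennreal (2 / ((x0 + y) * (x - y)) * f x - 2 / ((x0 + y) * (x - y)) * f y)"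
      using section_vol_le_two_cones[of a l k x b J r t, folded x0_def y_def] y b J t elim f by simp
    also have "2 / ((x0 + y) * (x - y)) * f x - 2 / ((x0 + y) * (x - y)) * f y = 2 / (x0 + y) * ((f x - f y) / (x - y))"
      by (simp add: right_diff_distrib diff_divide_distrib)
    also have "ennreal \<dots> \<le> ennreal (2 / (x0 + y) * E x)"
      using elim y b by (intro ennreal_leI mult_left_mono) auto
    finally show ?case .
  qed
qed simp

section \<open>Two explicit directions\<close>

text \<open>For the direction of a coordinate axis the recursion computes the volume of an \<open>l_1\<close>-ball of
  radius \<open>r - t\<close>.\<close>

lemma section_vol_axis:
  assumes "finite J" "\<And>j. j \<in> J \<Longrightarrow> a j = 0" "a k = 1" "0 \<le> t"
  shows "section_vol k J a t r = ennreal (2 ^ card J / fact (card J) * tpow (card J) (r - t))"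
  using assms(1,2)
proof (induction J arbitrary: r)
  case empty
  then show ?case using assms(3,4) by (auto simp: section_vol_empty tpow_def)
next
  case (insert j J)
  have "section_vol k (insert j J) a t r = (\<integral>\<^sup>+u. section_vol k J a t (r - \<bar>u\<bar>) \<partial>lborel)"
    using insert by (simp add: section_vol_insert)
  also have "\<dots> = (\<integral>\<^sup>+u. ennreal (2 ^ card J / fact (card J)) * ennreal (tpow (card J) ((r - t) - (1 * \<bar>u\<bar> - 0 * u))) \<partial>lborel)"
    using insert by (intro nn_integral_cong) (simp add: algebra_simps flip: ennreal_mult)
  also have "\<dots> = ennreal (2 ^ card J / fact (card J)) * ennreal (2 / Suc (card J) * tpow (Suc (card J)) (r - t))"
    by (subst nn_integral_cmult, measurable) (subst tpow_kernel, auto)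
  also have "\<dots> = ennreal (2 ^ card J / fact (card J) * (2 / Suc (card J) * tpow (Suc (card J)) (r - t)))"
    by (rule ennreal_mult'[symmetric]) simp
  also have "2 ^ card J / fact (card J) * (2 / Suc (card J) * tpow (Suc (card J)) (r - t))
      = 2 ^ Suc (card J) / fact (Suc (card J)) * tpow (Suc (card J)) (r - t)"
    by (simp add: mult_ac)
  finally show ?case using insert.hyps by simp
qed

text \<open>For a direction proportional to \<open>(1, 1, 0)\<close> the slice at height \<open>u\<close> contributes \<open>(1 - \<bar>u\<bar>) / x\<close> as long
  as it is not empty, that is for \<open>\<bar>u\<bar> \<le> 1 - t / x\<close>. Integration gives the bound.\<close>

lemma section_vol_edge_direction_ge:
  assumes "a k = x" "a l = x" "a c = 0" "c \<noteq> l" "0 \<le> t" "t \<le> x" "0 < x"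
  shows "ennreal (1 / x * (1 - (t / x)\<^sup>2)) \<le> section_vol k {c, l} a t 1"
proof -
  have one: "ennreal (r / x) \<le> section_vol k {l} a t r" if "t \<le> x * r" for r
  proof -
    have r: "t / x \<le> r" "0 \<le> t / x" using that assms by (auto simp: field_simps)
    let ?I = "{- (r - t / x) / 2 .. (r + t / x) / 2}"
    have "emeasure lborel {- (r - p) / 2 .. (r + p) / 2} = ennreal r" if "0 \<le> p" "p \<le> r" for p
      using that by (subst emeasure_lborel_Icc) (simp_all add: field_simps)
    from this[OF r(2,1)] have "ennreal (r / x) = ennreal (1 / x) * emeasure lborel ?I"
      using r assms(7) by (simp flip: ennreal_mult)
    also have "\<dots> = (\<integral>\<^sup>+u. ennreal (1 / x) * indicator ?I u \<partial>lborel)"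
      by (rule nn_integral_cmult_indicator[symmetric]) simp
    also have "\<dots> \<le> (\<integral>\<^sup>+u. section_vol k {} a (t - a l * u) (r - \<bar>u\<bar>) \<partial>lborel)"
    proof (rule nn_integral_mono)
      fix u :: real
      have "\<bar>t - x * u\<bar> / x = \<bar>t / x - u\<bar>"
      proof -
        have "t - x * u = x * (t / x - u)" using assms(7) by (simp add: field_simps)
        then show ?thesis using assms(7) by (simp add: abs_mult)
      qed
      moreover have "\<bar>t / x - u\<bar> \<le> r - \<bar>u\<bar>" if "u \<in> ?I" using that r by (auto simp: abs_if)
      ultimately show "ennreal (1 / x) * indicator ?I u \<le> section_vol k {} a (t - a l * u) (r - \<bar>u\<bar>)"
        using assms by (auto simp: section_vol_empty indicator_def)
    qed
    also have "\<dots> = section_vol k {l} a t r" by (subst section_vol_insert) auto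
    finally show ?thesis .
  qed
  define w where "w = 1 - t / x"
  have w: "0 \<le> w" "w \<le> 1" using assms by (auto simp: w_def)
  \<comment> \<open>On \<open>\<bar>u\<bar> \<le> w\<close> the density is \<open>1 - \<bar>u\<bar> = (w - \<bar>u\<bar>) + (1 - w)\<close>, a sum of two truncated powers.\<close>
  have "1 / x * (1 - (t / x)\<^sup>2) = 1 / x * (w\<^sup>2 + (1 - w) * (2 * w))"
    by (simp add: w_def power2_eq_square algebra_simps)
  then have "ennreal (1 / x * (1 - (t / x)\<^sup>2)) = ennreal (1 / x) * ennreal (w\<^sup>2) + ennreal ((1 - w) / x) * ennreal (2 * w)"
    using w assms(7) by (simp add: distrib_left flip: ennreal_mult ennreal_plus)
  also have "\<dots> = ennreal (1 / x) * (\<integral>\<^sup>+u. ennreal (tpow 1 (w - (1 * \<bar>u\<bar> - 0 * u))) \<partial>lborel)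
      + ennreal ((1 - w) / x) * (\<integral>\<^sup>+u. ennreal (tpow 0 (w - (1 * \<bar>u\<bar> - 0 * u))) \<partial>lborel)"
    using w by (subst (1 2) tpow_kernel) (simp_all add: tpow_def power2_eq_square)
  also have "\<dots> = (\<integral>\<^sup>+u. ennreal (1 / x) * ennreal (tpow 1 (w - (1 * \<bar>u\<bar> - 0 * u))) \<partial>lborel)
      + (\<integral>\<^sup>+u. ennreal ((1 - w) / x) * ennreal (tpow 0 (w - (1 * \<bar>u\<bar> - 0 * u))) \<partial>lborel)"
    by (subst (1 2) nn_integral_cmult) measurable
  also have "\<dots> = (\<integral>\<^sup>+u. ennreal (1 / x) * ennreal (tpow 1 (w - (1 * \<bar>u\<bar> - 0 * u)))
      + ennreal ((1 - w) / x) * ennreal (tpow 0 (w - (1 * \<bar>u\<bar> - 0 * u))) \<partial>lborel)"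
    by (rule nn_integral_add[symmetric]) measurable
  also have "\<dots> \<le> (\<integral>\<^sup>+u. section_vol k {l} a (t - a c * u) (1 - \<bar>u\<bar>) \<partial>lborel)"
  proof (rule nn_integral_mono)
    fix u :: real
    show "ennreal (1 / x) * ennreal (tpow 1 (w - (1 * \<bar>u\<bar> - 0 * u)))
      + ennreal ((1 - w) / x) * ennreal (tpow 0 (w - (1 * \<bar>u\<bar> - 0 * u))) \<le> section_vol k {l} a (t - a c * u) (1 - \<bar>u\<bar>)"
    proof (cases "\<bar>u\<bar> \<le> w")
      case False
      then show ?thesis by (simp add: tpow_def)
    next
      case True
      have "ennreal (1 / x) * ennreal (w - \<bar>u\<bar>) + ennreal ((1 - w) / x) = ennreal ((1 - \<bar>u\<bar>) / x)"
      proof -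
        have "ennreal (1 / x) * ennreal (w - \<bar>u\<bar>) = ennreal ((w - \<bar>u\<bar>) / x)"
          using True assms(7) by (simp flip: ennreal_mult)
        moreover have "ennreal ((w - \<bar>u\<bar>) / x) + ennreal ((1 - w) / x) = ennreal ((w - \<bar>u\<bar>) / x + (1 - w) / x)"
          using True w assms(7) by (intro ennreal_plus[symmetric]) auto
        moreover have "(w - \<bar>u\<bar>) / x + (1 - w) / x = (1 - \<bar>u\<bar>) / x" by (simp flip: add_divide_distrib)
        ultimately show ?thesis by simp
      qed
      moreover have "t \<le> x * (1 - \<bar>u\<bar>)" using True assms(7) by (simp add: w_def field_simps)
      ultimately show ?thesis using one[of "1 - \<bar>u\<bar>"] True assms(3) by (simp add: tpow_def)
    qed
  qed
  also have "\<dots> = section_vol k {c, l} a t 1" using assms(4) by (subst (2) section_vol_insert) auto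
  finally show ?thesis .
qed

section \<open>The section measure in coordinates\<close>

lemma PiM_lborel_translate:
  assumes "finite B"
  shows "distr (\<Pi>\<^sub>M b\<in>B. lborel) (\<Pi>\<^sub>M b\<in>B. lborel) (\<lambda>f. \<lambda>b\<in>B. f b + c b) = (\<Pi>\<^sub>M b\<in>B. (lborel :: real measure))"
proof -
  interpret product_sigma_finite "\<lambda>_. lborel :: real measure" ..
  let ?P = "\<Pi>\<^sub>M b\<in>B. (lborel :: real measure)"
  have T [measurable]: "(\<lambda>f. \<lambda>b\<in>B. f b + c b) \<in> measurable ?P ?P" by measurable
  show ?thesis
  proof (rule PiM_eqI[OF assms])
    fix A :: "'a \<Rightarrow> real set" assume A: "\<And>b. b \<in> B \<Longrightarrow> A b \<in> sets lborel"
    have "(\<lambda>f. \<lambda>b\<in>B. f b + c b) -` Pi\<^sub>E B A \<inter> space ?P = Pi\<^sub>E B (\<lambda>b. (\<lambda>x. c b + x) -` A b)"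
      by (auto simp: space_PiM PiE_iff add.commute)
    then have "emeasure (distr ?P ?P (\<lambda>f. \<lambda>b\<in>B. f b + c b)) (Pi\<^sub>E B A) = emeasure ?P (Pi\<^sub>E B (\<lambda>b. (\<lambda>x. c b + x) -` A b))"
      using A assms by (subst emeasure_distr[OF T]) (auto intro!: sets_PiM_I_finite)
    also have "\<dots> = (\<Prod>b\<in>B. emeasure lborel ((\<lambda>x. c b + x) -` A b))"
    proof (rule emeasure_PiM[OF assms])
      fix b assume "b \<in> B"
      then show "(\<lambda>x. c b + x) -` A b \<in> sets lborel"
        using measurable_sets[of "\<lambda>x. c b + x" borel borel "A b"] A by auto
    qed
    also have "\<dots> = (\<Prod>b\<in>B. emeasure lborel (A b))"
    proof (rule prod.cong)
      fix b assume "b \<in> B"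
      then show "emeasure lborel ((\<lambda>x. c b + x) -` A b) = emeasure lborel (A b)"
        using A[of b] by (subst (2) lborel_distr_plus[of "c b", symmetric]) (simp add: emeasure_distr)
    qed simp
    finally show "emeasure (distr ?P ?P (\<lambda>f. \<lambda>b\<in>B. f b + c b)) (Pi\<^sub>E B A) = (\<Prod>b\<in>B. emeasure lborel (A b))" .
  qed simp
qed

text \<open>A cylinder over a subset of the hyperplane has the same volume whether its axis is the normal
  \<open>a\<close> or an oblique vector \<open>v\<close> of the same height: at height \<open>s\<close> the two differ by the translation by
  \<open>s (a - v)\<close> inside the hyperplane.\<close>

lemma emeasure_flat_lborel_eq_oblique_cylinder:
  fixes a v :: "'a::euclidean_space"
  assumes a: "norm a = 1" and B: "orthonormal_basis_of (hyperplane a 0) B"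
    and S [measurable]: "S \<in> sets borel" and v: "v \<bullet> a = 1"
  shows "emeasure (flat_lborel (t *\<^sub>R a) B) S =
    emeasure lborel {x. x \<bullet> a \<in> {0..1} \<and> t *\<^sub>R a + (x - (x \<bullet> a) *\<^sub>R v) \<in> S}"
    (is "_ = emeasure lborel ?Z")
proof -
  have fin: "finite B" using B by (rule orthonormal_basis_of_finite)
  have Ba: "b \<bullet> a = 0" if "b \<in> B" for b
    using B that span_base[of b B] by (auto simp: orthonormal_basis_of_def hyperplane_def)
  have aa: "a \<bullet> a = 1" using a by (simp add: dot_square_norm)
  have aB: "a \<notin> B" using Ba aa by auto
  have "x \<in> span (insert a B)" for x
  proof -
    have "x - (x \<bullet> a) *\<^sub>R a \<in> span B"
      using B aa by (auto simp: orthonormal_basis_of_def hyperplane_def inner_diff_left)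
    then show ?thesis unfolding span_insert by blast
  qed
  then have C: "orthonormal_basis_of UNIV (insert a B)"
    using B a Ba by (auto simp: orthonormal_basis_of_def pairwise_insert orthogonal_def inner_commute)
  have "a - v \<in> span B"
    using B aa v by (auto simp: orthonormal_basis_of_def hyperplane_def inner_diff_left)
  then obtain c where c: "a - v = (\<Sum>b\<in>B. c b *\<^sub>R b)" using span_finite[OF fin] by auto
  interpret product_sigma_finite "\<lambda>_::'a. lborel :: real measure" ..
  have Zm [measurable]: "?Z \<in> sets borel" by measurable
  let ?P = "\<Pi>\<^sub>M b\<in>B. (lborel :: real measure)"
  let ?h = "\<lambda>f::'a \<Rightarrow> real. \<Sum>b\<in>B. f b *\<^sub>R b"
  let ?F = "\<lambda>f. indicator S (t *\<^sub>R a + ?h f) :: ennreal"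
  have F [measurable]: "?F \<in> borel_measurable ?P" by measurable
  have ind: "indicator ?Z (\<Sum>b\<in>insert a B. (f(a := s)) b *\<^sub>R b)
      = indicator {0..1} s * ?F (\<lambda>b\<in>B. f b + s * c b)" for f and s :: real
  proof -
    have "(\<Sum>b\<in>B. (f(a := s)) b *\<^sub>R b) = ?h f" using aB by (intro sum.cong) auto
    then have sum: "(\<Sum>b\<in>insert a B. (f(a := s)) b *\<^sub>R b) = s *\<^sub>R a + ?h f" using fin aB by simp
    have in_a: "(s *\<^sub>R a + ?h f) \<bullet> a = s" by (simp add: inner_add_left inner_sum_left Ba aa)
    have "?h (\<lambda>b\<in>B. f b + s * c b) = ?h f + s *\<^sub>R (a - v)"
      unfolding c by (simp add: scaleR_add_left sum.distrib scaleR_sum_right)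
    then have "s *\<^sub>R a + ?h f - s *\<^sub>R v = ?h (\<lambda>b\<in>B. f b + s * c b)" by (simp add: algebra_simps)
    then show ?thesis unfolding sum by (simp add: indicator_def in_a)
  qed
  have shift: "(\<integral>\<^sup>+f. ?F (\<lambda>b\<in>B. f b + s * c b) \<partial>?P) = (\<integral>\<^sup>+f. ?F f \<partial>?P)" for s
    by (subst (2) PiM_lborel_translate[OF fin, of "\<lambda>b. s * c b", symmetric]) (simp add: nn_integral_distr)
  have "emeasure lborel ?Z = (\<integral>\<^sup>+x. indicator ?Z x \<partial>flat_lborel 0 (insert a B))"
    by (simp add: flat_lborel_UNIV[OF C])
  also have "\<dots> = (\<integral>\<^sup>+f. indicator ?Z (\<Sum>b\<in>insert a B. f b *\<^sub>R b) \<partial>(\<Pi>\<^sub>M b\<in>insert a B. lborel))"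
    unfolding flat_lborel_def by (subst nn_integral_distr) simp_all
  also have "\<dots> = (\<integral>\<^sup>+s. (\<integral>\<^sup>+f. indicator ?Z (\<Sum>b\<in>insert a B. (f(a := s)) b *\<^sub>R b) \<partial>?P) \<partial>lborel)"
    by (rule product_nn_integral_insert_rev[OF fin aB]) measurable
  also have "\<dots> = (\<integral>\<^sup>+(s::real). (\<integral>\<^sup>+f. ?F f \<partial>?P) * indicator {0..1} s \<partial>lborel)"
  proof (rule nn_integral_cong)
    fix s :: real
    have "(\<integral>\<^sup>+f. indicator {0..1} s * ?F (\<lambda>b\<in>B. f b + s * c b) \<partial>?P)
        = indicator {0..1} s * (\<integral>\<^sup>+f. ?F (\<lambda>b\<in>B. f b + s * c b) \<partial>?P)"
      by (rule nn_integral_cmult) measurable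
    then show "(\<integral>\<^sup>+f. indicator ?Z (\<Sum>b\<in>insert a B. (f(a := s)) b *\<^sub>R b) \<partial>?P)
        = (\<integral>\<^sup>+f. ?F f \<partial>?P) * indicator {0..1} s"
      by (simp only: ind shift mult.commute)
  qed
  also have "\<dots> = (\<integral>\<^sup>+f. ?F f \<partial>?P)"
    by (subst nn_integral_cmult_indicator) simp_all
  also have "\<dots> = (\<integral>\<^sup>+x. indicator S x \<partial>flat_lborel (t *\<^sub>R a) B)"
    unfolding flat_lborel_def by (subst nn_integral_distr) simp_all
  also have "\<dots> = emeasure (flat_lborel (t *\<^sub>R a) B) S"
    by (simp add: flat_lborel_def)
  finally show ?thesis by simp
qed

text \<open>The cylinder whose axis is parallel to the basis vector \<open>e\<close> is evaluated in coordinates. On each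
  line parallel to \<open>e\<close> it is an interval of length \<open>1 / \<bar>a \<bullet> e\<bar>\<close>, or empty.\<close>

lemma emeasure_section_eq_section_vol:
  fixes a e :: "real ^ 'n"
  assumes a: "norm a = 1" and e: "e \<in> Basis" "a \<bullet> e \<noteq> 0"
  shows "emeasure (hyperplane_lborel a t) (l1_unit_ball \<inter> hyperplane a t)
    = section_vol e (Basis - {e}) ((\<bullet>) a) t 1"
proof -
  let ?S = "l1_unit_ball \<inter> hyperplane a t"
  have l1: "l1_unit_ball = {x :: real ^ 'n. (\<Sum>b\<in>Basis. \<bar>x \<bullet> b\<bar>) \<le> 1}"
  proof -
    have "(\<Sum>b\<in>Basis. \<bar>x \<bullet> b\<bar>) = (\<Sum>i\<in>UNIV. \<bar>x $ i\<bar>)" for x :: "real ^ 'n"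
    proof -
      have "inj (\<lambda>i::'n. axis i (1::real))" by (auto simp: inj_on_def axis_eq_axis)
      moreover have "(Basis :: (real ^ 'n) set) = range (\<lambda>i. axis i 1)" by (auto simp: Basis_vec_def)
      ultimately have "(\<Sum>b\<in>Basis. \<bar>x \<bullet> b\<bar>) = (\<Sum>b\<in>range (\<lambda>i. axis i 1). \<bar>x \<bullet> b\<bar>)" by simp
      also have "\<dots> = (\<Sum>i\<in>UNIV. \<bar>x $ i\<bar>)"
        using \<open>inj _\<close> by (subst sum.reindex) (auto simp: inner_axis)
      finally show ?thesis .
    qed
    then show ?thesis by (simp add: l1_unit_ball_def)
  qed
  have S [measurable]: "?S \<in> sets borel"
    unfolding l1 hyperplane_def by measurable
  obtain B where B: "orthonormal_basis_of (hyperplane a 0) B"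
    using orthonormal_basis_of_hyperplane_exists by blast
  define v where "v = e /\<^sub>R (a \<bullet> e)"
  have v: "v \<bullet> a = 1" using e by (simp add: v_def inner_commute)
  have aa: "a \<bullet> a = 1" using a by (simp add: dot_square_norm)
  let ?J = "Basis - {e}"
  let ?P = "\<Pi>\<^sub>M b\<in>?J. (lborel :: real measure)"
  have ins: "insert e ?J = (Basis :: (real ^ 'n) set)" using e by auto
  define W where "W = {x. x \<bullet> a \<in> {t..t+1} \<and> x - (x \<bullet> a - t) *\<^sub>R v \<in> ?S}"
  have W [measurable]: "W \<in> sets borel" unfolding W_def by measurable
  have "emeasure (hyperplane_lborel a t) ?S
      = emeasure lborel {x. x \<bullet> a \<in> {0..1} \<and> t *\<^sub>R a + (x - (x \<bullet> a) *\<^sub>R v) \<in> ?S}"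
    unfolding hyperplane_lborel_eq[OF a B] by (rule emeasure_flat_lborel_eq_oblique_cylinder[OF a B S v])
  also have "\<dots> = emeasure lborel ((\<lambda>x. t *\<^sub>R a + x) -` W)"
    by (intro arg_cong[where f = "emeasure lborel"])
      (auto simp: W_def inner_add_left aa algebra_simps)
  also have "\<dots> = emeasure lborel W"
    by (subst (2) lborel_distr_plus[of "t *\<^sub>R a", symmetric]) (simp add: emeasure_distr)
  also have "\<dots> = (\<integral>\<^sup>+f. indicator W (\<Sum>b\<in>Basis. f b *\<^sub>R b) \<partial>(\<Pi>\<^sub>M b\<in>Basis. lborel))"
    unfolding nn_integral_indicator[OF W[folded sets_lborel], symmetric]
    by (subst lborel_eq, subst nn_integral_distr) simp_all
  also have "\<dots> = (\<integral>\<^sup>+f. (\<integral>\<^sup>+s. indicator W (\<Sum>b\<in>Basis. (f(e := s)) b *\<^sub>R b) \<partial>lborel) \<partial>?P)"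
  proof -
    interpret product_sigma_finite "\<lambda>_::real ^ 'n. lborel :: real measure" ..
    have "finite ?J" "e \<notin> ?J" by auto
    from product_nn_integral_insert[OF this, unfolded ins]
    show ?thesis by measurable
  qed
  also have "\<dots> = (\<integral>\<^sup>+f. ennreal (1 / \<bar>a \<bullet> e\<bar>) * indicator {y \<in> space ?P.
      \<bar>t - (\<Sum>b\<in>?J. (a \<bullet> b) * y b)\<bar> / \<bar>a \<bullet> e\<bar> + (\<Sum>b\<in>?J. \<bar>y b\<bar>) \<le> 1} f \<partial>?P)"
  proof (rule nn_integral_cong)
    fix f :: "real ^ 'n \<Rightarrow> real" assume f: "f \<in> space ?P"
    let ?Q = "\<bar>t - (\<Sum>b\<in>?J. (a \<bullet> b) * f b)\<bar> / \<bar>a \<bullet> e\<bar> + (\<Sum>b\<in>?J. \<bar>f b\<bar>) \<le> 1"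
    define c where "c = (\<Sum>b\<in>?J. (a \<bullet> b) * f b)"
    let ?I = "{s. (a \<bullet> e) * s + c \<in> {t..t+1}}"
    have ind: "(\<Sum>b\<in>Basis. (f(e := s)) b *\<^sub>R b) \<in> W \<longleftrightarrow> s \<in> ?I \<and> ?Q" for s
    proof -
      define x where "x = (\<Sum>b\<in>Basis. (f(e := s)) b *\<^sub>R b)"
      have xb: "x \<bullet> b = (f(e := s)) b" if "b \<in> Basis" for b
        unfolding x_def by (rule inner_sum_left_Basis[OF that])
      have "x \<bullet> a = (\<Sum>b\<in>Basis. (x \<bullet> b) * (a \<bullet> b))" by (rule euclidean_inner)
      also have "\<dots> = (\<Sum>b\<in>insert e ?J. (f(e := s)) b * (a \<bullet> b))"
        unfolding ins by (intro sum.cong) (simp_all add: xb)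
      also have "\<dots> = (a \<bullet> e) * s + c"
        by (subst sum.insert) (auto simp: c_def mult.commute intro!: sum.cong)
      finally have xa: "x \<bullet> a = (a \<bullet> e) * s + c" .
      define z where "z = x - (x \<bullet> a - t) *\<^sub>R v"
      have ze: "z \<bullet> e = (t - c) / (a \<bullet> e)"
        using e by (simp add: z_def inner_diff_left xa xb v_def field_simps)
      have zb: "z \<bullet> b = f b" if "b \<in> ?J" for b
        using that e by (auto simp: z_def inner_diff_left xb v_def inner_Basis)
      have "z \<bullet> a = t" by (simp add: z_def inner_diff_left v)
      moreover have "(\<Sum>b\<in>insert e ?J. \<bar>z \<bullet> b\<bar>) = \<bar>t - c\<bar> / \<bar>a \<bullet> e\<bar> + (\<Sum>b\<in>?J. \<bar>f b\<bar>)"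
        by (subst sum.insert) (auto simp: ze zb intro!: sum.cong)
      ultimately have "z \<in> ?S \<longleftrightarrow> ?Q" unfolding ins by (simp add: l1 hyperplane_def c_def)
      moreover have "x \<in> W \<longleftrightarrow> x \<bullet> a \<in> {t..t+1} \<and> z \<in> ?S" by (simp add: W_def z_def)
      ultimately show ?thesis unfolding x_def[symmetric] xa by simp
    qed
    have I: "emeasure lborel ?I = ennreal (1 / \<bar>a \<bullet> e\<bar>)"
    proof (cases "0 < a \<bullet> e")
      case True
      then have "?I = {(t - c) / (a \<bullet> e) .. (t - c) / (a \<bullet> e) + 1 / (a \<bullet> e)}"
        by (auto simp: field_simps)
      then show ?thesis using True by simp
    next
      case False
      then have "a \<bullet> e < 0" using e by simp
      then have "?I = {(t - c) / (a \<bullet> e) + 1 / (a \<bullet> e) .. (t - c) / (a \<bullet> e)}"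
        by (auto simp: field_simps)
      then show ?thesis using \<open>a \<bullet> e < 0\<close> by simp
    qed
    have "(\<integral>\<^sup>+s. indicator W (\<Sum>b\<in>Basis. (f(e := s)) b *\<^sub>R b) \<partial>lborel)
        = (\<integral>\<^sup>+s. (if ?Q then 1 else 0) * indicator ?I s \<partial>lborel)"
      by (intro nn_integral_cong)
        (auto simp only: indicator_def ind mult_1_left mult_zero_left mult_zero_right simp_thms of_bool_eq split: if_split)
    also have "\<dots> = (if ?Q then 1 else 0) * emeasure lborel ?I"
      by (rule nn_integral_cmult_indicator) measurable
    also note I
    finally show "(\<integral>\<^sup>+s. indicator W (\<Sum>b\<in>Basis. (f(e := s)) b *\<^sub>R b) \<partial>lborel)
      = ennreal (1 / \<bar>a \<bullet> e\<bar>) * indicator {y \<in> space ?P.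
      \<bar>t - (\<Sum>b\<in>?J. (a \<bullet> b) * y b)\<bar> / \<bar>a \<bullet> e\<bar> + (\<Sum>b\<in>?J. \<bar>y b\<bar>) \<le> 1} f"
      using f by (simp add: indicator_def)
  qed
  also have "\<dots> = section_vol e ?J ((\<bullet>) a) t 1"
    unfolding section_vol_def by (rule nn_integral_cmult_indicator) measurable
  finally show ?thesis .
qed

lemma parallel_section_eq:
  fixes a e :: "real ^ 'n"
  assumes "norm a = 1" "e \<in> Basis" "a \<bullet> e \<noteq> 0"
  shows "parallel_section a t = enn2real (section_vol e (Basis - {e}) ((\<bullet>) a) t 1)"
  unfolding parallel_section_def measure_def emeasure_section_eq_section_vol[OF assms] ..

section \<open>Inequalities in four dimensions\<close>

text \<open>This is the comparison of cones for a direction with only two nonzero coordinates \<open>x\<close> and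
  \<open>sqrt (1 - x\<^sup>2)\<close>. Near \<open>x = 1\<close>, where both sides agree, \<open>(x - t) / (1 - t)\<close> is bounded by its value for
  \<open>t = 1 / sqrt 3\<close>. Near \<open>x = 1 / sqrt 2\<close> the factor \<open>2 x\<^sup>2 - 1\<close> vanishes; there \<open>2 x\<^sup>2 - 1 \<ge> x\<^sup>2 - t\<^sup>2\<close>
  allows the factor \<open>x - t\<close> to be cancelled.\<close>

lemma cone_cubic_ineq:
  fixes t x :: real
  assumes t: "0 < t" "1/3 \<le> t\<^sup>2" and x: "t \<le> x" "x \<le> 1" "1 - t\<^sup>2 \<le> x\<^sup>2"
  shows "(x - t)^3 \<le> (1 - t)^3 * (x\<^sup>2 * (2 * x\<^sup>2 - 1))"
proof (cases "x \<le> 77/100")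
  case True
  have "x\<^sup>2 \<le> (77/100)\<^sup>2" using True t x by (intro power_mono) auto
  then have t2: "407/1000 \<le> t\<^sup>2" using x by (simp add: power2_eq_square)
  have t0: "638/1000 \<le> t"
  proof (rule ccontr)
    assume "\<not> ?thesis"
    then have "t\<^sup>2 \<le> (638/1000)\<^sup>2" using t by (intro power_mono) auto
    with \<open>x\<^sup>2 \<le> (77/100)\<^sup>2\<close> x show False by (simp add: power2_eq_square)
  qed
  have "x - t \<le> 365/1000 * (1 - t)" using True t0 by simp
  then have "(x - t)\<^sup>2 \<le> (365/1000 * (1 - t))\<^sup>2" using x by (intro power_mono) auto
  then have a: "(x - t)\<^sup>2 \<le> 134/1000 * (1 - t)\<^sup>2" by (simp add: power_mult_distrib power2_eq_square)
      (use mult_nonneg_nonneg[of "(1-t)" "1-t"] x in \<open>simp add: field_simps\<close>)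
  have "0 \<le> (t - 23/100) * (77/100 - t)" using t0 True x by (intro mult_nonneg_nonneg) auto
  then have "177/1000 \<le> t * (1 - t)" by (simp add: field_simps)
  then have "(407/1000) * (177/1000) \<le> t\<^sup>2 * (t * (1 - t))" using t2 by (intro mult_mono) auto
  then have b: "134/1000 \<le> (1 - t) * (t\<^sup>2 * (2 * t))" by (simp add: algebra_simps)
  have c: "t\<^sup>2 * (2 * t) \<le> x\<^sup>2 * (x + t)" using x t by (intro mult_mono power_mono) auto
  have "134/1000 \<le> (1 - t) * (x\<^sup>2 * (x + t))"
    using b mult_left_mono[OF c, of "1 - t"] x by linarith
  then have "134/1000 * (1 - t)\<^sup>2 \<le> (1 - t) * (x\<^sup>2 * (x + t)) * (1 - t)\<^sup>2"
    by (intro mult_right_mono) auto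
  with a have d: "(x - t)\<^sup>2 \<le> (1 - t)^3 * (x\<^sup>2 * (x + t))"
    by (simp add: power2_eq_square power3_eq_cube field_simps)
  have "(x - t)^3 = (x - t) * (x - t)\<^sup>2" by (simp add: power2_eq_square power3_eq_cube)
  also have "\<dots> \<le> (x - t) * ((1 - t)^3 * (x\<^sup>2 * (x + t)))" using d x by (intro mult_left_mono) auto
  also have "\<dots> = (1 - t)^3 * (x\<^sup>2 * (x\<^sup>2 - t\<^sup>2))" by (simp add: power2_eq_square algebra_simps)
  also have "\<dots> \<le> (1 - t)^3 * (x\<^sup>2 * (2 * x\<^sup>2 - 1))"
    using x by (intro mult_left_mono) auto
  finally show ?thesis .
next
  case False
  \<comment> \<open>The constant \<open>2.36\<close> is just below \<open>1 / (1 - 1 / sqrt 3)\<close>.\<close>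
  define d where "d = 1 - x"
  have d: "0 \<le> d" "d \<le> 23/100" using False x by (auto simp: d_def)
  have t0: "577/1000 \<le> t"
  proof (rule ccontr)
    assume "\<not> ?thesis"
    then have "t\<^sup>2 \<le> (577/1000)\<^sup>2" using t by (intro power_mono) auto
    with t show False by (simp add: power2_eq_square)
  qed
  have "d * (236/100 * (1 - t)) \<le> d * 1" using t0 d by (intro mult_left_mono) auto
  then have "x - t \<le> (1 - t) * (1 - 236/100 * d)" by (simp add: d_def algebra_simps)
  then have "(x - t)^3 \<le> ((1 - t) * (1 - 236/100 * d))^3" using x by (intro power_mono) auto
  also have "\<dots> = (1 - t)^3 * (1 - 236/100 * d)^3" by (simp add: power_mult_distrib)
  also have "\<dots> \<le> (1 - t)^3 * (x\<^sup>2 * (2 * x\<^sup>2 - 1))"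
  proof (rule mult_left_mono)
    have "0 \<le> (d - 23/100)\<^sup>2" by simp
    then have "0 \<le> 10800 - 57088 * d + 51440 * d\<^sup>2" using d by (simp add: power2_eq_square algebra_simps)
    then have "0 \<le> d * ((10800 - 57088 * d + 51440 * d\<^sup>2) / 10000 + 256/1000000 * d\<^sup>2 + 2 * d^3)"
      using d by (intro mult_nonneg_nonneg add_nonneg_nonneg) auto
    moreover have x1: "x = 1 - d" by (simp add: d_def)
    ultimately show "(1 - 236/100 * d)^3 \<le> x\<^sup>2 * (2 * x\<^sup>2 - 1)"
      unfolding x1 by (simp add: power2_eq_square power3_eq_cube field_simps)
  qed (use x in auto)
  finally show ?thesis .
qed

text \<open>Put \<open>X = x - t\<close> and \<open>Y = y - t\<close>. Since \<open>1 \<le> 3 t\<^sup>2\<close>, the last factor is at least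
  \<open>2 X (X + 2 t) + Y (Y + 2 t)\<close>. As \<open>X + Y \<le> sqrt 2 - 2 t\<close> is small, the resulting terms linear in \<open>X, Y\<close>
  dominate multiples of quadratic ones, and a comparison of quadratic forms remains.\<close>

lemma two_cone_cubic_ineq:
  fixes t x y :: real
  assumes t: "0 < t" "1/3 \<le> t\<^sup>2" and x: "t \<le> y" "y \<le> x" "x\<^sup>2 + y\<^sup>2 \<le> 1"
  shows "(x - t)\<^sup>2 + (x - t) * (y - t) + (y - t)\<^sup>2 \<le> (1 - t)^3 * ((x + y) * (2 * x\<^sup>2 + y\<^sup>2 - 1))"
proof -
  define X Y k Z where "X = x - t" and "Y = y - t" and "k = sqrt 2 - 2 * t" and "Z = (1 - t)^3"
  have XY: "0 \<le> Y" "Y \<le> X" using x by (auto simp: X_def Y_def)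
  have s: "14142/10000 \<le> sqrt 2" "sqrt 2 \<le> 14143/10000"
    by (rule real_le_rsqrt, simp add: power2_eq_square, rule real_le_lsqrt, simp_all add: power2_eq_square)
  have "(x + y)\<^sup>2 \<le> 2" using x(3) zero_le_power2[of "x - y"] by (simp add: power2_eq_square algebra_simps)
  then have "x + y \<le> sqrt 2" by (rule real_le_rsqrt)
  then have k: "X + Y \<le> k" by (simp add: X_def Y_def k_def)
  then have k0: "0 \<le> k" using XY by simp
  have t0: "5773/10000 \<le> t"
  proof (rule ccontr)
    assume "\<not> ?thesis"
    then have "t\<^sup>2 \<le> (5773/10000)\<^sup>2" using t by (intro power_mono) auto
    with t show False by (simp add: power2_eq_square)
  qed
  have t1: "t \<le> 7072/10000" using k0 s by (simp add: k_def)
  have Z0: "0 \<le> Z" using t1 by (simp add: Z_def)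
  \<comment> \<open>The tangent of \<open>(1 - t)^3\<close> at \<open>t = 0.5773\<close>, close to the critical value \<open>1 / sqrt 3\<close>.\<close>
  define u where "u = 1 - t"
  have "0 \<le> (u - 4227/10000)\<^sup>2 * (u + 8454/10000)" using t1 by (simp add: u_def)
  then have Z1: "7552/100000 - 5361/10000 * (t - 5773/10000) \<le> Z"
    using t0 by (simp add: Z_def u_def power2_eq_square power3_eq_cube field_simps)
  have "\<bar>sqrt 2 / 2 - t\<bar> \<le> 13/100" using t0 t1 s by (auto simp: abs_if)
  then have "(sqrt 2 / 2 - t)\<^sup>2 \<le> (13/100)\<^sup>2" by (metis abs_le_square_iff abs_of_nonneg divide_nonneg_nonneg zero_le_numeral)
  then have "19324/10000 \<le> 4 * (t * (sqrt 2 - t))" by (simp add: power2_eq_square algebra_simps)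
  then have "(7552/100000 - 5361/10000 * (t - 5773/10000)) * (19324/10000) \<le> Z * (4 * (t * (sqrt 2 - t)))"
    using Z1 Z0 t1 by (intro mult_mono) auto
  then have lam: "55/100 * k \<le> Z * (4 * t * (t + k))" using s t0 unfolding k_def by (simp add: field_simps)
  have tk: "2 * k \<le> t" using s t0 by (simp add: k_def)
  have "0 \<le> Z * (2 * t * (t - 2 * k))" using Z0 t tk by simp
  then have xy: "1375/1000 * k \<le> Z * (12 * t\<^sup>2 + 6 * k * t)"
    using lam by (simp add: power2_eq_square algebra_simps)
  define S where "S = 4 * t\<^sup>2 * (2 * X + Y) + t * (8 * X\<^sup>2 + 6 * (X * Y) + 4 * Y\<^sup>2)"
  have "(x + y) * (2 * x\<^sup>2 + y\<^sup>2 - 3 * t\<^sup>2) = S + (X + Y) * (2 * X\<^sup>2 + Y\<^sup>2)"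
    by (simp add: S_def X_def Y_def power2_eq_square algebra_simps)
  moreover have "0 \<le> (X + Y) * (2 * X\<^sup>2 + Y\<^sup>2)" using XY by simp
  moreover have "(x + y) * (2 * x\<^sup>2 + y\<^sup>2 - 3 * t\<^sup>2) \<le> (x + y) * (2 * x\<^sup>2 + y\<^sup>2 - 1)"
    using t x by (intro mult_left_mono) auto
  ultimately have S: "S \<le> (x + y) * (2 * x\<^sup>2 + y\<^sup>2 - 1)" by linarith
  have main: "X\<^sup>2 + X * Y + Y\<^sup>2 \<le> Z * S"
  proof (cases "k = 0")
    case True
    then have "X = 0" "Y = 0" using k XY by auto
    then show ?thesis by (simp add: S_def)
  next
    case False
    have "4 * t\<^sup>2 * (2 * X + Y) * (X + Y) \<le> 4 * t\<^sup>2 * (2 * X + Y) * k"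
      using k XY by (intro mult_left_mono) auto
    then have "Z * (4 * t\<^sup>2 * (2 * X + Y) * (X + Y) + k * (t * (8 * X\<^sup>2 + 6 * (X * Y) + 4 * Y\<^sup>2))) \<le> Z * (k * S)"
      using Z0 by (intro mult_left_mono) (simp_all add: S_def algebra_simps)
    also have "Z * (4 * t\<^sup>2 * (2 * X + Y) * (X + Y) + k * (t * (8 * X\<^sup>2 + 6 * (X * Y) + 4 * Y\<^sup>2)))
      = Z * (4 * t * (t + k)) * (2 * X\<^sup>2 + Y\<^sup>2) + Z * (12 * t\<^sup>2 + 6 * k * t) * (X * Y)"
      by (simp add: power2_eq_square algebra_simps)
    finally have "Z * (4 * t * (t + k)) * (2 * X\<^sup>2 + Y\<^sup>2) + Z * (12 * t\<^sup>2 + 6 * k * t) * (X * Y) \<le> Z * (k * S)" .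
    moreover have "55/100 * k * (2 * X\<^sup>2 + Y\<^sup>2) \<le> Z * (4 * t * (t + k)) * (2 * X\<^sup>2 + Y\<^sup>2)"
      using lam by (intro mult_right_mono) auto
    moreover have "1375/1000 * k * (X * Y) \<le> Z * (12 * t\<^sup>2 + 6 * k * t) * (X * Y)"
      using xy XY by (intro mult_right_mono) auto
    moreover have "k * (X\<^sup>2 + X * Y + Y\<^sup>2) \<le> k * (55/100 * (2 * X\<^sup>2 + Y\<^sup>2) + 1375/1000 * (X * Y))"
    proof (rule mult_left_mono[OF _ k0])
      have "Y * Y \<le> X * X" "Y * Y \<le> X * Y" using XY by (auto intro: mult_mono)
      then have "0 \<le> 4 * (X * X - Y * Y) + 15 * (X * Y - Y * Y) + Y * Y"
        by (intro add_nonneg_nonneg) auto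
      then show "X\<^sup>2 + X * Y + Y\<^sup>2 \<le> 55/100 * (2 * X\<^sup>2 + Y\<^sup>2) + 1375/1000 * (X * Y)"
        by (simp add: power2_eq_square field_simps)
    qed
    ultimately have "k * (X\<^sup>2 + X * Y + Y\<^sup>2) \<le> k * (Z * S)" by (simp add: algebra_simps)
    then show ?thesis using False k0 by simp
  qed
  also have "\<dots> \<le> Z * ((x + y) * (2 * x\<^sup>2 + y\<^sup>2 - 1))" using S Z0 by (rule mult_left_mono)
  finally show ?thesis by (simp add: X_def Y_def Z_def)
qed

text \<open>Among pairs with the same sum on one side of \<open>c\<close>, the product is smallest when one of the two
  numbers is \<open>c\<close>.\<close>

lemma prod_merge:
  fixes u v c w :: real
  assumes "c \<le> u \<and> c \<le> v \<or> u \<le> c \<and> v \<le> c" and "c + w = u + v"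
  shows "c * w \<le> u * v"
proof -
  have "0 \<le> (u - c) * (v - c)" using assms by (auto intro: mult_nonneg_nonneg mult_nonpos_nonpos)
  moreover have w: "w = u + v - c" using assms by simp
  ultimately show ?thesis unfolding w by (simp add: algebra_simps)
qed

text \<open>For given \<open>x\<close> the product on the right is smallest when the squares \<open>a\<^sup>2, b\<^sup>2, c\<^sup>2\<close>, which are at
  most \<open>t\<^sup>2\<close>, are as unequal as possible: all weight on one of them if \<open>1 - x\<^sup>2 \<le> t\<^sup>2\<close>, and
  \<open>t\<^sup>2, 1 - x\<^sup>2 - t\<^sup>2, 0\<close> otherwise. Two applications of \<open>prod_merge\<close> lead there.\<close>

lemma cone_ineq_4:
  fixes x a b c t :: real
  assumes t: "0 < t" "1/3 \<le> t\<^sup>2" and x: "t < x" "x\<^sup>2 + a\<^sup>2 + b\<^sup>2 + c\<^sup>2 = 1"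
    and abc: "a\<^sup>2 \<le> t\<^sup>2" "b\<^sup>2 \<le> t\<^sup>2" "c\<^sup>2 \<le> t\<^sup>2"
  shows "x\<^sup>2 * (x - t)^3 \<le> (1 - t)^3 * ((x\<^sup>2 - a\<^sup>2) * (x\<^sup>2 - b\<^sup>2) * (x\<^sup>2 - c\<^sup>2))"
proof -
  have x2: "t\<^sup>2 < x\<^sup>2" using t x by (intro power_strict_mono) auto
  have x1: "x\<^sup>2 \<le> 1" using x(2) zero_le_power2[of a] zero_le_power2[of b] zero_le_power2[of c] by linarith
  then have "x \<le> 1" using t x power_le_one_iff[of x 2] by auto
  then have t1: "0 \<le> (1 - t)^3" using x by auto
  define p where "p = (x\<^sup>2 - a\<^sup>2) * (x\<^sup>2 - b\<^sup>2) * (x\<^sup>2 - c\<^sup>2)"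
  show ?thesis
  proof (cases "1 - t\<^sup>2 \<le> x\<^sup>2")
    case True
    have "x\<^sup>2 * (x\<^sup>2 - a\<^sup>2 - b\<^sup>2) \<le> (x\<^sup>2 - a\<^sup>2) * (x\<^sup>2 - b\<^sup>2)"
      by (intro prod_merge) auto
    then have "x\<^sup>2 * (x\<^sup>2 - a\<^sup>2 - b\<^sup>2) * (x\<^sup>2 - c\<^sup>2) \<le> p"
      unfolding p_def using abc x2 by (intro mult_right_mono) auto
    moreover have "x\<^sup>2 * (x\<^sup>2 - a\<^sup>2 - b\<^sup>2 - c\<^sup>2) \<le> (x\<^sup>2 - a\<^sup>2 - b\<^sup>2) * (x\<^sup>2 - c\<^sup>2)"
      by (intro prod_merge) auto
    then have "x\<^sup>2 * (x\<^sup>2 * (x\<^sup>2 - a\<^sup>2 - b\<^sup>2 - c\<^sup>2)) \<le> x\<^sup>2 * ((x\<^sup>2 - a\<^sup>2 - b\<^sup>2) * (x\<^sup>2 - c\<^sup>2))"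
      by (intro mult_left_mono) auto
    moreover have "x\<^sup>2 - a\<^sup>2 - b\<^sup>2 - c\<^sup>2 = 2 * x\<^sup>2 - 1" using x(2) by simp
    ultimately have "x\<^sup>2 * (x\<^sup>2 * (2 * x\<^sup>2 - 1)) \<le> p" by (simp add: mult.assoc)
    then have "(1 - t)^3 * (x\<^sup>2 * (x\<^sup>2 * (2 * x\<^sup>2 - 1))) \<le> (1 - t)^3 * p" using t1 by (rule mult_left_mono)
    moreover have "x\<^sup>2 * (x - t)^3 \<le> x\<^sup>2 * ((1 - t)^3 * (x\<^sup>2 * (2 * x\<^sup>2 - 1)))"
      using cone_cubic_ineq[OF t] x True \<open>x \<le> 1\<close> by (intro mult_left_mono) auto
    ultimately show ?thesis by (simp add: p_def mult_ac)
  next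
    case False
    have "x\<^sup>2 * ((x\<^sup>2 - t\<^sup>2) * (2 * x\<^sup>2 + t\<^sup>2 - 1)) \<le> p"
    proof (cases "a\<^sup>2 + b\<^sup>2 \<le> t\<^sup>2")
      case True
      have "x\<^sup>2 * (x\<^sup>2 - a\<^sup>2 - b\<^sup>2) \<le> (x\<^sup>2 - a\<^sup>2) * (x\<^sup>2 - b\<^sup>2)"
        by (intro prod_merge) auto
      then have "x\<^sup>2 * (x\<^sup>2 - a\<^sup>2 - b\<^sup>2) * (x\<^sup>2 - c\<^sup>2) \<le> p"
        unfolding p_def using abc x2 by (intro mult_right_mono) auto
      moreover have "(x\<^sup>2 - t\<^sup>2) * (2 * x\<^sup>2 + t\<^sup>2 - 1) \<le> (x\<^sup>2 - a\<^sup>2 - b\<^sup>2) * (x\<^sup>2 - c\<^sup>2)"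
        using True abc x(2) by (intro prod_merge) auto
      then have "x\<^sup>2 * ((x\<^sup>2 - t\<^sup>2) * (2 * x\<^sup>2 + t\<^sup>2 - 1)) \<le> x\<^sup>2 * ((x\<^sup>2 - a\<^sup>2 - b\<^sup>2) * (x\<^sup>2 - c\<^sup>2))"
        by (intro mult_left_mono) auto
      ultimately show ?thesis by (simp add: mult.assoc)
    next
      case False
      have "(x\<^sup>2 - t\<^sup>2) * (x\<^sup>2 + t\<^sup>2 - a\<^sup>2 - b\<^sup>2) \<le> (x\<^sup>2 - a\<^sup>2) * (x\<^sup>2 - b\<^sup>2)"
        using abc by (intro prod_merge) auto
      then have "(x\<^sup>2 - t\<^sup>2) * (x\<^sup>2 + t\<^sup>2 - a\<^sup>2 - b\<^sup>2) * (x\<^sup>2 - c\<^sup>2) \<le> p"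
        unfolding p_def using abc x2 by (intro mult_right_mono) auto
      moreover have "x\<^sup>2 * (2 * x\<^sup>2 + t\<^sup>2 - 1) \<le> (x\<^sup>2 + t\<^sup>2 - a\<^sup>2 - b\<^sup>2) * (x\<^sup>2 - c\<^sup>2)"
        using False x(2) by (intro prod_merge) auto
      then have "(x\<^sup>2 - t\<^sup>2) * (x\<^sup>2 * (2 * x\<^sup>2 + t\<^sup>2 - 1)) \<le> (x\<^sup>2 - t\<^sup>2) * ((x\<^sup>2 + t\<^sup>2 - a\<^sup>2 - b\<^sup>2) * (x\<^sup>2 - c\<^sup>2))"
        using x2 by (intro mult_left_mono) auto
      ultimately show ?thesis by (simp add: mult_ac)
    qed
    then have "(1 - t)^3 * (x\<^sup>2 * ((x\<^sup>2 - t\<^sup>2) * (2 * x\<^sup>2 + t\<^sup>2 - 1))) \<le> (1 - t)^3 * p" using t1 by (rule mult_left_mono)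
    moreover have "x\<^sup>2 * (x - t)^3 \<le> x\<^sup>2 * ((1 - t)^3 * ((x\<^sup>2 - t\<^sup>2) * (2 * x\<^sup>2 + t\<^sup>2 - 1)))"
    proof (rule mult_left_mono)
      have "(x - t) * (x - t)\<^sup>2 \<le> (x - t) * ((1 - t)^3 * ((x + t) * (2 * x\<^sup>2 + t\<^sup>2 - 1)))"
        using two_cone_cubic_ineq[OF t, of t x] x False by (intro mult_left_mono) auto
      then show "(x - t)^3 \<le> (1 - t)^3 * ((x\<^sup>2 - t\<^sup>2) * (2 * x\<^sup>2 + t\<^sup>2 - 1))"
        by (simp add: power3_eq_cube power2_eq_square algebra_simps)
    qed simp
    ultimately show ?thesis by (simp add: p_def mult_ac)
  qed
qed

text \<open>Each further dimension contributes the factor \<open>(x - t) / (1 - t) \<le> x\<close>.\<close>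

lemma two_coordinates_ineq:
  fixes x t :: real
  assumes t: "0 < t" "1/3 \<le> t\<^sup>2" and x: "t \<le> x" "x \<le> 1" "1 - t\<^sup>2 \<le> x\<^sup>2" and m: "3 \<le> m"
  shows "(x - t) ^ m \<le> (1 - t) ^ m * (x ^ (m - 1) * (2 * x\<^sup>2 - 1))"
proof -
  define n where "n = m - 3"
  have m: "m = n + 3" using assms by (simp add: n_def)
  have "x - t \<le> (1 - t) * x" using x t by (simp add: algebra_simps mult_left_le)
  then have "(x - t) ^ n \<le> ((1 - t) * x) ^ n" using x by (intro power_mono) auto
  moreover have "(x - t)^3 \<le> (1 - t)^3 * (x\<^sup>2 * (2 * x\<^sup>2 - 1))" by (rule cone_cubic_ineq) fact+
  ultimately have "(x - t) ^ n * (x - t)^3 \<le> ((1 - t) * x) ^ n * ((1 - t)^3 * (x\<^sup>2 * (2 * x\<^sup>2 - 1)))"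
    using x t by (intro mult_mono) auto
  also have "\<dots> = (1 - t) ^ m * (x ^ (m - 1) * (2 * x\<^sup>2 - 1))"
    by (simp add: m power_add power_mult_distrib power2_eq_square power3_eq_cube mult_ac)
  finally show ?thesis by (simp add: m power_add power3_eq_cube)
qed

section \<open>Inequalities in three dimensions\<close>

text \<open>The same two regions as in \<open>cone_cubic_ineq\<close>. With the smaller power the inequality is false for
  \<open>t = 1 / sqrt 3\<close>, already near \<open>x = 1\<close>, where the slopes of both sides force \<open>2 / (1 - t) \<ge> 5\<close>.\<close>

lemma cone_quadratic_ineq_near_axis:
  fixes t x :: real
  assumes t: "638/1000 \<le> t" and x: "t \<le> x" "x \<le> 1" "1 - t\<^sup>2 \<le> x\<^sup>2"
  shows "(x - t)\<^sup>2 \<le> (1 - t)\<^sup>2 * (x * (2 * x\<^sup>2 - 1))"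
proof (cases "x \<le> 77/100")
  case True
  define u where "u = 1 - t"
  have u: "23/100 \<le> u" "u \<le> 362/1000" using t True x by (auto simp: u_def)
  have "0 \<le> (362/1000 - u) * (1 - 1084/1000 * (u + 362/1000))" using u by (intro mult_nonneg_nonneg) auto
  then have a: "u - 23/100 \<le> 1084/1000 * u\<^sup>2" by (simp add: power2_eq_square field_simps)
  have b: "1084/1000 * u\<^sup>2 \<le> (5929/10000 + 77/100 * t) * u\<^sup>2"
    using u by (intro mult_right_mono) (auto simp: u_def)
  have "u\<^sup>2 \<le> (362/1000)\<^sup>2" using u by (intro power_mono) auto
  then have "u\<^sup>2 * (x + 77/100 + t) \<le> (362/1000)\<^sup>2 * (231/100)" using x True t by (intro mult_mono) auto
  then have "0 \<le> (77/100 - x) * (1 - u\<^sup>2 * (x + 77/100 + t))"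
    using True by (intro mult_nonneg_nonneg) (auto simp: power2_eq_square)
  then have c: "x - t \<le> u\<^sup>2 * (x * (x + t))"
    using a b by (simp add: u_def power2_eq_square field_simps)
  have "(x - t)\<^sup>2 \<le> (x - t) * (u\<^sup>2 * (x * (x + t)))"
    unfolding power2_eq_square[of "x - t"] using c x by (intro mult_left_mono) auto
  also have "\<dots> = u\<^sup>2 * (x * (x\<^sup>2 - t\<^sup>2))" by (simp add: power2_eq_square algebra_simps)
  also have "\<dots> \<le> u\<^sup>2 * (x * (2 * x\<^sup>2 - 1))" using x t by (intro mult_left_mono) auto
  finally show ?thesis by (simp add: u_def)
next
  case False
  define d where "d = 1 - x"
  have d: "0 \<le> d" "d \<le> 23/100" using False x by (auto simp: d_def)
  \<comment> \<open>The constant \<open>2.762\<close> is just below \<open>1 / (1 - 0.638)\<close>.\<close>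
  have "d * (2762/1000 * (1 - t)) \<le> d * 1" using t d by (intro mult_left_mono) auto
  then have "x - t \<le> (1 - t) * (1 - 2762/1000 * d)" by (simp add: d_def algebra_simps)
  then have "(x - t)\<^sup>2 \<le> ((1 - t) * (1 - 2762/1000 * d))\<^sup>2" using x by (intro power_mono) auto
  also have "\<dots> = (1 - t)\<^sup>2 * (1 - 2762/1000 * d)\<^sup>2" by (simp add: power_mult_distrib)
  also have "\<dots> \<le> (1 - t)\<^sup>2 * (x * (2 * x\<^sup>2 - 1))"
  proof (rule mult_left_mono)
    have "d * d \<le> 23/100 * d" using d by (intro mult_right_mono) auto
    then have "0 \<le> d * (524/1000 - 1628644/1000000 * d - 2 * d\<^sup>2)"
      using d by (intro mult_nonneg_nonneg) (auto simp: power2_eq_square)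
    moreover have x: "x = 1 - d" by (simp add: d_def)
    ultimately show "(1 - 2762/1000 * d)\<^sup>2 \<le> x * (2 * x\<^sup>2 - 1)"
      unfolding x by (simp add: power2_eq_square field_simps)
  qed (use x in auto)
  finally show ?thesis .
qed

text \<open>With \<open>X = x - t\<close> and \<open>d = t - 0.638\<close>, the constraint on \<open>x\<close> gives \<open>X \<le> 0.1322 - d\<close>. The left side is
  at most \<open>0.548 (x + t) X\<close>, and what remains is linear in \<open>X\<close>.\<close>

lemma cone_quadratic_ineq_off_axis:
  fixes t x :: real
  assumes t: "638/1000 \<le> t" and x: "t \<le> x" "x\<^sup>2 \<le> 1 - t\<^sup>2"
  shows "x * (x - t) \<le> (1 - t)\<^sup>2 * ((x + t) * (2 * x\<^sup>2 + t\<^sup>2 - 1))"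
proof -
  define X d u where "X = x - t" and "d = t - 638/1000" and "u = 1 - t"
  have t2: "(638/1000)\<^sup>2 \<le> t\<^sup>2" using t by (intro power_mono) auto
  have x1: "x \<le> 7702/10000"
  proof (rule ccontr)
    assume "\<not> ?thesis"
    then have "(7702/10000)\<^sup>2 \<le> x\<^sup>2" by (intro power_mono) auto
    with x t2 show False by (simp add: power2_eq_square)
  qed
  have "t\<^sup>2 \<le> x\<^sup>2" using x t by (intro power_mono) auto
  then have t3: "t \<le> 708/1000"
    using x power_mono[of "708/1000" t 2] by (cases "t \<le> 708/1000") (auto simp: power2_eq_square)
  have d: "0 \<le> d" "d \<le> 7/100" using t t3 by (auto simp: d_def)
  have X: "0 \<le> X" "X \<le> 1322/10000 - d" using x x1 by (auto simp: X_def d_def)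
  have ud: "u = 362/1000 - d" "t = 638/1000 + d" by (auto simp: u_def d_def)
  have dd: "d * d \<le> 7/100 * d" using d by (intro mult_right_mono) auto
  have d2: "0 \<le> d * d" by simp
  have u2: "0 \<le> 1310/10000 - 724/1000 * d" "1310/10000 - 724/1000 * d \<le> u\<^sup>2"
    using d d2 by (auto simp: ud power2_eq_square field_simps)
  have "(1310/10000 - 724/1000 * d) * (638/1000 + d) \<le> u\<^sup>2 * t"
    using u2 d by (intro mult_mono) (auto simp: ud)
  then have tu: "3342/10000 - 16/10 * d \<le> 4 * (u\<^sup>2 * t)" using dd d by (simp add: field_simps)
  have "2211/10000 + 3828/1000 * d \<le> 3 * t\<^sup>2 - 1" using d d2 by (simp add: ud power2_eq_square field_simps)
  then have "(1310/10000 - 724/1000 * d) * (2211/10000 + 3828/1000 * d) \<le> u\<^sup>2 * (3 * t\<^sup>2 - 1)"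
    using u2 d by (intro mult_mono) auto
  then have R: "2896/100000 + 1/10 * d \<le> u\<^sup>2 * (3 * t\<^sup>2 - 1)" using dd d by (simp add: field_simps)
  have "X * (548/1000 - 4 * (u\<^sup>2 * t)) \<le> (1322/10000 - d) * (2138/10000 + 16/10 * d)"
    using X tu d by (intro order_trans[OF mult_left_mono mult_right_mono]) auto
  also have "\<dots> \<le> 2896/100000 + 1/10 * d" using d by (simp add: algebra_simps)
  finally have "X * (548/1000) \<le> u\<^sup>2 * (3 * t\<^sup>2 - 1 + 4 * t * X)" using R by (simp add: algebra_simps)
  also have "\<dots> \<le> u\<^sup>2 * (3 * t\<^sup>2 - 1 + 4 * t * X + 2 * X\<^sup>2)" by (intro mult_left_mono) auto
  finally have *: "X * (548/1000) * (x + t) \<le> u\<^sup>2 * (3 * t\<^sup>2 - 1 + 4 * t * X + 2 * X\<^sup>2) * (x + t)"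
    using x t by (intro mult_right_mono) auto
  have "x * X \<le> (548/1000 * (x + t)) * X" using X d by (intro mult_right_mono) (auto simp: X_def ud)
  also have "\<dots> \<le> u\<^sup>2 * ((x + t) * (2 * x\<^sup>2 + t\<^sup>2 - 1))"
    using * by (simp add: X_def power2_eq_square algebra_simps)
  finally show ?thesis by (simp add: X_def u_def)
qed

text \<open>The left side is \<open>(f x - f y) / (x\<^sup>2 - y\<^sup>2)\<close> for \<open>f z = z (z - t)\<^sup>2 / (z\<^sup>2 - \<alpha>)\<close>, in cancelled form, and
  equality holds for \<open>x = y\<close>, \<open>\<alpha> = 0\<close>. In the parameters \<open>\<alpha>\<close>, \<open>\<beta> = (x - y)\<^sup>2 / 2\<close> and \<open>\<eta> = 1/2 - t\<^sup>2\<close> the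
  difference of the two sides vanishes at \<open>\<alpha> = \<beta> = 0\<close>, while \<open>\<alpha> + \<beta> \<le> 2 \<eta> \<le> 0.2\<close>. After replacing the square
  root \<open>w = sqrt (1 - \<alpha> - \<beta>)\<close> by a linear lower bound it is at least \<open>\<alpha>\<close> times a positive quantity plus
  \<open>\<beta>\<close> times a positive quantity.\<close>

lemma two_cone_quadratic_ineq:
  fixes t x y \<alpha> :: real
  assumes t: "638/1000 \<le> t" and x: "t \<le> y" "y \<le> x" "x\<^sup>2 + y\<^sup>2 + \<alpha> = 1" "0 \<le> \<alpha>"
    and \<alpha>: "\<alpha> < y\<^sup>2"
  shows "(x\<^sup>2 * y\<^sup>2 - \<alpha> * (x\<^sup>2 + x * y + y\<^sup>2) + 2 * t * \<alpha> * (x + y) - t\<^sup>2 * x * y - t\<^sup>2 * \<alpha>)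
     / ((x + y) * ((x\<^sup>2 - \<alpha>) * (y\<^sup>2 - \<alpha>))) \<le> sqrt 2 * (1/2 - t\<^sup>2)"
proof -
  define \<sigma> p \<eta> \<beta> m w where "\<sigma> = x + y" and "p = x * y" and "\<eta> = 1/2 - t\<^sup>2" and "\<beta> = (x - y)\<^sup>2 / 2"
    and "m = (x\<^sup>2 - \<alpha>) * (y\<^sup>2 - \<alpha>)" and "w = \<sigma> / sqrt 2"
  have t2: "(638/1000)\<^sup>2 \<le> t\<^sup>2" using t by (intro power_mono) auto
  have p: "p = 1/2 - \<alpha>/2 - \<beta>" using x(3) by (simp add: p_def \<beta>_def power2_eq_square field_simps)
  have w2: "w\<^sup>2 = 1 - (\<alpha> + \<beta>)" using x(3)
    by (simp add: w_def \<sigma>_def \<beta>_def power_divide power2_eq_square field_simps)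
  have sg: "\<sigma>\<^sup>2 = 1 - \<alpha> + 2 * p" using x(3) by (simp add: p_def \<sigma>_def power2_eq_square field_simps)
  have m: "m = p\<^sup>2 - \<alpha> + 2 * \<alpha>\<^sup>2"
  proof -
    have "m = p\<^sup>2 - \<alpha> * (x\<^sup>2 + y\<^sup>2) + \<alpha>\<^sup>2" by (simp add: m_def p_def power2_eq_square algebra_simps)
    also have "x\<^sup>2 + y\<^sup>2 = 1 - \<alpha>" using x(3) by simp
    finally show ?thesis by (simp add: power2_eq_square algebra_simps)
  qed
  have \<beta>0: "0 \<le> \<beta>" by (simp add: \<beta>_def)
  have "(2 * t)\<^sup>2 \<le> \<sigma>\<^sup>2" using x t by (intro power_mono) (auto simp: \<sigma>_def)
  then have s: "\<alpha> + \<beta> \<le> 2 * \<eta>" unfolding sg p \<eta>_def by (simp add: power_mult_distrib)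
  have \<eta>: "0 \<le> \<eta>" "\<eta> \<le> 1/10" using s x \<beta>0 t2 by (auto simp: \<eta>_def power2_eq_square)
  have m0: "0 < m" unfolding m_def using \<alpha> x t power_mono[of y x 2] by (intro mult_pos_pos) (auto simp del: power_mono_iff)
  have \<sigma>0: "0 < \<sigma>" using x t by (simp add: \<sigma>_def)
  \<comment> \<open>The slope \<open>0.55\<close> is slightly above \<open>1/2\<close>, which suffices for \<open>\<alpha> + \<beta> \<le> 0.2\<close>.\<close>
  have w: "1 - 55/100 * (\<alpha> + \<beta>) \<le> w"
  proof (rule power2_le_imp_le)
    define s where "s = \<alpha> + \<beta>"
    have "s * s \<le> 2/10 * s" using s \<eta> x \<beta>0 by (intro mult_right_mono) (auto simp: s_def)
    then have "(1 - 55/100 * s)\<^sup>2 \<le> 1 - s" using x \<beta>0 by (simp add: s_def power2_eq_square algebra_simps)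
    then show "(1 - 55/100 * (\<alpha> + \<beta>))\<^sup>2 \<le> w\<^sup>2" unfolding w2 s_def by simp
    show "0 \<le> w" using \<sigma>0 by (simp add: w_def)
  qed
  have "0 \<le> (\<sigma> - 2 * t)\<^sup>2" by simp
  \<comment> \<open>This is \<open>\<sigma> t \<le> \<sigma>\<^sup>2 / 4 + t\<^sup>2\<close>, with equality for \<open>\<sigma> = 2 t\<close>.\<close>
  then have \<kappa>: "\<eta> - \<alpha>/2 \<le> (\<sigma> - t)\<^sup>2 - p" using sg by (simp add: \<eta>_def power2_eq_square algebra_simps)
  define q where "q = \<alpha>/2 + \<beta>"
  have q: "0 \<le> q" "q \<le> 2 * \<eta>" using s x \<beta>0 by (auto simp: q_def)
  have pq: "p = 1/2 - q" by (simp add: p q_def)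
  have "q * q \<le> q * 1" using q \<eta> by (intro mult_left_mono; linarith)
  moreover have "\<alpha> * \<alpha> \<le> \<alpha> * (1/2)" using \<eta> s x \<beta>0 by (intro mult_left_mono; linarith)
  ultimately have m4: "m \<le> 1/4" unfolding m pq by (simp add: power2_eq_square algebra_simps)
  have k1: "p * (p - t\<^sup>2) - \<alpha> * ((\<sigma> - t)\<^sup>2 - p) \<le> p * (\<eta> - q) - \<alpha> * (\<eta> - \<alpha>/2)"
  proof -
    have "p - t\<^sup>2 = \<eta> - q" by (simp add: pq \<eta>_def)
    then show ?thesis using mult_left_mono[OF \<kappa> x(4)] by simp
  qed
  have k2: "2 * \<eta> * (1 - 55/100 * (\<alpha> + \<beta>)) * m \<le> 2 * \<eta> * w * m"
    using w m0 \<eta> by (intro mult_right_mono mult_left_mono) auto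
  have k3: "2 * \<eta> * m - 275/1000 * \<eta> * (\<alpha> + \<beta>) \<le> 2 * \<eta> * (1 - 55/100 * (\<alpha> + \<beta>)) * m"
  proof -
    have "11/10 * \<eta> * (\<alpha> + \<beta>) * m \<le> 11/10 * \<eta> * (\<alpha> + \<beta>) * (1/4)"
      using m4 \<eta> x \<beta>0 by (intro mult_left_mono) auto
    then show ?thesis by (simp add: algebra_simps)
  qed
  have k4: "p * (\<eta> - q) - \<alpha> * (\<eta> - \<alpha>/2) \<le> 2 * \<eta> * m - 275/1000 * \<eta> * (\<alpha> + \<beta>)"
  proof -
    have a: "\<alpha> * (3/4 - 9/2 * \<eta>) \<le> 2 * \<eta> * (3/4 - 9/2 * \<eta>)"
      using s \<beta>0 \<eta> by (intro mult_right_mono) auto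
    have "0 \<le> (1/10 - \<eta>) * (2375/1000 - 9 * \<eta>)" using \<eta> by (intro mult_nonneg_nonneg) auto
    then have "1775/1000 * \<eta> + 2 * \<eta> * (3/4 - 9/2 * \<eta>) \<le> 1/4" by (simp add: field_simps)
    then have "0 \<le> \<alpha> * (1/4 - 1775/1000 * \<eta> - \<alpha> * (3/4 - 9/2 * \<eta>))"
      using a x by (intro mult_nonneg_nonneg) auto
    moreover have "(1 - 2 * \<eta>) * (\<alpha> + \<beta>) \<le> 1 * (2/10)"
      using \<eta> s x \<beta>0 by (intro mult_mono) auto
    then have "0 \<le> \<beta> * (1/2 - 1275/1000 * \<eta> - (1 - 2 * \<eta>) * (\<alpha> + \<beta>))"
      using \<beta>0 \<eta> by (intro mult_nonneg_nonneg) auto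
    ultimately show ?thesis
      unfolding m pq q_def by (simp add: power2_eq_square field_simps)
  qed
  have "2 * w = sqrt 2 * \<sigma>" by (simp add: w_def field_simps)
  then have "(2 * w) * (\<eta> * m) = (sqrt 2 * \<sigma>) * (\<eta> * m)" by simp
  then have "2 * \<eta> * w * m = sqrt 2 * \<eta> * (\<sigma> * m)" by (simp only: mult_ac)
  with k1 k2 k3 k4 have "p * (p - t\<^sup>2) - \<alpha> * ((\<sigma> - t)\<^sup>2 - p) \<le> sqrt 2 * \<eta> * (\<sigma> * m)" by linarith
  moreover have "x\<^sup>2 * y\<^sup>2 - \<alpha> * (x\<^sup>2 + x * y + y\<^sup>2) + 2 * t * \<alpha> * (x + y) - t\<^sup>2 * x * y - t\<^sup>2 * \<alpha>
      = p * (p - t\<^sup>2) - \<alpha> * ((\<sigma> - t)\<^sup>2 - p)"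
    by (simp add: p_def \<sigma>_def power2_eq_square algebra_simps)
  ultimately show ?thesis
    using m0 \<sigma>0 by (simp add: pos_divide_le_eq flip: \<sigma>_def m_def \<eta>_def)
qed

text \<open>As for \<open>cone_ineq_4\<close>, with the extreme positions \<open>1 - x\<^sup>2, 0\<close> and \<open>t\<^sup>2, 1 - x\<^sup>2 - t\<^sup>2\<close> of the two squares.\<close>

lemma cone_ineq_3:
  fixes x a b t :: real
  assumes t: "638/1000 \<le> t" and x: "t < x" "x\<^sup>2 + a\<^sup>2 + b\<^sup>2 = 1" and ab: "a\<^sup>2 \<le> t\<^sup>2" "b\<^sup>2 \<le> t\<^sup>2"
  shows "x * (x - t)\<^sup>2 \<le> (1 - t)\<^sup>2 * ((x\<^sup>2 - a\<^sup>2) * (x\<^sup>2 - b\<^sup>2))"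
proof -
  have x2: "t\<^sup>2 < x\<^sup>2" using t x by (intro power_strict_mono) auto
  have x1: "x\<^sup>2 \<le> 1" using x(2) zero_le_power2[of a] zero_le_power2[of b] by linarith
  then have "x \<le> 1" using t x power_le_one_iff[of x 2] by auto
  define p where "p = (x\<^sup>2 - a\<^sup>2) * (x\<^sup>2 - b\<^sup>2)"
  show ?thesis
  proof (cases "1 - t\<^sup>2 \<le> x\<^sup>2")
    case True
    have "x\<^sup>2 * (x\<^sup>2 - a\<^sup>2 - b\<^sup>2) \<le> p"
      unfolding p_def by (intro prod_merge) auto
    also have "x\<^sup>2 - a\<^sup>2 - b\<^sup>2 = 2 * x\<^sup>2 - 1" using x(2) by simp
    finally have "(1 - t)\<^sup>2 * (x\<^sup>2 * (2 * x\<^sup>2 - 1)) \<le> (1 - t)\<^sup>2 * p" by (rule mult_left_mono) simp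
    moreover have "x * (x - t)\<^sup>2 \<le> x * ((1 - t)\<^sup>2 * (x * (2 * x\<^sup>2 - 1)))"
      using cone_quadratic_ineq_near_axis[OF t] x True t \<open>x \<le> 1\<close> by (intro mult_left_mono) auto
    ultimately show ?thesis by (simp add: p_def power2_eq_square mult_ac)
  next
    case False
    have "(x\<^sup>2 - t\<^sup>2) * (2 * x\<^sup>2 + t\<^sup>2 - 1) \<le> p"
      unfolding p_def using ab x(2) by (intro prod_merge) auto
    then have "(1 - t)\<^sup>2 * ((x\<^sup>2 - t\<^sup>2) * (2 * x\<^sup>2 + t\<^sup>2 - 1)) \<le> (1 - t)\<^sup>2 * p" by (rule mult_left_mono) simp
    moreover have "(x - t) * (x * (x - t)) \<le> (x - t) * ((1 - t)\<^sup>2 * ((x + t) * (2 * x\<^sup>2 + t\<^sup>2 - 1)))"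
      using cone_quadratic_ineq_off_axis[OF t] x False by (intro mult_left_mono) auto
    moreover have "x\<^sup>2 - t\<^sup>2 = (x - t) * (x + t)" by (simp add: power2_eq_square algebra_simps)
    ultimately show ?thesis by (simp add: p_def power2_eq_square[of "x - t"] mult_ac)
  qed
qed

text \<open>The right side is the quadratic inequality \<open>(1 + sqrt 2) t\<^sup>2 - 2 t + 1 - sqrt 2 / 2 \<ge> 0\<close>; completing the
  square produces the centre \<open>sqrt 2 - 1\<close>, which is smaller than \<open>1 / sqrt 3\<close>.\<close>

lemma threshold_iff:
  fixes t :: real
  assumes t: "1 / sqrt 3 \<le> t"
  shows "sqrt 2 - 1 + sqrt (5 - 7 / sqrt 2) \<le> t \<longleftrightarrow> sqrt 2 * (1/2 - t\<^sup>2) \<le> (1 - t)\<^sup>2"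
proof -
  define s where "s = sqrt 2"
  have s: "s * s = 2" "14142/10000 \<le> s" "s \<le> 14143/10000"
    unfolding s_def
    by (simp, rule real_le_rsqrt, simp add: power2_eq_square, rule real_le_lsqrt, simp_all add: power2_eq_square)
  have "577/1000 \<le> 1 / sqrt 3"
  proof -
    have "sqrt 3 \<le> 17321/10000" by (rule real_le_lsqrt) (simp_all add: power2_eq_square)
    then show ?thesis by (simp add: field_simps)
  qed
  with t s have pos: "0 \<le> t - (s - 1)" by simp
  have q: "7 / s = 7 / 2 * s" using s by (simp add: field_simps)
  have "sqrt 2 - 1 + sqrt (5 - 7 / sqrt 2) \<le> t \<longleftrightarrow> sqrt (5 - 7 / 2 * s) \<le> t - (s - 1)"
    unfolding s_def[symmetric] q by arith
  also have "\<dots> \<longleftrightarrow> 5 - 7 / 2 * s \<le> (t - (s - 1))\<^sup>2"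
    using pos s by (auto intro: real_le_lsqrt dest: sqrt_le_D)
  also have "\<dots> \<longleftrightarrow> (1 + s) * (5 - 7 / 2 * s) \<le> (1 + s) * (t - (s - 1))\<^sup>2"
    using s by (simp add: mult_le_cancel_left)
  also have "(1 + s) * (t - (s - 1))\<^sup>2 - (1 + s) * (5 - 7 / 2 * s) = (1 - t)\<^sup>2 - s * (1/2 - t\<^sup>2)"
  proof -
    have "(1 + s) * (t - (s - 1))\<^sup>2 - (1 + s) * (5 - 7 / 2 * s) - ((1 - t)\<^sup>2 - s * (1/2 - t\<^sup>2))
        = (s * s - 2) * (s - 2 * t + 5/2)"
      by (simp add: power2_eq_square field_simps)
    then show ?thesis using s by simp
  qed
  then have "(1 + s) * (5 - 7 / 2 * s) \<le> (1 + s) * (t - (s - 1))\<^sup>2 \<longleftrightarrow> s * (1/2 - t\<^sup>2) \<le> (1 - t)\<^sup>2"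
    by linarith
  finally show ?thesis by (simp add: s_def)
qed

lemma threshold_bounds:
  "638/1000 \<le> sqrt 2 - 1 + sqrt (5 - 7 / sqrt 2)" "sqrt 2 - 1 + sqrt (5 - 7 / sqrt 2) < 1 / sqrt 2"
proof -
  define s where "s = sqrt 2"
  have s: "s * s = 2" "141421/100000 \<le> s" "s \<le> 141422/100000"
    unfolding s_def
    by (simp, rule real_le_rsqrt, simp add: power2_eq_square, rule real_le_lsqrt, simp_all add: power2_eq_square)
  have q: "7 / s = 7 / 2 * s" "1 / s = s / 2" using s by (simp_all add: field_simps)
  have "2240/10000 \<le> sqrt (5 - 7 / 2 * s)"
    using s by (intro real_le_rsqrt) (simp add: power2_eq_square)
  then show "638/1000 \<le> sqrt 2 - 1 + sqrt (5 - 7 / sqrt 2)" unfolding s_def[symmetric] q using s by linarith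
  have "sqrt (5 - 7 / 2 * s) \<le> 2245/10000"
    using s by (intro real_le_lsqrt) (simp_all add: power2_eq_square)
  then show "sqrt 2 - 1 + sqrt (5 - 7 / sqrt 2) < 1 / sqrt 2" unfolding s_def[symmetric] q using s by linarith
qed

section \<open>Comparison with coordinate sections\<close>

lemma ex_max_abs:
  fixes a :: "'i \<Rightarrow> real"
  assumes "finite J" "J \<noteq> {}"
  obtains l where "l \<in> J" "\<And>j. j \<in> J \<Longrightarrow> \<bar>a j\<bar> \<le> \<bar>a l\<bar>"
proof -
  have "Max ((\<lambda>j. \<bar>a j\<bar>) ` J) \<in> (\<lambda>j. \<bar>a j\<bar>) ` J" using assms by (intro Max_in) auto
  then obtain l where "l \<in> J" "Max ((\<lambda>j. \<bar>a j\<bar>) ` J) = \<bar>a l\<bar>" by auto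
  then show ?thesis using that assms by (metis Max_ge finite_imageI imageI)
qed

lemma ex_min_abs:
  fixes a :: "'i \<Rightarrow> real"
  assumes "finite J" "J \<noteq> {}"
  obtains l where "l \<in> J" "\<And>j. j \<in> J \<Longrightarrow> \<bar>a l\<bar> \<le> \<bar>a j\<bar>"
proof -
  have "Min ((\<lambda>j. \<bar>a j\<bar>) ` J) \<in> (\<lambda>j. \<bar>a j\<bar>) ` J" using assms by (intro Min_in) auto
  then obtain l where "l \<in> J" "Min ((\<lambda>j. \<bar>a j\<bar>) ` J) = \<bar>a l\<bar>" by auto
  then show ?thesis using that assms by (metis Min_le finite_imageI imageI)
qed

lemma ex_max_basis:
  fixes a :: "'a::euclidean_space"
  assumes "norm a = 1"
  obtains e where "e \<in> Basis" "a \<bullet> e \<noteq> 0" "\<And>b. b \<in> Basis - {e} \<Longrightarrow> \<bar>a \<bullet> b\<bar> \<le> \<bar>a \<bullet> e\<bar>"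
    "(a \<bullet> e)\<^sup>2 + (\<Sum>b\<in>Basis - {e}. (a \<bullet> b)\<^sup>2) = 1"
proof -
  obtain e where e: "e \<in> Basis" "\<And>b. b \<in> Basis \<Longrightarrow> \<bar>a \<bullet> b\<bar> \<le> \<bar>a \<bullet> e\<bar>"
    by (rule ex_max_abs[of "Basis :: 'a set" "(\<bullet>) a"]) auto
  have sum: "(\<Sum>b\<in>Basis. (a \<bullet> b)\<^sup>2) = 1"
    using assms euclidean_inner[of a a] by (simp add: power2_eq_square dot_square_norm)
  have "a \<bullet> e \<noteq> 0"
  proof
    assume "a \<bullet> e = 0"
    then have "(\<Sum>b\<in>Basis. (a \<bullet> b)\<^sup>2) = (\<Sum>b\<in>(Basis :: 'a set). 0)" using e(2) by (intro sum.cong) auto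
    then show False using sum by simp
  qed
  moreover have "(a \<bullet> e)\<^sup>2 + (\<Sum>b\<in>Basis - {e}. (a \<bullet> b)\<^sup>2) = 1"
    using sum e(1) by (subst (asm) sum.remove[of _ e]) auto
  ultimately show ?thesis using that e by auto
qed

text \<open>In the case of two vertices put \<open>\<tau> = t / r\<close>. Then \<open>f(z) = \<phi>(z) (z - \<tau>)^3\<close> up to a constant, with a decreasing function \<open>\<phi>\<close>.
  Hence the difference quotient of \<open>f\<close> is at most \<open>\<phi>(z)\<close> times that of \<open>(z - \<tau>)^3\<close>, which is a
  polynomial.\<close>

lemma section_vol_le_axis_4:
  assumes J: "finite J" "card J = 3" "\<And>j. j \<in> J \<Longrightarrow> \<bar>a j\<bar> \<le> \<bar>a k\<bar>"
    and sum: "(a k)\<^sup>2 + (\<Sum>j\<in>J. (a j)\<^sup>2) = 1" and rt: "r \<le> sqrt 3 * t"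
  shows "section_vol k J a t r \<le> ennreal (4 / 3 * tpow 3 (r - t))"
proof -
  obtain l where l: "l \<in> J" "\<And>j. j \<in> J \<Longrightarrow> \<bar>a j\<bar> \<le> \<bar>a l\<bar>" by (rule ex_max_abs[of J a]) (use J in auto)
  have "card (J - {l}) = 2" using J l by simp
  then obtain c d where cd: "J - {l} = {c, d}" "c \<noteq> d" by (auto simp: card_2_iff)
  then have J3: "J = insert l {c, d}" "l \<notin> {c, d}" using l by auto
  define x y C D \<tau> where "x = \<bar>a k\<bar>" and "y = \<bar>a l\<bar>" and "C = (a c)\<^sup>2" and "D = (a d)\<^sup>2" and "\<tau> = t / r"
  have sq: "x\<^sup>2 + y\<^sup>2 + C + D = 1" using sum J3 cd(2) by (simp add: x_def y_def C_def D_def)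
  have yx: "y \<le> x" "C \<le> y\<^sup>2" "D \<le> y\<^sup>2" "0 \<le> C" "0 \<le> D"
    using J(3)[OF l(1)] l(2)[of c] l(2)[of d] J3
    by (auto simp: x_def y_def C_def D_def abs_le_square_iff[symmetric])
  have y2: "y\<^sup>2 \<le> x\<^sup>2" using yx(1) by (intro power_mono) (auto simp: y_def)
  have x0: "0 < x"
  proof (rule ccontr)
    assume "\<not> 0 < x"
    then have "x\<^sup>2 = 0" by (simp add: x_def)
    then show False using sq yx y2 by simp
  qed
  show ?thesis
  proof (cases "0 < r")
    case False
    then show ?thesis using J3 by (simp add: section_vol_nonpos_radius)
  next
    case r: True
    have t: "t = \<tau> * r" using r by (simp add: \<tau>_def)
    have "0 < t" using rt r zero_less_mult_pos[of "sqrt 3" t] by simp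
    then have \<tau>0: "0 < \<tau>" using r by (simp add: \<tau>_def)
    have "1 \<le> sqrt 3 * \<tau>" using rt r by (simp add: \<tau>_def field_simps)
    then have "1\<^sup>2 \<le> (sqrt 3 * \<tau>)\<^sup>2" by (intro power_mono) auto
    then have \<tau>2: "1/3 \<le> \<tau>\<^sup>2" by (simp add: power_mult_distrib)
    have scale: "z * r - t = r * (z - \<tau>)" for z by (simp add: t algebra_simps)
    have x1: "x \<le> 1" using sq yx zero_le_power2[of y] power_le_one_iff[of x 2] x0 by auto
    consider "x \<le> \<tau>" | "y \<le> \<tau>" "\<tau> < x" | "\<tau> < y" using yx by linarith
    then show ?thesis
    proof cases
      case 1
      then have "\<bar>a k\<bar> * r \<le> t" using r by (simp add: t x_def)
      moreover have "1 < (1 + real (card J)) * (t / r)\<^sup>2" using \<tau>2 J by (simp add: \<tau>_def)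
      ultimately have "section_vol k J a t r = 0"
        using J sum r x0 by (intro section_vol_beyond_max_eq_0) (auto simp: x_def)
      then show ?thesis by simp
    next
      case 2
      have lt: "\<bar>a j\<bar> < \<bar>a k\<bar>" if "j \<in> J" for j using l(2)[OF that] 2 by (simp add: x_def y_def)
      have y\<tau>: "y\<^sup>2 \<le> \<tau>\<^sup>2" using 2 by (intro power_mono) (auto simp: y_def)
    have lt2: "(a j)\<^sup>2 < x\<^sup>2" if "j \<in> J" for j
      using power_strict_mono[OF lt[OF that], of 2] by (simp add: x_def)
      have pos: "0 < x\<^sup>2 - y\<^sup>2" "0 < x\<^sup>2 - C" "0 < x\<^sup>2 - D"
        using lt2[of l] lt2[of c] lt2[of d] J3 by (auto simp: y_def C_def D_def)
      have ineq: "x\<^sup>2 * (x - \<tau>)^3 \<le> (1 - \<tau>)^3 * ((x\<^sup>2 - y\<^sup>2) * (x\<^sup>2 - C) * (x\<^sup>2 - D))"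
        using cone_ineq_4[OF \<tau>0 \<tau>2, of x y "a c" "a d"] 2 sq y\<tau> yx by (simp add: C_def D_def)
      have "section_vol k J a t r
          \<le> ennreal ((\<Prod>j\<in>J. 2 * x / (x\<^sup>2 - (a j)\<^sup>2)) / (x * fact (card J)) * tpow (card J) (x * r - t))"
        unfolding x_def using lt x0 J(1) by (intro section_vol_le_cone) (auto simp: x_def)
      also have "(\<Prod>j\<in>J. 2 * x / (x\<^sup>2 - (a j)\<^sup>2)) / (x * fact (card J)) * tpow (card J) (x * r - t)
          = 4 / 3 * (x\<^sup>2 * (x - \<tau>)^3 * r^3 / ((x\<^sup>2 - y\<^sup>2) * (x\<^sup>2 - C) * (x\<^sup>2 - D)))"
      proof -
        have "(\<Prod>j\<in>J. 2 * x / (x\<^sup>2 - (a j)\<^sup>2)) = 2 * x / (x\<^sup>2 - y\<^sup>2) * (2 * x / (x\<^sup>2 - C) * (2 * x / (x\<^sup>2 - D)))"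
          using J3 cd(2) by (simp add: y_def C_def D_def)
        moreover have "tpow (card J) (x * r - t) = r^3 * (x - \<tau>)^3"
          using 2 r J(2) by (simp add: tpow_def scale power_mult_distrib mult_less_0_iff)
        moreover have "2 * x / p * (2 * x / q * (2 * x / s)) / (x * 6) * (R * X) = 4 / 3 * (x\<^sup>2 * X * R / (p * q * s))"
          for p q s R X :: real using x0 by (simp add: power2_eq_square mult_ac)
        moreover have "fact (card J) = (6 :: real)" using J(2) by (simp add: fact_numeral)
        ultimately show ?thesis by (simp only:)
      qed
      also have "\<dots> \<le> 4 / 3 * ((1 - \<tau>)^3 * r^3)"
        using mult_right_mono[OF ineq, of "r^3"] pos r by (simp add: pos_divide_le_eq mult_ac)
      also have "\<dots> = 4 / 3 * tpow 3 (r - t)"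
        using scale[of 1] 2 x1 r by (simp add: tpow_def power_mult_distrib mult_less_0_iff)
      finally show ?thesis by (auto intro: ennreal_leI)
    next
      case 3
      have y\<tau>: "\<tau>\<^sup>2 < y\<^sup>2" using 3 \<tau>0 by (intro power_strict_mono) auto
      \<comment> \<open>Three coordinates cannot all exceed \<open>\<tau>\<close>, because \<open>3 \<tau>\<^sup>2 \<ge> 1\<close>.\<close>
      have C: "C \<le> \<tau>\<^sup>2" "D \<le> \<tau>\<^sup>2" using sq yx y2 y\<tau> \<tau>2 by linarith+
      have pos: "0 < x\<^sup>2 - C - D" using sq y2 y\<tau> \<tau>2 by linarith
      define S where "S z = (z - \<tau>)\<^sup>2 + (z - \<tau>) * (y - \<tau>) + (y - \<tau>)\<^sup>2" for z
      define E where "E z = 2 / 3 * r^3 * (S z / (z\<^sup>2 - C - D))" for z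
      define f where "f z = (\<Prod>j\<in>{c, d}. 2 * z / (z\<^sup>2 - (a j)\<^sup>2)) / fact (Suc (card {c, d})) * (z * r - t) ^ Suc (card {c, d})" for z
      define \<phi> where "\<phi> z = z / (z\<^sup>2 - C) * (z / (z\<^sup>2 - D))" for z
      have f: "f z = 2 / 3 * r^3 * (\<phi> z * (z - \<tau>)^3)" for z
        proof -
        have "2 * z / A * (2 * z / B) / 6 * (r * q)^3 = 2 / 3 * r^3 * (z / A * (z / B) * q^3)" for A B q :: real
          by (simp add: power_mult_distrib)
        moreover have "f z = 2 * z / (z\<^sup>2 - C) * (2 * z / (z\<^sup>2 - D)) / 6 * (r * (z - \<tau>))^3"
          using cd(2) unfolding f_def scale by (simp add: C_def D_def eval_nat_numeral)
        ultimately show ?thesis by (simp only: \<phi>_def)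
      qed
      have "section_vol k (insert l {c, d}) a t r \<le> ennreal (2 / (\<bar>a k\<bar> + \<bar>a l\<bar>) * E \<bar>a k\<bar>)"
      proof (rule section_vol_le_two_cones_limit[where a = a and k = k and l = l and J = "{c, d}" and r = r and t = t and E = E and b = \<tau>])
        show "(E \<longlongrightarrow> E \<bar>a k\<bar>) (at_right \<bar>a k\<bar>)"
          unfolding E_def S_def using pos by (intro tendsto_intros) (simp add: x_def)
        have "\<forall>\<^sub>F z in at_right \<bar>a k\<bar>. \<bar>a k\<bar> < z" by (simp add: eventually_at_right_less)
        then have "\<forall>\<^sub>F z in at_right \<bar>a k\<bar>. (f z - f \<bar>a l\<bar>) / (z - \<bar>a l\<bar>) \<le> E z"
        proof eventually_elim
          case (elim z)
          then have z: "x < z" by (simp add: x_def)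
          have zy: "y < z" "\<tau> < z" using z yx 3 by auto
          have z2: "x\<^sup>2 < z\<^sup>2" using z x0 by (intro power_strict_mono) auto
          have posy: "0 < y\<^sup>2 - C" "0 < y\<^sup>2 - D" using C y\<tau> by auto
          have posz: "0 < z\<^sup>2 - C" "0 < z\<^sup>2 - D" "0 < z\<^sup>2 - C - D" using posy y2 z2 pos by auto
          have mono: "z / (z\<^sup>2 - A) \<le> y / (y\<^sup>2 - A)" if "0 \<le> A" "0 < y\<^sup>2 - A" "0 < z\<^sup>2 - A" for A
          proof -
            have "0 \<le> (z - y) * (z * y + A)" using that zy 3 \<tau>0 by (intro mult_nonneg_nonneg) auto
            then show ?thesis using that by (simp add: divide_le_eq pos_le_divide_eq) (simp add: field_simps power2_eq_square)
          qed
          have \<phi>0: "0 \<le> \<phi> z" unfolding \<phi>_def using posz zy \<tau>0 by (intro mult_nonneg_nonneg) auto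
          have \<phi>1: "\<phi> z \<le> \<phi> y"
            unfolding \<phi>_def using posz posy yx zy 3 \<tau>0 by (intro mult_mono mono) auto
          have \<phi>2: "\<phi> z \<le> 1 / (z\<^sup>2 - C - D)"
          proof -
            have "z\<^sup>2 * (z\<^sup>2 - C - D) \<le> (z\<^sup>2 - C) * (z\<^sup>2 - D)" using yx by (simp add: algebra_simps)
            moreover have "A / V \<le> 1 / W" if "A * W \<le> V" "0 < V" "0 < W" for A V W :: real
              using that by (simp add: field_simps)
            ultimately have "z\<^sup>2 / ((z\<^sup>2 - C) * (z\<^sup>2 - D)) \<le> 1 / (z\<^sup>2 - C - D)"
              using posz mult_pos_pos[OF posz(1,2)] by blast
            then show ?thesis by (simp add: \<phi>_def power2_eq_square)
          qed
          have S0: "0 \<le> S z" unfolding S_def using zy 3 by (intro add_nonneg_nonneg) auto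
          have "\<phi> z * (z - \<tau>)^3 - \<phi> y * (y - \<tau>)^3 \<le> \<phi> z * (z - \<tau>)^3 - \<phi> z * (y - \<tau>)^3"
            using \<phi>1 3 by (intro diff_left_mono mult_right_mono) auto
          also have "\<dots> = (z - y) * (\<phi> z * S z)" by (simp add: S_def power2_eq_square power3_eq_cube algebra_simps)
          also have "\<dots> \<le> (z - y) * (1 / (z\<^sup>2 - C - D) * S z)"
            using \<phi>2 S0 zy by (intro mult_left_mono mult_right_mono) auto
          finally have "(\<phi> z * (z - \<tau>)^3 - \<phi> y * (y - \<tau>)^3) / (z - y) \<le> S z / (z\<^sup>2 - C - D)"
            using zy by (simp add: pos_divide_le_eq mult.commute)
          from mult_left_mono[OF this, of "2 / 3 * r^3"] r
          have "2 / 3 * r^3 * ((\<phi> z * (z - \<tau>)^3 - \<phi> y * (y - \<tau>)^3) / (z - y)) \<le> E z" by (simp add: E_def)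
          then show ?case by (simp add: f right_diff_distrib flip: y_def)
        qed
        then show "\<forall>\<^sub>F z in at_right \<bar>a k\<bar>.
          ((\<Prod>j\<in>{c, d}. 2 * z / (z\<^sup>2 - (a j)\<^sup>2)) / fact (Suc (card {c, d})) * (z * r - t) ^ Suc (card {c, d}) -
           (\<Prod>j\<in>{c, d}. 2 * \<bar>a l\<bar> / (\<bar>a l\<bar>\<^sup>2 - (a j)\<^sup>2)) / fact (Suc (card {c, d})) * (\<bar>a l\<bar> * r - t) ^ Suc (card {c, d})) /
           (z - \<bar>a l\<bar>) \<le> E z" unfolding f_def .
        show "\<bar>a j\<bar> \<le> \<tau>" if "j \<in> {c, d}" for j
          using that C \<tau>0 unfolding C_def D_def by (auto intro: power2_le_imp_le)
        show "\<tau> * r \<le> t" "t \<le> \<bar>a l\<bar> * r" using r 3 by (simp_all add: t y_def)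
      qed (use 3 yx \<tau>0 r J3 in \<open>auto simp: x_def y_def\<close>)
      then have "section_vol k J a t r \<le> ennreal (2 / (x + y) * E x)" using J3 by (simp add: x_def y_def)
      also have "2 / (x + y) * E x = 4 / 3 * r^3 * (S x / ((x + y) * (x\<^sup>2 - C - D)))"
      proof -
        have "2 / p * (2 / 3 * R * (T / q)) = 4 / 3 * R * (T / (p * q))" for p q R T :: real by simp
        then show ?thesis by (simp only: E_def)
      qed
      also have "\<dots> \<le> 4 / 3 * r^3 * (1 - \<tau>)^3"
      proof (rule mult_left_mono)
        have eq: "x\<^sup>2 - C - D = 2 * x\<^sup>2 + y\<^sup>2 - 1" using sq by simp
        have "x\<^sup>2 + y\<^sup>2 \<le> 1" using sq yx by simp
        with two_cone_cubic_ineq[OF \<tau>0 \<tau>2, of y x] 3 yx have "S x \<le> (1 - \<tau>)^3 * ((x + y) * (x\<^sup>2 - C - D))"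
          unfolding S_def eq by auto
        moreover have "0 < (x + y) * (x\<^sup>2 - C - D)" using pos x0 3 \<tau>0 by (intro mult_pos_pos) auto
        ultimately show "S x / ((x + y) * (x\<^sup>2 - C - D)) \<le> (1 - \<tau>)^3" by (simp add: pos_divide_le_eq)
      qed (use r in auto)
      also have "\<dots> = 4 / 3 * tpow 3 (r - t)"
        using scale[of 1] 3 yx x1 r by (simp add: tpow_def power_mult_distrib mult_less_0_iff)
      finally show ?thesis by (auto intro: ennreal_leI)
    qed
  qed
qed

text \<open>The assumption on \<open>sqrt 2 * (1/2 - t\<^sup>2)\<close> is the comparison with the direction \<open>(1, 1, 0) / sqrt 2\<close>; it
  decides the case in which two coordinates exceed \<open>t\<close>.\<close>

lemma section_vol_le_axis_3:
  assumes J: "finite J" "card J = 2" "\<And>j. j \<in> J \<Longrightarrow> \<bar>a j\<bar> \<le> \<bar>a k\<bar>"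
    and sum: "(a k)\<^sup>2 + (\<Sum>j\<in>J. (a j)\<^sup>2) = 1" and t: "638/1000 \<le> t" "sqrt 2 * (1/2 - t\<^sup>2) \<le> (1 - t)\<^sup>2"
  shows "section_vol k J a t 1 \<le> ennreal (2 * (1 - t)\<^sup>2)"
proof -
  obtain l where l: "l \<in> J" "\<And>j. j \<in> J \<Longrightarrow> \<bar>a j\<bar> \<le> \<bar>a l\<bar>" by (rule ex_max_abs[of J a]) (use J in auto)
  have "card (J - {l}) = 1" using J l by simp
  then obtain c where cd: "J - {l} = {c}" by (auto simp: card_1_singleton_iff)
  then have J2: "J = insert l {c}" "l \<notin> {c}" using l by auto
  define x y C where "x = \<bar>a k\<bar>" and "y = \<bar>a l\<bar>" and "C = (a c)\<^sup>2"
  have sq: "x\<^sup>2 + y\<^sup>2 + C = 1" using sum J2 by (simp add: x_def y_def C_def)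
  have yx: "y \<le> x" "C \<le> y\<^sup>2" "0 \<le> C"
    using J(3)[OF l(1)] l(2)[of c] J2 by (auto simp: x_def y_def C_def abs_le_square_iff[symmetric])
  have y2: "y\<^sup>2 \<le> x\<^sup>2" using yx(1) by (intro power_mono) (auto simp: y_def)
  have x0: "0 < x"
  proof (rule ccontr)
    assume "\<not> 0 < x"
    then have "x\<^sup>2 = 0" by (simp add: x_def)
    then show False using sq yx y2 by simp
  qed
  have t2: "(638/1000)\<^sup>2 \<le> t\<^sup>2" using t by (intro power_mono) auto
  then have t3: "1/3 < t\<^sup>2" by (simp add: power2_eq_square)
  consider "x \<le> t" | "y \<le> t" "t < x" | "t < y" using yx by linarith
  then show ?thesis
  proof cases
    case 1
    have "section_vol k J a t 1 = 0"
      using J sum x0 1 t3 by (intro section_vol_beyond_max_eq_0) (auto simp: x_def)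
    then show ?thesis by simp
  next
    case 2
    have lt: "\<bar>a j\<bar> < \<bar>a k\<bar>" if "j \<in> J" for j using l(2)[OF that] 2 by (simp add: x_def y_def)
    have y\<tau>: "y\<^sup>2 \<le> t\<^sup>2" using 2 by (intro power_mono) (auto simp: y_def)
    have lt2: "(a j)\<^sup>2 < x\<^sup>2" if "j \<in> J" for j
      using power_strict_mono[OF lt[OF that], of 2] by (simp add: x_def)
    have pos: "0 < x\<^sup>2 - y\<^sup>2" "0 < x\<^sup>2 - C"
      using lt2[of l] lt2[of c] J2 by (auto simp: y_def C_def)
    have ineq: "x * (x - t)\<^sup>2 \<le> (1 - t)\<^sup>2 * ((x\<^sup>2 - y\<^sup>2) * (x\<^sup>2 - C))"
      using cone_ineq_3[OF t(1), of x y "a c"] 2 sq y\<tau> yx by (simp add: C_def)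
    have "section_vol k J a t 1
        \<le> ennreal ((\<Prod>j\<in>J. 2 * x / (x\<^sup>2 - (a j)\<^sup>2)) / (x * fact (card J)) * tpow (card J) (x * 1 - t))"
      unfolding x_def using lt x0 J(1) by (intro section_vol_le_cone) (auto simp: x_def)
    also have "(\<Prod>j\<in>J. 2 * x / (x\<^sup>2 - (a j)\<^sup>2)) / (x * fact (card J)) * tpow (card J) (x * 1 - t)
        = 2 * (x * (x - t)\<^sup>2 / ((x\<^sup>2 - y\<^sup>2) * (x\<^sup>2 - C)))"
    proof -
      have "(\<Prod>j\<in>J. 2 * x / (x\<^sup>2 - (a j)\<^sup>2)) = 2 * x / (x\<^sup>2 - y\<^sup>2) * (2 * x / (x\<^sup>2 - C))"
        using J2 by (simp add: y_def C_def)
      moreover have "2 * x / p * (2 * x / q) / (x * 2) * T = 2 * (x * T / (p * q))" for p q T :: real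
        using x0 by simp
      moreover have "tpow (card J) (x * 1 - t) = (x - t)\<^sup>2" "fact (card J) = (2 :: real)"
        using 2 J(2) by (simp_all add: tpow_def)
      ultimately show ?thesis by (simp only:)
    qed
    also have "\<dots> \<le> 2 * (1 - t)\<^sup>2" using ineq pos by (simp add: pos_divide_le_eq)
    finally show ?thesis by (auto intro: ennreal_leI)
  next
    case 3
    have yt: "t\<^sup>2 < y\<^sup>2" using 3 t by (intro power_strict_mono) auto
    have C: "C \<le> t\<^sup>2" using sq yx y2 yt t3 by linarith
    have pos: "0 < x\<^sup>2 - C" "0 < y\<^sup>2 - C" using C yt y2 by auto
    define E where "E z = (z\<^sup>2 * y\<^sup>2 - C * (z\<^sup>2 + z * y + y\<^sup>2) + 2 * t * C * (z + y) - t\<^sup>2 * z * y - t\<^sup>2 * C)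
      / ((z\<^sup>2 - C) * (y\<^sup>2 - C))" for z
    define f where "f z = (\<Prod>j\<in>{c}. 2 * z / (z\<^sup>2 - (a j)\<^sup>2)) / fact (Suc (card {c})) * (z * 1 - t) ^ Suc (card {c})" for z
    have f: "f z = z * (z - t)\<^sup>2 / (z\<^sup>2 - C)" for z
    proof -
      have "2 * z / D / 2 * T = z * T / D" for D T :: real by simp
      moreover have "f z = 2 * z / (z\<^sup>2 - C) / 2 * (z - t)\<^sup>2"
        by (simp add: f_def C_def power2_eq_square)
      ultimately show ?thesis by (simp only:)
    qed
    have "section_vol k (insert l {c}) a t 1 \<le> ennreal (2 / (\<bar>a k\<bar> + \<bar>a l\<bar>) * E \<bar>a k\<bar>)"
    proof (rule section_vol_le_two_cones_limit[where a = a and k = k and l = l and J = "{c}" and r = 1 and t = t and E = E and b = t])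
      show "(E \<longlongrightarrow> E \<bar>a k\<bar>) (at_right \<bar>a k\<bar>)"
        unfolding E_def using pos by (intro tendsto_intros) (simp add: x_def)
      have "\<forall>\<^sub>F z in at_right \<bar>a k\<bar>. \<bar>a k\<bar> < z" by (simp add: eventually_at_right_less)
      then have "\<forall>\<^sub>F z in at_right \<bar>a k\<bar>. (f z - f \<bar>a l\<bar>) / (z - \<bar>a l\<bar>) \<le> E z"
      proof eventually_elim
        case (elim z)
        then have z: "x < z" by (simp add: x_def)
        have z2: "x\<^sup>2 < z\<^sup>2" using z x0 by (intro power_strict_mono) auto
        have posz: "0 < z\<^sup>2 - C" using pos z2 by auto
        have "f z - f y = (z * (z - t)\<^sup>2 * (y\<^sup>2 - C) - y * (y - t)\<^sup>2 * (z\<^sup>2 - C)) / ((z\<^sup>2 - C) * (y\<^sup>2 - C))"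
          unfolding f using posz pos by (subst diff_frac_eq) auto
        also have "z * (z - t)\<^sup>2 * (y\<^sup>2 - C) - y * (y - t)\<^sup>2 * (z\<^sup>2 - C)
            = (z - y) * (z\<^sup>2 * y\<^sup>2 - C * (z\<^sup>2 + z * y + y\<^sup>2) + 2 * t * C * (z + y) - t\<^sup>2 * z * y - t\<^sup>2 * C)"
          by (simp add: power2_eq_square algebra_simps)
        finally have "f z - f y = (z - y) * E z" by (simp add: E_def)
        then show ?case using z yx by (simp flip: y_def)
      qed
      then show "\<forall>\<^sub>F z in at_right \<bar>a k\<bar>.
        ((\<Prod>j\<in>{c}. 2 * z / (z\<^sup>2 - (a j)\<^sup>2)) / fact (Suc (card {c})) * (z * 1 - t) ^ Suc (card {c}) -
         (\<Prod>j\<in>{c}. 2 * \<bar>a l\<bar> / (\<bar>a l\<bar>\<^sup>2 - (a j)\<^sup>2)) / fact (Suc (card {c})) * (\<bar>a l\<bar> * 1 - t) ^ Suc (card {c})) /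
         (z - \<bar>a l\<bar>) \<le> E z" unfolding f_def .
      show "\<bar>a j\<bar> \<le> t" if "j \<in> {c}" for j
        using that C t unfolding C_def by (auto intro: power2_le_imp_le)
    qed (use 3 yx t J2 in \<open>auto simp: x_def y_def\<close>)
    then have "section_vol k J a t 1 \<le> ennreal (2 / (x + y) * E x)" using J2 by (simp add: x_def y_def)
    also have "2 / (x + y) * E x \<le> 2 * (sqrt 2 * (1/2 - t\<^sup>2))"
    proof -
      have "C < y\<^sup>2" "t \<le> y" using pos 3 by auto
      note bound = two_cone_quadratic_ineq[OF t(1) this(2) yx(1) sq yx(3) this(1)]
      have "2 / q * (n / p) \<le> 2 * M" if "n / (q * p) \<le> M" for n p q M :: real
        using mult_left_mono[OF that, of 2] by simp
      from this[OF bound] show ?thesis unfolding E_def .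
    qed
    also have "\<dots> \<le> 2 * (1 - t)\<^sup>2" using t(2) by simp
    finally show ?thesis by (auto intro: ennreal_leI)
  qed
qed

text \<open>Let \<open>a_j\<close> be the smallest coordinate and \<open>N = sqrt (1 - a_j\<^sup>2)\<close> the norm of the others. A slice has
  relative distance \<open>(t - a_j u) / (N (r - \<bar>u\<bar>))\<close> from the origin, and this is at least \<open>1 / sqrt 3\<close>
  because \<open>r \<le> sqrt 3 t\<close> and \<open>N\<^sup>2 \<ge> 3 a_j\<^sup>2\<close>. So the induction hypothesis applies to every slice.\<close>

theorem section_vol_le_axis:
  assumes "finite J" "card J = n + 3" "\<And>j. j \<in> J \<Longrightarrow> \<bar>a j\<bar> \<le> \<bar>a k\<bar>"
    and "(a k)\<^sup>2 + (\<Sum>j\<in>J. (a j)\<^sup>2) = 1" and "r \<le> sqrt 3 * t"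
  shows "section_vol k J a t r \<le> ennreal (2 ^ card J / fact (card J) * tpow (card J) (r - t))"
  using assms
proof (induction n arbitrary: J a t r)
  case 0
  then show ?case using section_vol_le_axis_4[of J a k r t] by (simp add: fact_numeral)
next
  case (Suc n)
  note J = Suc.prems(1-3) and sum = Suc.prems(4) and rt = Suc.prems(5)
  obtain j where j: "j \<in> J" "\<And>i. i \<in> J \<Longrightarrow> \<bar>a j\<bar> \<le> \<bar>a i\<bar>" by (rule ex_min_abs[of J a]) (use J in auto)
  define I where "I = J - {j}"
  define m where "m = card I"
  have I: "finite I" "j \<notin> I" "J = insert j I" "card I = n + 3" "card J = Suc m" "m = n + 3"
    using J j by (auto simp: I_def m_def)
  show ?case
  proof (cases "0 < r")
    case False
    then show ?thesis using I by (simp add: section_vol_nonpos_radius)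
  next
    case r: True
    define N where "N = sqrt (1 - (a j)\<^sup>2)"
    have small: "5 * (a j)\<^sup>2 \<le> 1"
    proof -
      have min: "(a j)\<^sup>2 \<le> (a i)\<^sup>2" if "i \<in> J" for i using j(2)[OF that] by (simp add: abs_le_square_iff)
      have "real (card J) * (a j)\<^sup>2 \<le> (\<Sum>i\<in>J. (a i)\<^sup>2)" by (rule sum_bounded_below) (rule min)
      moreover have "(a j)\<^sup>2 \<le> (a k)\<^sup>2" using J(3)[OF j(1)] by (simp add: abs_le_square_iff)
      moreover have "4 * (a j)\<^sup>2 \<le> real (card J) * (a j)\<^sup>2" using J by (intro mult_right_mono) auto
      ultimately show ?thesis using sum by linarith
    qed
    then have N2: "N\<^sup>2 = 1 - (a j)\<^sup>2" by (simp add: N_def)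
    have N: "0 < N" "N \<le> 1" using small zero_le_power2[of "a j"] by (auto simp: N_def)
    have jN: "sqrt 3 * \<bar>a j\<bar> \<le> N"
    proof (rule power2_le_imp_le)
      show "(sqrt 3 * \<bar>a j\<bar>)\<^sup>2 \<le> N\<^sup>2" using small unfolding N2 by (simp add: power_mult_distrib)
    qed (use N in simp)
    have slice: "section_vol k I a (t - a j * u) (r - \<bar>u\<bar>)
      \<le> ennreal (2 ^ m / fact m / N ^ Suc m * tpow m (N * (r - \<bar>u\<bar>) - (t - a j * u)))" for u
    proof -
      define a' where "a' = (\<lambda>i. a i / N)"
      have a': "N * a' i = a i" for i using N by (simp add: a'_def)
      have "section_vol k I a (t - a j * u) (r - \<bar>u\<bar>)
          = section_vol k I (\<lambda>i. N * a' i) (N * ((t - a j * u) / N)) (r - \<bar>u\<bar>)" unfolding a' using N by simp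
      also have "\<dots> = ennreal (1 / N) * section_vol k I a' ((t - a j * u) / N) (r - \<bar>u\<bar>)"
        by (rule section_vol_scale[OF N(1)])
      also have "section_vol k I a' ((t - a j * u) / N) (r - \<bar>u\<bar>)
          \<le> ennreal (2 ^ card I / fact (card I) * tpow (card I) (r - \<bar>u\<bar> - (t - a j * u) / N))"
      proof (rule Suc.IH)
        show "finite I" "card I = n + 3" using I by auto
        show "\<bar>a' i\<bar> \<le> \<bar>a' k\<bar>" if "i \<in> I" for i
          using J(3)[of i] that I N by (auto simp: a'_def divide_right_mono)
        have "(a' k)\<^sup>2 + (\<Sum>i\<in>I. (a' i)\<^sup>2) = ((a k)\<^sup>2 + (\<Sum>i\<in>I. (a i)\<^sup>2)) / N\<^sup>2"
          by (simp add: a'_def power_divide add_divide_distrib sum_divide_distrib)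
        also have "(a k)\<^sup>2 + (\<Sum>i\<in>I. (a i)\<^sup>2) = N\<^sup>2" using sum I N2 by simp
        finally show "(a' k)\<^sup>2 + (\<Sum>i\<in>I. (a' i)\<^sup>2) = 1" using N by simp
        have "sqrt 3 * (a j * u) \<le> sqrt 3 * (\<bar>a j\<bar> * \<bar>u\<bar>)"
          using abs_ge_self[of "a j * u"] by (simp add: abs_mult)
        also have "\<dots> \<le> N * \<bar>u\<bar>" using jN mult_right_mono[of "sqrt 3 * \<bar>a j\<bar>" N "\<bar>u\<bar>"] by (simp add: mult.assoc)
        finally have "sqrt 3 * (a j * u) \<le> N * \<bar>u\<bar>" .
        moreover have "N * r \<le> 1 * r" using N r by (intro mult_right_mono) auto
        then have "N * r \<le> sqrt 3 * t" using rt by simp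
        ultimately have "N * (r - \<bar>u\<bar>) \<le> sqrt 3 * (t - a j * u)" by (simp add: right_diff_distrib)
        then show "r - \<bar>u\<bar> \<le> sqrt 3 * ((t - a j * u) / N)" using N by (simp add: pos_le_divide_eq mult.commute)
      qed
      also have "r - \<bar>u\<bar> - (t - a j * u) / N = (N * (r - \<bar>u\<bar>) - (t - a j * u)) / N"
        using N by (simp add: diff_divide_distrib)
      also have "ennreal (1 / N) * ennreal (2 ^ card I / fact (card I) * tpow (card I) ((N * (r - \<bar>u\<bar>) - (t - a j * u)) / N))
          = ennreal (2 ^ m / fact m / N ^ Suc m * tpow m (N * (r - \<bar>u\<bar>) - (t - a j * u)))"
        using N by (simp add: tpow_divide m_def mult_ac flip: ennreal_mult')
      finally show ?thesis by (simp add: mult_left_mono)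
    qed
    have aN: "\<bar>a j\<bar> < N"
    proof (rule power2_less_imp_less)
      show "\<bar>a j\<bar>\<^sup>2 < N\<^sup>2" using small unfolding N2 by simp
    qed (use N in simp)
    have "section_vol k J a t r \<le> ennreal (2 ^ m / fact m / N ^ Suc m * (2 * N / (N\<^sup>2 - (a j)\<^sup>2) / Suc m) * tpow (Suc m) (N * r - t))"
      unfolding I(3) using N by (intro section_vol_insert_le[where x = N and m = m and C = "2 ^ m / fact m / N ^ Suc m", OF I(1,2) aN _ slice]) auto
    also have "2 ^ m / fact m / N ^ Suc m * (2 * N / (N\<^sup>2 - (a j)\<^sup>2) / Suc m) * tpow (Suc m) (N * r - t)
        = 2 ^ Suc m / fact (Suc m) * (tpow (Suc m) (N * r - t) / (N ^ m * (2 * N\<^sup>2 - 1)))"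
    proof -
      have "N\<^sup>2 - (a j)\<^sup>2 = 2 * N\<^sup>2 - 1" using N2 by simp
      moreover have "P / F / (N * Q) * (2 * N / R / S) * T = 2 * P / (S * F) * (T / (Q * R))" for P F Q R S T :: real
        using N by (simp add: mult_ac)
      ultimately show ?thesis by (simp only: power_Suc fact_Suc)
    qed
    also have "\<dots> \<le> 2 ^ Suc m / fact (Suc m) * tpow (Suc m) (r - t)"
    proof (rule mult_left_mono)
      have pos: "0 < N ^ m * (2 * N\<^sup>2 - 1)" using N small N2 by (intro mult_pos_pos) auto
      show "tpow (Suc m) (N * r - t) / (N ^ m * (2 * N\<^sup>2 - 1)) \<le> tpow (Suc m) (r - t)"
      proof (cases "N * r < t")
        case True
        then show ?thesis by (simp add: tpow_def)
      next
        case False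
        define \<tau> where "\<tau> = t / r"
        have t: "t = \<tau> * r" using r by (simp add: \<tau>_def)
        have "1 \<le> sqrt 3 * \<tau>" using rt r by (simp add: \<tau>_def field_simps)
        then have \<tau>0: "0 < \<tau>" using zero_less_mult_pos[of "sqrt 3" \<tau>] by simp
        have "1\<^sup>2 \<le> (sqrt 3 * \<tau>)\<^sup>2" using \<open>1 \<le> sqrt 3 * \<tau>\<close> by (intro power_mono) auto
        then have \<tau>2: "1/3 \<le> \<tau>\<^sup>2" by (simp add: power_mult_distrib)
        have \<tau>N: "\<tau> \<le> N" using False r by (simp add: \<tau>_def field_simps)
        have "(N - \<tau>) ^ Suc m \<le> (1 - \<tau>) ^ Suc m * (N ^ (Suc m - 1) * (2 * N\<^sup>2 - 1))"
          using \<tau>N N small \<tau>2 I by (intro two_coordinates_ineq[OF \<tau>0 \<tau>2]) (auto simp: N2)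
        then have "(N - \<tau>) ^ Suc m * r ^ Suc m \<le> (1 - \<tau>) ^ Suc m * (N ^ m * (2 * N\<^sup>2 - 1)) * r ^ Suc m"
          using r by (intro mult_right_mono) auto
        then have "((N - \<tau>) * r) ^ Suc m \<le> ((1 - \<tau>) * r) ^ Suc m * (N ^ m * (2 * N\<^sup>2 - 1))"
          by (simp only: power_mult_distrib mult_ac)
        moreover have "(N - \<tau>) * r = N * r - t" "(1 - \<tau>) * r = r - t" by (simp_all add: t algebra_simps)
        moreover have "N * r \<le> r" using N r by simp
        ultimately show ?thesis using False pos by (simp add: tpow_def pos_divide_le_eq del: power_Suc)
      qed
    qed simp
    finally show ?thesis using I(5) by (simp add: ennreal_leI del: power_Suc fact_Suc)
  qed
qed

theorem theorem1p1:
  fixes t :: real and k :: "'n::finite"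
  assumes "1 / sqrt 3 \<le> t" and "t \<le> 1"
  shows "(CARD('n) \<ge> 4 \<longrightarrow>
           (\<forall>a \<in> sphere (0 :: real ^ 'n) 1. parallel_section a t \<le> parallel_section (axis k 1) t) \<and>
           parallel_section (axis k 1) t =
             2 ^ (CARD('n) - 1) / fact (CARD('n) - 1) * (1 - t) ^ (CARD('n) - 1)) \<and>
         (CARD('n) = 3 \<longrightarrow>
           ((\<forall>a \<in> sphere (0 :: real ^ 'n) 1. parallel_section a t \<le> parallel_section (axis k 1) t) \<longleftrightarrow>
            t \<in> {sqrt 2 - 1 + sqrt (5 - 7 / sqrt 2) .. 1}))"
proof -
  let ?m = "CARD('n) - 1"
  have t0: "0 \<le> t" using assms(1) by (rule order_trans[rotated]) simp
  have card: "card (Basis - {e}) = ?m" if "e \<in> Basis" for e :: "real ^ 'n"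
    using that by (simp add: card_Diff_singleton)
  have axis: "parallel_section (axis k 1 :: real ^ 'n) t = 2 ^ ?m / fact ?m * (1 - t) ^ ?m"
  proof -
    let ?e = "axis k 1 :: real ^ 'n"
    have e: "?e \<in> Basis" by (simp add: axis_in_Basis_iff)
    have "section_vol ?e (Basis - {?e}) ((\<bullet>) ?e) t 1 = ennreal (2 ^ ?m / fact ?m * tpow ?m (1 - t))"
      by (subst section_vol_axis) (use e t0 in \<open>auto simp: inner_Basis card\<close>)
    then show ?thesis
      using e assms by (subst parallel_section_eq[of _ ?e]) (auto simp: tpow_def)
  qed
  have le: "parallel_section a t \<le> 2 ^ ?m / fact ?m * (1 - t) ^ ?m"
    if n: "4 \<le> CARD('n)" and a: "norm a = 1" for a :: "real ^ 'n"
  proof -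
    obtain e where e: "e \<in> Basis" "a \<bullet> e \<noteq> 0" "\<And>b. b \<in> Basis - {e} \<Longrightarrow> \<bar>a \<bullet> b\<bar> \<le> \<bar>a \<bullet> e\<bar>"
      "(a \<bullet> e)\<^sup>2 + (\<Sum>b\<in>Basis - {e}. (a \<bullet> b)\<^sup>2) = 1" using ex_max_basis[OF a] by blast
    have "1 \<le> sqrt 3 * t" using assms by (simp add: field_simps)
    then have "section_vol e (Basis - {e}) ((\<bullet>) a) t 1 \<le> ennreal (2 ^ ?m / fact ?m * tpow ?m (1 - t))"
      using section_vol_le_axis[of "Basis - {e}" "CARD('n) - 4" "(\<bullet>) a" e 1 t] n e card[OF e(1)] by simp
    then show ?thesis
      unfolding parallel_section_eq[OF a e(1,2)] using assms by (intro enn2real_leI) (auto simp: tpow_def)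
  qed
  have le3: "parallel_section a t \<le> 2 * (1 - t)\<^sup>2"
    if n: "CARD('n) = 3" and a: "norm a = 1" and t3: "sqrt 2 - 1 + sqrt (5 - 7 / sqrt 2) \<le> t" for a :: "real ^ 'n"
  proof -
    obtain e where e: "e \<in> Basis" "a \<bullet> e \<noteq> 0" "\<And>b. b \<in> Basis - {e} \<Longrightarrow> \<bar>a \<bullet> b\<bar> \<le> \<bar>a \<bullet> e\<bar>"
      "(a \<bullet> e)\<^sup>2 + (\<Sum>b\<in>Basis - {e}. (a \<bullet> b)\<^sup>2) = 1" using ex_max_basis[OF a] by blast
    have "638/1000 \<le> t" using t3 threshold_bounds(1) by linarith
    moreover have "sqrt 2 * (1/2 - t\<^sup>2) \<le> (1 - t)\<^sup>2" using t3 threshold_iff[OF assms(1)] by simp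
    ultimately have "section_vol e (Basis - {e}) ((\<bullet>) a) t 1 \<le> ennreal (2 * (1 - t)\<^sup>2)"
      using e card[OF e(1)] n by (intro section_vol_le_axis_3) auto
    then show ?thesis unfolding parallel_section_eq[OF a e(1,2)] by (intro enn2real_leI) auto
  qed
  have gt3: "\<exists>a \<in> sphere (0 :: real ^ 'n) 1. 2 * (1 - t)\<^sup>2 < parallel_section a t"
    if n: "CARD('n) = 3" and t3: "t < sqrt 2 - 1 + sqrt (5 - 7 / sqrt 2)"
  proof -
    have "card (UNIV - {k}) = 2" using n by simp
    then obtain l c where lc: "UNIV - {k} = {l, c}" "l \<noteq> c" unfolding card_2_iff by blast
    let ?ax = "\<lambda>i. axis i 1 :: real ^ 'n"
    have UNIV: "UNIV = {k, l, c}" "k \<noteq> l" "k \<noteq> c" using lc by auto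
    have ax: "?ax i \<bullet> ?ax j = (if i = j then 1 else 0)" for i j by (simp add: inner_axis_axis)
    define x where "x = 1 / sqrt 2"
    have x: "0 < x" "x\<^sup>2 = 1/2" by (simp_all add: x_def power_divide)
    define a where "a = x *\<^sub>R (?ax k + ?ax l)"
    have ai: "a \<bullet> ?ax k = x" "a \<bullet> ?ax l = x" "a \<bullet> ?ax c = 0"
      using UNIV lc(2) by (simp_all add: a_def inner_add_left ax)
    have "a \<bullet> a = 2 * x\<^sup>2" using UNIV by (simp add: a_def inner_add_left inner_add_right ax power2_eq_square)
    then have a: "norm a = 1" using x by (simp add: norm_eq_sqrt_inner)
    have B: "(Basis :: (real ^ 'n) set) - {?ax k} = {?ax c, ?ax l}"
    proof -
      have "(Basis :: (real ^ 'n) set) = range ?ax" by (auto simp: Basis_vec_def)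
      also have "\<dots> = {?ax k, ?ax l, ?ax c}" by (simp add: UNIV(1))
      finally show ?thesis using UNIV by (auto simp: axis_eq_axis)
    qed
    have tx: "t \<le> x" using t3 threshold_bounds(2) by (simp add: x_def)
    have "ennreal (1 / x * (1 - (t / x)\<^sup>2)) \<le> section_vol (?ax k) (Basis - {?ax k}) ((\<bullet>) a) t 1"
      unfolding B using ai lc(2) t0 tx x
      by (intro section_vol_edge_direction_ge) (auto simp: axis_eq_axis)
    \<comment> \<open>Finiteness, so that the bound survives the conversion to reals.\<close>
    moreover have "section_vol (?ax k) (insert (?ax l) {?ax c}) ((\<bullet>) a) t 1 < top"
    proof -
      have "?ax l \<notin> {?ax c}" using lc(2) by (simp add: axis_eq_axis)
      then show ?thesis
        by (intro le_less_trans[OF conjunct1[OF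
              section_vol_le_two_cones[of "(\<bullet>) a" "?ax l" "?ax k" "x + 1" 0 "{?ax c}" 1 t]] ennreal_less_top])
          (use ai x t0 in auto)
    qed
    then have "section_vol (?ax k) (Basis - {?ax k}) ((\<bullet>) a) t 1 < top" unfolding B by (simp add: insert_commute)
    ultimately have "enn2real (ennreal (1 / x * (1 - (t / x)\<^sup>2))) \<le> parallel_section a t"
      using ai x by (subst parallel_section_eq[OF a, of "?ax k"]) (auto intro: enn2real_mono simp: axis_in_Basis_iff)
    moreover have "(t / x)\<^sup>2 \<le> 1" using t0 tx x by (intro power_le_one) auto
    ultimately have "1 / x * (1 - (t / x)\<^sup>2) \<le> parallel_section a t"
      using x by (subst (asm) enn2real_ennreal) auto
    moreover have "1 / x * (1 - (t / x)\<^sup>2) = 2 * (sqrt 2 * (1/2 - t\<^sup>2))"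
      using x by (simp add: power_divide) (simp add: x_def field_simps)
    moreover have "(1 - t)\<^sup>2 < sqrt 2 * (1/2 - t\<^sup>2)" using t3 threshold_iff[OF assms(1)] by simp
    ultimately show ?thesis using a by (intro bexI[of _ a]) auto
  qed
  show ?thesis
  proof (intro conjI impI)
    assume n: "4 \<le> CARD('n)"
    show "\<forall>a\<in>sphere (0 :: real ^ 'n) 1. parallel_section a t \<le> parallel_section (axis k 1) t"
      unfolding axis using le[OF n] by simp
    show "parallel_section (axis k 1 :: real ^ 'n) t = 2 ^ ?m / fact ?m * (1 - t) ^ ?m" by (rule axis)
  next
    assume n: "CARD('n) = 3"
    then have "2 ^ ?m / fact ?m * (1 - t) ^ ?m = 2 * (1 - t)\<^sup>2" by simp
    then show "(\<forall>a \<in> sphere (0 :: real ^ 'n) 1. parallel_section a t \<le> parallel_section (axis k 1) t) \<longleftrightarrow>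
            t \<in> {sqrt 2 - 1 + sqrt (5 - 7 / sqrt 2) .. 1}"
      unfolding axis using le3[OF n] gt3[OF n] assms(2) by (force simp: not_le)
  qed
qed

end
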